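(* Let $d,p\in\mathbb{N}$, let $f\in C_b^1(\mathbb{R}^d,\mathbb{R}^d)$, $\sigma\in C_b^2(\mathbb{R}^d,\mathbb{R}^{d\times p})$, let $\mathsf{a}:=\frac12\sigma\sigma'\in C_b^2(\mathbb{R}^d,\mathbb{R}^{d\times d})$, and let $\hat A$ be the second-order differential operator $\hat A\varphi=\operatorname{Tr}(\mathsf{a}\operatorname{Hess}\varphi)+\langle 2\overrightarrow{\operatorname{div}}(\mathsf{a})-f,\operatorname{grad}\varphi\rangle$ (acting in the space variable). Let $T>0$, let $a<b$ be real numbers, let $k\in C(\mathbb{R}^d,[0,\infty))$, and let $\psi:\mathbb{R}^d\to\mathbb{R}$ be an at most polynomially growing function. Suppose that $u\in C_b^{1,2}((0,T]\times\mathbb{R}^d,\mathbb{R})$ satisfies the Cauchy problem $$\frac{\partial u}{\partial t}(t,x)+k(x)u(t,x)=\hat A u(t,x),\quad (t,x)\in(0,T]\times\mathbb{R}^d,\qquad u(0,x)=\psi(x),\quad x\in\mathbb{R}^d.$$ Let $\xi:\Omega\to[a,b]^d$ be a continuous, uniformly distributed $\mathcal{F}_0$-measurable random variable, and let $\hat{\mathbb{X}}$ be the diffusion generated by $\hat A$ with the property that $\hat{\mathbb{X}}_0=\xi$ $\mathbb{P}$-a.s. Then there exists a unique continuous function $U:[a,b]^d\to\mathbb{R}$ such that $$\mathbb{E}\left[\left|\psi(\hat{\mathbb{X}}_T)\exp\left(-\int_0^T k(\hat{\mathbb{X}}_\tau)\,\mathrm{d}\tau\right)-U(\xi)\right|^2\right]=\inf_{v\in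 C([a,b]^d,\mathbb{R})}\mathbb{E}\left[\left|\psi(\hat{\mathbb{X}}_T)\exp\left(-\int_0^T k(\hat{\mathbb{X}}_\tau)\,\mathrm{d}\tau\right)-v(\xi)\right|^2\right],$$ and for all $x\in[a,b]^d$ we have $U(x)=u(T,x)$.
   Context: $(\Omega,\mathcal{F},\mathbb{P})$ is a probability space with a filtration $(\mathcal{F}_t)_{t\ge0}$ that is right-continuous and such that $\mathcal{F}_0$ contains all $\mathbb{P}$-nullsets of $\mathcal{F}$. $M'$ denotes the transpose of a matrix $M$. $C(A,B)$ denotes the continuous functions from $A$ to $B$. $C_b^k(\mathbb{R}^d,B)$ is the set of bounded $k$-times continuously differentiable functions from $\mathbb{R}^d$ to $B$ with bounded derivatives (of all orders up to $k$). For an interval $I\subset\mathbb{R}$, $C_b^{1,2}(I\times\mathbb{R}^d,\mathbb{R})$ is the set of bounded functions on $I\times\mathbb{R}^d$ that are once continuously differentiable with bounded derivative in the first variable and twice continuously differentiable with bounded derivative in the second variable. For $\mathsf{a}\in C^1(\mathbb{R}^d,\mathbb{R}^{d\times d})$, $\overrightarrow{\operatorname{div}}(\mathsf{a})=\left(\sum_{i=1}^d\partial_i \mathsf{a}_{ij}\right)_{j=1}^d$. A function $\psi:\mathbb{R}^d\to\mathbb{R}$ is at most polynomially growing if there exist $\lambda\ge1$ and $L\ge0$ such that $|\psi(x)|\le L(1+\|x\|^{2\lambda})$ for all $x\in\mathbb{R}^d$. The diffusion generated by $\hat A$ with initial value $\xi$ is the solution of the Itô stochastic differential equation $$\hat{\mathbb{X}}_t=\xi+\int_0^t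 \left(2\overrightarrow{\operatorname{div}}(\mathsf{a})-f\right)(\hat{\mathbb{X}}_s)\,\mathrm{d}s+\int_0^t\sigma(\hat{\mathbb{X}}_s)\,\mathrm{d}\hat W_s,\qquad t\ge0,$$ where $\hat W$ is a $p$-dimensional Brownian motion.
   Formalization: The initial condition u(0,x)=ψ(x) is understood as attained, i.e. u(t,x)→ψ(x) as t→0+ for each x; since u is only assumed regular on (0,T]×R^d, without this the claim fails (e.g. ψ=0, k=0, u=1 for t>0). *)

theory Defs
  imports "HOL-Probability.Probability"
begin

section \<open>Classes of continuously differentiable functions with bounded derivatives\<close>

definition partial_deriv :: "'n::finite \<Rightarrow> (real^'n \<Rightarrow> 'b::real_normed_vector) \<Rightarrow> real^'n \<Rightarrow> 'b" where
  "partial_deriv i f x = frechet_derivative f (at x) (axis i 1)"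

definition bcontinuous_on :: "'a::topological_space set \<Rightarrow> ('a \<Rightarrow> 'b::real_normed_vector) \<Rightarrow> bool" where
  "bcontinuous_on S f \<longleftrightarrow> continuous_on S f \<and> bounded (f ` S)"

text \<open>Bounded \<open>k\<close>-times continuously differentiable functions on \<open>\<real>\<^sup>n\<close> whose derivatives of order
  at most \<open>k\<close> are all bounded.\<close>

fun C_b :: "nat \<Rightarrow> (real^'n::finite \<Rightarrow> 'b::real_normed_vector) set" where
  "C_b 0 = {f. bcontinuous_on UNIV f}"
| "C_b (Suc k) =
    {f. bcontinuous_on UNIV f \<and> (\<forall>x. f differentiable (at x)) \<and> (\<forall>i. partial_deriv i f \<in> C_b k)}"

text \<open>The time derivative is taken within \<open>I\<close>, hence is one-sided at an endpoint belonging to \<open>I\<close>.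
  All derivatives are jointly continuous and bounded on \<open>I \<times> \<real>\<^sup>n\<close>.\<close>

definition time_deriv :: "real set \<Rightarrow> (real \<Rightarrow> real^'n::finite \<Rightarrow> real) \<Rightarrow> real \<Rightarrow> real^'n \<Rightarrow> real" where
  "time_deriv I u t x = vector_derivative (\<lambda>s. u s x) (at t within I)"

definition C_b_1_2 :: "real set \<Rightarrow> (real \<Rightarrow> real^'n::finite \<Rightarrow> real) set" where
  "C_b_1_2 I = {u.
      bcontinuous_on (I \<times> UNIV) (\<lambda>(t, x). u t x) \<and>
      (\<forall>t\<in>I. \<forall>x. (\<lambda>s. u s x) differentiable (at t within I)) \<and>
      bcontinuous_on (I \<times> UNIV) (\<lambda>(t, x). time_deriv I u t x) \<and>
      (\<forall>t\<in>I. \<forall>x. u t differentiable (at x)) \<and>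
      (\<forall>i. bcontinuous_on (I \<times> UNIV) (\<lambda>(t, x). partial_deriv i (u t) x)) \<and>
      (\<forall>t\<in>I. \<forall>x. \<forall>i. partial_deriv i (u t) differentiable (at x)) \<and>
      (\<forall>i j. bcontinuous_on (I \<times> UNIV) (\<lambda>(t, x). partial_deriv i (partial_deriv j (u t)) x))}"

definition at_most_polynomially_growing :: "(real^'n::finite \<Rightarrow> real) \<Rightarrow> bool" where
  "at_most_polynomially_growing \<psi> \<longleftrightarrow>
     (\<exists>l\<ge>1. \<exists>L\<ge>0. \<forall>x. \<bar>\<psi> x\<bar> \<le> L * (1 + norm x powr (2 * l)))"

section \<open>The differential operator and the Cauchy problem\<close>

definition grad :: "(real^'n::finite \<Rightarrow> real) \<Rightarrow> real^'n \<Rightarrow> real^'n" where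
  "grad \<phi> x = (\<chi> i. partial_deriv i \<phi> x)"

definition Hess :: "(real^'n::finite \<Rightarrow> real) \<Rightarrow> real^'n \<Rightarrow> real^'n^'n" where
  "Hess \<phi> x = (\<chi> i j. partial_deriv i (partial_deriv j \<phi>) x)"

definition div_vec :: "(real^'n::finite \<Rightarrow> real^'n^'n) \<Rightarrow> real^'n \<Rightarrow> real^'n" where
  "div_vec \<a> x = (\<chi> j. \<Sum>i\<in>UNIV. partial_deriv i (\<lambda>y. \<a> y $ i $ j) x)"

definition diffusion_matrix :: "(real^'n::finite \<Rightarrow> real^'m::finite^'n) \<Rightarrow> real^'n \<Rightarrow> real^'n^'n" where
  "diffusion_matrix \<sigma> x = (1 / 2) *\<^sub>R (\<sigma> x ** transpose (\<sigma> x))"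

definition drift_hat ::
  "(real^'n::finite \<Rightarrow> real^'n) \<Rightarrow> (real^'n \<Rightarrow> real^'m::finite^'n) \<Rightarrow> real^'n \<Rightarrow> real^'n" where
  "drift_hat f \<sigma> x = 2 *\<^sub>R div_vec (diffusion_matrix \<sigma>) x - f x"

definition A_hat ::
  "(real^'n::finite \<Rightarrow> real^'n) \<Rightarrow> (real^'n \<Rightarrow> real^'m::finite^'n) \<Rightarrow> (real^'n \<Rightarrow> real) \<Rightarrow> real^'n \<Rightarrow> real" where
  "A_hat f \<sigma> \<phi> x = trace (diffusion_matrix \<sigma> x ** Hess \<phi> x) + drift_hat f \<sigma> x \<bullet> grad \<phi> x"

text \<open>The equation holds on \<open>(0, T]\<close> only, so the initial value is required to be attained in the
  limit \<open>t \<rightarrow> 0+\<close>; without this, \<open>u 0\<close> would be unrelated to the values of \<open>u\<close> at positive times.\<close>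

definition solves_Cauchy_problem ::
  "(real^'n::finite \<Rightarrow> real^'n) \<Rightarrow> (real^'n \<Rightarrow> real^'m::finite^'n) \<Rightarrow> (real^'n \<Rightarrow> real) \<Rightarrow> (real^'n \<Rightarrow> real)
    \<Rightarrow> real \<Rightarrow> (real \<Rightarrow> real^'n \<Rightarrow> real) \<Rightarrow> bool" where
  "solves_Cauchy_problem f \<sigma> k \<psi> T u \<longleftrightarrow>
     (\<forall>t\<in>{0<..T}. \<forall>x. time_deriv {0<..T} u t x + k x * u t x = A_hat f \<sigma> (u t) x) \<and>
     (\<forall>x. u 0 x = \<psi> x \<and> ((\<lambda>t. u t x) \<longlongrightarrow> u 0 x) (at_right 0))"

section \<open>Filtrations, Brownian motion and the Ito integral\<close>

text \<open>Time runs through \<open>[0, \<infinity>)\<close>; values at negative times are irrelevant throughout.\<close>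

locale filtered_prob_space = prob_space M for M :: "'a measure" +
  fixes F :: "real \<Rightarrow> 'a measure"
  assumes subalgebra_F: "0 \<le> t \<Longrightarrow> subalgebra M (F t)"
    and F_mono: "0 \<le> s \<Longrightarrow> s \<le> t \<Longrightarrow> sets (F s) \<subseteq> sets (F t)"
    and F_right_continuous: "0 \<le> t \<Longrightarrow> sets (F t) = (\<Inter>s\<in>{t<..}. sets (F s))"
    and null_sets_F: "null_sets M \<subseteq> sets (F 0)"
begin

definition adapted :: "(real \<Rightarrow> 'a \<Rightarrow> 'b::topological_space) \<Rightarrow> bool" where
  "adapted X \<longleftrightarrow> (\<forall>t\<ge>0. X t \<in> borel_measurable (F t))"

definition progressive :: "(real \<Rightarrow> 'a \<Rightarrow> 'b::topological_space) \<Rightarrow> bool" where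
  "progressive H \<longleftrightarrow>
     (\<forall>t\<ge>0. (\<lambda>(s, \<omega>). H s \<omega>) \<in> borel_measurable (restrict_space borel {0..t} \<Otimes>\<^sub>M F t))"

definition brownian_motion :: "(real \<Rightarrow> 'a \<Rightarrow> real^'m::finite) \<Rightarrow> bool" where
  "brownian_motion W \<longleftrightarrow>
     adapted W \<and>
     (AE \<omega> in M. W 0 \<omega> = 0) \<and>
     (AE \<omega> in M. continuous_on {0..} (\<lambda>t. W t \<omega>)) \<and>
     (\<forall>s\<ge>0. \<forall>t>s.
        indep_set (sets (F s)) {(\<lambda>\<omega>. W t \<omega> - W s \<omega>) -` B \<inter> space M | B. B \<in> sets borel} \<and>
        distributed M lborel (\<lambda>\<omega>. W t \<omega> - W s \<omega>)
          (\<lambda>x. ennreal (\<Prod>j\<in>UNIV. normal_density 0 (sqrt (t - s)) (x $ j))))"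

text \<open>\<open>(n, \<tau>, A)\<close> encodes the process \<open>\<Sum>i<n. A i \<sqdot> 1_{(\<tau> i, \<tau> (i+1)]}\<close>.\<close>

definition elementary_process :: "nat \<Rightarrow> (nat \<Rightarrow> real) \<Rightarrow> (nat \<Rightarrow> 'a \<Rightarrow> real^'m::finite^'n::finite) \<Rightarrow> bool" where
  "elementary_process n \<tau> A \<longleftrightarrow>
     (\<forall>i<n. 0 \<le> \<tau> i \<and> \<tau> i \<le> \<tau> (Suc i) \<and> A i \<in> borel_measurable (F (\<tau> i)) \<and>
        bounded (A i ` space M))"

definition elementary_value ::
  "nat \<Rightarrow> (nat \<Rightarrow> real) \<Rightarrow> (nat \<Rightarrow> 'a \<Rightarrow> real^'m::finite^'n::finite) \<Rightarrow> real \<Rightarrow> 'a \<Rightarrow> real^'m^'n" where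
  "elementary_value n \<tau> A s \<omega> = (\<Sum>i<n. indicator {\<tau> i<..\<tau> (Suc i)} s *\<^sub>R A i \<omega>)"

definition elementary_integral ::
  "(real \<Rightarrow> 'a \<Rightarrow> real^'m) \<Rightarrow> nat \<Rightarrow> (nat \<Rightarrow> real) \<Rightarrow> (nat \<Rightarrow> 'a \<Rightarrow> real^'m::finite^'n::finite) \<Rightarrow> real \<Rightarrow> 'a \<Rightarrow> real^'n" where
  "elementary_integral W n \<tau> A t \<omega> =
     (\<Sum>i<n. A i \<omega> *v (W (min t (\<tau> (Suc i))) \<omega> - W (min t (\<tau> i)) \<omega>))"

text \<open>\<open>J\<close> is a version of the Ito integral of the matrix-valued process \<open>H\<close> over \<open>[0, t]\<close> with
  respect to the Brownian motion \<open>W\<close>, as the \<open>L\<^sup>2\<close>-limit of integrals of elementary processes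
  approximating \<open>H\<close> in \<open>L\<^sup>2([0, t] \<times> \<Omega>)\<close> (so \<open>H\<close> is square-integrable there). The limit does not
  depend, up to null sets, on the approximating sequence. The norm of a matrix is the Frobenius
  norm.\<close>

definition has_Ito_integral ::
  "(real \<Rightarrow> 'a \<Rightarrow> real^'m::finite) \<Rightarrow> (real \<Rightarrow> 'a \<Rightarrow> real^'m^'n::finite) \<Rightarrow> real \<Rightarrow> ('a \<Rightarrow> real^'n) \<Rightarrow> bool" where
  "has_Ito_integral W H t J \<longleftrightarrow>
     progressive H \<and> J \<in> borel_measurable M \<and>
     (\<exists>n \<tau> A. (\<forall>r. elementary_process (n r) (\<tau> r) (A r)) \<and>
        ((\<lambda>r. \<integral>\<^sup>+\<omega>. (\<integral>\<^sup>+s\<in>{0..t}.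
            ennreal ((norm (elementary_value (n r) (\<tau> r) (A r) s \<omega> - H s \<omega>))\<^sup>2) \<partial>lborel) \<partial>M)
          \<longlonglongrightarrow> 0) \<and>
        ((\<lambda>r. \<integral>\<^sup>+\<omega>.
            ennreal ((norm (elementary_integral W (n r) (\<tau> r) (A r) t \<omega> - J \<omega>))\<^sup>2) \<partial>M)
          \<longlonglongrightarrow> 0))"

text \<open>Continuous adapted solutions of \<open>X\<^sub>t = \<xi> + \<integral>\<^sub>0\<^sup>t \<mu>(X\<^sub>s) ds + \<integral>\<^sub>0\<^sup>t \<sigma>(X\<^sub>s) dW\<^sub>s\<close>, \<open>t \<ge> 0\<close>. The
  equation holds almost surely for each \<open>t\<close>. All paths are required to be continuous, since \<open>M\<close>
  need not be complete.\<close>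

definition solves_SDE ::
  "(real^'n::finite \<Rightarrow> real^'n) \<Rightarrow> (real^'n \<Rightarrow> real^'m::finite^'n) \<Rightarrow> (real \<Rightarrow> 'a \<Rightarrow> real^'m)
    \<Rightarrow> ('a \<Rightarrow> real^'n) \<Rightarrow> (real \<Rightarrow> 'a \<Rightarrow> real^'n) \<Rightarrow> bool" where
  "solves_SDE \<mu> \<sigma> W \<xi> X \<longleftrightarrow>
     adapted X \<and>
     (\<forall>\<omega>\<in>space M. continuous_on {0..} (\<lambda>t. X t \<omega>)) \<and>
     (\<forall>t\<ge>0. \<exists>J. has_Ito_integral W (\<lambda>s \<omega>. \<sigma> (X s \<omega>)) t J \<and>
        (AE \<omega> in M. X t \<omega> = \<xi> \<omega> + (LBINT s:{0..t}. \<mu> (X s \<omega>)) + J \<omega>))"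

definition diffusion_generated_by_A_hat ::
  "(real^'n::finite \<Rightarrow> real^'n) \<Rightarrow> (real^'n \<Rightarrow> real^'m::finite^'n) \<Rightarrow> (real \<Rightarrow> 'a \<Rightarrow> real^'m)
    \<Rightarrow> ('a \<Rightarrow> real^'n) \<Rightarrow> (real \<Rightarrow> 'a \<Rightarrow> real^'n) \<Rightarrow> bool" where
  "diffusion_generated_by_A_hat f \<sigma> W \<xi> X \<longleftrightarrow> solves_SDE (drift_hat f \<sigma>) \<sigma> W \<xi> X"

end

section \<open>Minimisation over continuous functions on a cube\<close>

definition cube :: "real \<Rightarrow> real \<Rightarrow> (real^'n::finite) set" where
  "cube a b = cbox (\<chi> i. a) (\<chi> i. b)"

text \<open>Functions with domain \<open>K\<close> are represented by their extension with value \<^term>\<open>undefined\<close>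
  outside \<open>K\<close>, so that equality in this set is equality on \<open>K\<close>.\<close>

definition C_on :: "'a::topological_space set \<Rightarrow> ('a \<Rightarrow> real) set" where
  "C_on K = {v \<in> extensional K. continuous_on K v}"

end

theory Submission
  imports Defs
begin

text \<open>By orthogonality in \<open>L\<^sup>2\<close> it suffices that, with \<open>Y = \<psi>(X\<^sub>T) exp (- \<integral>\<^sub>0\<^sup>T k(X\<^sub>s) ds)\<close>, the error
  \<open>Y - u(T, \<xi>)\<close> is orthogonal to every bounded \<open>\<F>\<^sub>0\<close>-measurable random variable \<open>G\<close>. This is a
  Feynman-Kac identity, and it is proved without Ito's formula: from the \<open>L\<^sup>2\<close> estimate
  \<open>X\<^sub>t\<^sub>+\<^sub>h - X\<^sub>t = \<sigma>(X\<^sub>t) (W\<^sub>t\<^sub>+\<^sub>h - W\<^sub>t) + o(\<surd>h)\<close> and a second-order Taylor expansion one obtains the right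
  derivative of \<open>t \<mapsto> E[Z u(T - t, X\<^sub>t)]\<close>, and a continuous function with continuous right derivative
  is its integral. Since \<open>k\<close> may be unbounded, the discount factor is first formed with
  \<open>min k n\<close>; the error term is dominated because the equation bounds \<open>k u\<close>. The limit
  \<open>t \<rightarrow> T\<close> uses that \<open>u\<close> is Lipschitz in space, uniformly in time.\<close>

section \<open>Gaussian moments and independence\<close>

text \<open>The obstacle is that \<open>has_Ito_integral\<close> describes the stochastic integral
  at one fixed time only, as an \<open>L\<^sup>2\<close> limit along a sequence that may change with
  the time, and that the equation for \<open>X\<close> holds almost surely for each time separately.
  There is no integral process to work with, and for an increment of \<open>X\<close> only second
  moments are controlled. Two facts about increments are therefore extracted from the definition: a
  mean square bound for the distance to the integral of an integrand frozen at the left end, and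
  mean zero against bounded random variables known at the left end. Together with the explicit
  moments of a Brownian increment up to order four they determine the right derivative of an
  expectation. It is taken for \<open>t < T\<close> only, because the regularity of \<open>u\<close>
  starts after time 0. Truncating \<open>k\<close> gives the difference quotients of the discount
  factor a bound that is the same for all paths, as bounded convergence demands.\<close>

lemma
  fixes f :: "'b::euclidean_space \<Rightarrow> real \<Rightarrow> real"
  assumes f: "\<And>b. b \<in> Basis \<Longrightarrow> integrable lborel (f b)"
  shows integrable_lborel_prod: "integrable lborel (\<lambda>x::'b. \<Prod>b\<in>Basis. f b (x \<bullet> b))" (is ?A)
    and integral_lborel_prod:
      "(\<integral>x. (\<Prod>b\<in>Basis. f b (x \<bullet> b)) \<partial>(lborel :: 'b measure)) = (\<Prod>b\<in>Basis. (\<integral>y. f b y \<partial>lborel))" (is ?B)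
proof -
  interpret product_sigma_finite "\<lambda>_::'b. lborel :: real measure" ..
  have m: "b \<in> Basis \<Longrightarrow> f b \<in> borel_measurable borel" for b
    using f[of b] by (simp add: borel_measurable_integrable)
  have [measurable]: "(\<lambda>x::'b. \<Prod>b\<in>Basis. f b (x \<bullet> b)) \<in> borel_measurable borel"
    by (intro borel_measurable_prod measurable_compose[OF _ m]) auto
  have eq: "(\<Prod>b\<in>Basis. f b ((\<Sum>b\<in>Basis. z b *\<^sub>R b) \<bullet> b)) = (\<Prod>b\<in>Basis. f b (z b))"
    for z :: "'b \<Rightarrow> real"
    by (intro prod.cong refl) (simp add: inner_sum_left inner_Basis if_distrib cong: if_cong)
  show ?A
    unfolding lborel_eq[where 'a='b]
    by (subst integrable_distr_eq) (auto simp: eq intro!: product_integrable_prod f)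
  show ?B
    unfolding lborel_eq[where 'a='b]
    by (subst integral_distr) (auto simp: eq intro!: product_integral_prod f)
qed

text \<open>The elements of \<open>Basis\<close> are the unit vectors \<open>axis j 1\<close>, and
  \<open>axis_index\<close> recovers \<open>j\<close>, so a product over \<open>Basis\<close>
  reindexes to one over coordinates. This form fits the density in
  \<open>brownian_motion\<close>.\<close>

lemma
  fixes f :: "'m::finite \<Rightarrow> real \<Rightarrow> real"
  assumes f: "\<And>j. integrable lborel (f j)"
  shows integrable_lborel_vec_prod: "integrable lborel (\<lambda>x::real^'m. \<Prod>j\<in>UNIV. f j (x $ j))"
    and integral_lborel_vec_prod:
      "(\<integral>x. (\<Prod>j\<in>UNIV. f j (x $ j)) \<partial>(lborel :: (real^'m) measure)) = (\<Prod>j\<in>UNIV. (\<integral>y. f j y \<partial>lborel))"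
proof -
  have B: "(Basis :: (real^'m) set) = range (\<lambda>j. axis j 1)"
    by (auto simp: Basis_vec_def)
  have inj: "inj (\<lambda>j. axis j (1::real) :: real^'m)"
    by (auto simp: inj_on_def axis_eq_axis)
  have re: "(\<Prod>b\<in>(Basis :: (real^'m) set). g (axis_index b) b) = (\<Prod>j\<in>UNIV. g j (axis j 1))"
    for g :: "'m \<Rightarrow> real^'m \<Rightarrow> real"
    unfolding B by (subst prod.reindex[OF inj]) simp
  have eq: "(\<Prod>b\<in>Basis. f (axis_index b) (x \<bullet> b)) = (\<Prod>j\<in>UNIV. f j (x $ j))" for x :: "real^'m"
    by (subst re[of "\<lambda>j b. f j (x \<bullet> b)"]) (simp add: inner_axis)
  have eq': "(\<Prod>b\<in>(Basis :: (real^'m) set). (\<integral>y. f (axis_index b) y \<partial>lborel)) = (\<Prod>j\<in>UNIV. (\<integral>y. f j y \<partial>lborel))"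
    by (subst re[of "\<lambda>j b. (\<integral>y. f j y \<partial>lborel)"]) simp
  show "integrable lborel (\<lambda>x::real^'m. \<Prod>j\<in>UNIV. f j (x $ j))"
    using integrable_lborel_prod[of "\<lambda>b::real^'m. f (axis_index b)"] f by (simp only: eq)
  show "(\<integral>x. (\<Prod>j\<in>UNIV. f j (x $ j)) \<partial>(lborel :: (real^'m) measure)) = (\<Prod>j\<in>UNIV. (\<integral>y. f j y \<partial>lborel))"
    using integral_lborel_prod[of "\<lambda>b::real^'m. f (axis_index b)"] f by (simp only: eq eq')
qed

lemma normal_moments:
  assumes s: "0 < s"
  shows "(\<integral>y. normal_density 0 s y * y \<partial>lborel) = 0"
    and "(\<integral>y. normal_density 0 s y * y\<^sup>2 \<partial>lborel) = s\<^sup>2"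
    and "(\<integral>y. normal_density 0 s y * y ^ 4 \<partial>lborel) = 3 * s ^ 4"
  using integral_normal_moment_odd[of s 0 0] integral_normal_moment_even[of s 0 1]
    integral_normal_moment_even[of s 0 2] s
  by (simp_all add: fact_numeral power_divide field_simps power2_eq_square power4_eq_xxxx)

context prob_space
begin

text \<open>This is the density clause of \<open>brownian_motion\<close>. The parameter is the
  standard deviation of each coordinate, so an increment over a time of length h has parameter
  \<open>sqrt h\<close>.\<close>

definition gaussian_vec :: "real \<Rightarrow> ('a \<Rightarrow> real^'m::finite) \<Rightarrow> bool" where
  "gaussian_vec s D \<longleftrightarrow>
     distributed M lborel D (\<lambda>x. ennreal (\<Prod>j\<in>UNIV. normal_density 0 s (x $ j)))"

text \<open>The density is a product over the coordinates, so the mean of a monomial factors into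
  one-dimensional moments. With a free exponent for each coordinate, all moments used later are
  instances of one formula.\<close>

lemma
  fixes D :: "'a \<Rightarrow> real^'m::finite"
  assumes D: "gaussian_vec s D" and s: "0 < s"
  shows gaussian_vec_integrable_prod: "integrable M (\<lambda>\<omega>. \<Prod>j\<in>UNIV. (D \<omega> $ j) ^ e j)" (is ?A)
    and gaussian_vec_expectation_prod:
      "(\<integral>\<omega>. (\<Prod>j\<in>UNIV. (D \<omega> $ j) ^ e j) \<partial>M)
         = (\<Prod>j\<in>UNIV. (\<integral>y. normal_density 0 s y * y ^ e j \<partial>lborel))" (is ?B)
proof -
  have D': "distributed M lborel D (\<lambda>x. ennreal (\<Prod>j\<in>UNIV. normal_density 0 s (x $ j)))"
    using D by (simp add: gaussian_vec_def)
  have int: "integrable lborel (\<lambda>y. normal_density 0 s y * y ^ e j)" for j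
    using integrable_normal_moment[of s 0 "e j"] s by simp
  have m: "(\<lambda>x::real^'m. \<Prod>j\<in>UNIV. (x $ j) ^ e j) \<in> borel_measurable lborel"
    by (simp add: borel_measurable_continuous_onI continuous_intros)
  show ?A
    using integrable_lborel_vec_prod[OF int]
    by (subst distributed_integrable[OF D' m, symmetric]) (auto simp: prod.distrib prod_nonneg)
  show ?B
    by (subst distributed_integral[OF D' m, symmetric])
      (auto simp: prod.distrib[symmetric] prod_nonneg integral_lborel_vec_prod[OF int])
qed

lemma
  fixes D :: "'a \<Rightarrow> real^'m::finite"
  assumes D: "gaussian_vec s D" and s: "0 < s"
  shows gaussian_vec_integrable1: "integrable M (\<lambda>\<omega>. D \<omega> $ p)"
    and gaussian_vec_expectation1: "(\<integral>\<omega>. D \<omega> $ p \<partial>M) = 0"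
    and gaussian_vec_integrable2: "integrable M (\<lambda>\<omega>. D \<omega> $ p * D \<omega> $ q)"
    and gaussian_vec_expectation2: "(\<integral>\<omega>. D \<omega> $ p * D \<omega> $ q \<partial>M) = (if p = q then s\<^sup>2 else 0)"
    and gaussian_vec_integrable4: "integrable M (\<lambda>\<omega>. (D \<omega> $ p) ^ 4)"
    and gaussian_vec_expectation4: "(\<integral>\<omega>. (D \<omega> $ p) ^ 4 \<partial>M) = 3 * s ^ 4"
proof -
  have eq1: "(\<Prod>j\<in>UNIV. (x $ j) ^ (if j = p then n else 0)) = (x $ p) ^ n" for x :: "real^'m" and n p
    by (simp add: if_distrib prod.If_cases cong: if_cong)
  \<comment> \<open>Adding the two exponents treats \<open>p = q\<close> and
    \<open>p \<noteq> q\<close> alike: on the diagonal the exponent becomes 2.\<close>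
  have eq2: "(\<Prod>j\<in>UNIV. (x $ j) ^ ((if j = p then 1 else 0) + (if j = q then 1 else 0))) = x $ p * x $ q"
    for x :: "real^'m"
    using eq1[of x p 1] eq1[of x q 1] by (simp only: power_add prod.distrib power_one_right)
  have one: "(\<Prod>j\<in>UNIV. (\<integral>y. normal_density 0 s y * y ^ (if j = p then n else 0) \<partial>lborel))
       = (\<integral>y. normal_density 0 s y * y ^ n \<partial>lborel)" for n and p :: 'm
  proof -
    have "(\<Prod>j\<in>UNIV. (\<integral>y. normal_density 0 s y * y ^ (if j = p then n else 0) \<partial>lborel))
      = (\<Prod>j\<in>UNIV. if j = p then (\<integral>y. normal_density 0 s y * y ^ n \<partial>lborel) else 1)"
      using s by (intro prod.cong) auto
    then show ?thesis by simp
  qed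
  note i = gaussian_vec_integrable_prod[OF D s] and x = gaussian_vec_expectation_prod[OF D s]
  show "integrable M (\<lambda>\<omega>. D \<omega> $ p)" "(\<integral>\<omega>. D \<omega> $ p \<partial>M) = 0"
    using i[of "\<lambda>j. if j = p then 1 else 0"] x[of "\<lambda>j. if j = p then 1 else 0"] normal_moments[OF s]
    by (simp_all only: eq1 one power_one_right)
  show "integrable M (\<lambda>\<omega>. (D \<omega> $ p) ^ 4)" "(\<integral>\<omega>. (D \<omega> $ p) ^ 4 \<partial>M) = 3 * s ^ 4"
    using i[of "\<lambda>j. if j = p then 4 else 0"] x[of "\<lambda>j. if j = p then 4 else 0"] normal_moments[OF s]
    by (simp_all only: eq1 one)
  show "integrable M (\<lambda>\<omega>. D \<omega> $ p * D \<omega> $ q)"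
    using i[of "\<lambda>j. (if j = p then 1 else 0) + (if j = q then 1 else 0)"] by (simp only: eq2)
  show "(\<integral>\<omega>. D \<omega> $ p * D \<omega> $ q \<partial>M) = (if p = q then s\<^sup>2 else 0)"
  proof (cases "p = q")
    case True
    then show ?thesis
      using x[of "\<lambda>j. if j = p then 2 else 0"] normal_moments[OF s]
      by (simp add: eq1 one flip: power2_eq_square)
  next
    case False
    \<comment> \<open>Off the diagonal the factor at \<open>p\<close> is a first moment, which is
      zero.\<close>
    have "(\<Prod>j\<in>UNIV. (\<integral>y. normal_density 0 s y * y ^ ((if j = p then 1 else 0) + (if j = q then 1 else 0)) \<partial>lborel)) = 0"
      using False normal_moments(1)[OF s] by (intro prod_zero) auto
    then show ?thesis
      using False x[of "\<lambda>j. (if j = p then 1 else 0) + (if j = q then 1 else 0)"] by (simp only: eq2) simp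
  qed
qed

text \<open>\<open>indep_var\<close> compares the sigma-algebras generated by preimages. Preimages
  under \<open>C\<close> generate a part of \<open>sets G\<close>, and those under \<open>D\<close>
  form a sigma-algebra already, so the assumed product rule applies to every pair of events
  directly.\<close>

lemma indep_set_indep_var:
  assumes ind: "indep_set (sets G) {D -` B \<inter> space M | B. B \<in> sets N}"
    and sub: "subalgebra M G" and C: "C \<in> measurable G L" and D: "D \<in> measurable M N"
  shows "indep_var L C N D"
proof -
  have sp: "space G = space M" using sub by (simp add: subalgebra_def)
  have SD: "sigma_sets (space M) {D -` B \<inter> space M | B. B \<in> sets N} = {D -` B \<inter> space M | B. B \<in> sets N}"
    using sets_vimage_algebra2[of D "space M" N] measurable_space[OF D]
      sets.sigma_sets_eq[of "vimage_algebra (space M) D N"]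
    by (simp add: Pi_iff)
  have "{C -` A \<inter> space M |A. A \<in> sets L} \<subseteq> sets G"
    using measurable_sets[OF C] sp by auto
  then have SC: "sigma_sets (space M) {C -` A \<inter> space M |A. A \<in> sets L} \<subseteq> sets G"
    using sets.sigma_sets_subset[of _ G] by (simp add: sp)
  have SG: "sets G \<subseteq> events" using sub by (simp add: subalgebra_def)
  have "indep_set (sigma_sets (space M) {C -` A \<inter> space M |A. A \<in> sets L})
      (sigma_sets (space M) {D -` B \<inter> space M | B. B \<in> sets N})"
    unfolding SD
  proof (rule indep_setI)
    show "{D -` B \<inter> space M | B. B \<in> sets N} \<subseteq> events"
      using measurable_sets[OF D] by auto
    show "sigma_sets (space M) {C -` A \<inter> space M |A. A \<in> sets L} \<subseteq> events"
      using SC SG by (rule order_trans)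
    show "prob (a \<inter> b) = prob a * prob b"
      if "a \<in> sigma_sets (space M) {C -` A \<inter> space M |A. A \<in> sets L}"
        "b \<in> {D -` B \<inter> space M | B. B \<in> sets N}" for a b
      using indep_setD[OF ind subsetD[OF SC that(1)] that(2)] .
  qed
  then show ?thesis
    using measurable_from_subalg[OF sub C] D by (simp add: indep_var_eq)
qed

end

section \<open>Moments of Brownian increments\<close>

lemma borel_measurable_vec_nth [measurable (raw)]:
  fixes f :: "'a \<Rightarrow> ('b::second_countable_topology)^'n::finite"
  assumes "f \<in> borel_measurable M"
  shows "(\<lambda>x. f x $ i) \<in> borel_measurable M"
  by (rule measurable_compose[OF assms borel_measurable_continuous_onI]) (intro continuous_intros)

lemma borel_measurable_matrix_vector_mult [measurable (raw)]:
  fixes A :: "'a \<Rightarrow> real^'m::finite^'n::finite"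
  assumes [measurable]: "A \<in> borel_measurable M" "x \<in> borel_measurable M"
  shows "(\<lambda>w. A w *v x w) \<in> borel_measurable M"
proof -
  have "(\<lambda>w. \<Sum>i\<in>UNIV. (\<Sum>j\<in>UNIV. A w $ i $ j * x w $ j) *\<^sub>R (axis i 1 :: real^'n)) \<in> borel_measurable M"
    by measurable
  moreover have "(\<Sum>i\<in>UNIV. (\<Sum>j\<in>UNIV. B $ i $ j * y $ j) *\<^sub>R (axis i 1 :: real^'n)) = B *v y"
    for B :: "real^'m^'n" and y
    by (simp add: vec_eq_iff matrix_vector_mult_def axis_def if_distrib cong: if_cong)
  ultimately show ?thesis by simp
qed

lemma abs_vec_nth_nth_le: "\<bar>A $ i $ j\<bar> \<le> norm A" for A :: "real^'m::finite^'n::finite"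
  using component_le_norm_cart[of "A $ i" j] Finite_Cartesian_Product.norm_nth_le[of A i] by linarith

lemma inner_matrix_vector_mult_both:
  fixes A B :: "real^'m::finite^'n::finite"
  shows "(A *v x) \<bullet> (B *v y) = (\<Sum>p\<in>UNIV. \<Sum>q\<in>UNIV. (\<Sum>r\<in>UNIV. A $ r $ p * B $ r $ q) * (x $ p * y $ q))"
proof -
  have "(A *v x) \<bullet> (B *v y) = (\<Sum>r\<in>UNIV. \<Sum>p\<in>UNIV. \<Sum>q\<in>UNIV. A $ r $ p * B $ r $ q * (x $ p * y $ q))"
    by (simp add: inner_vec_def matrix_vector_mult_def sum_product mult_ac)
  also have "\<dots> = (\<Sum>p\<in>UNIV. \<Sum>r\<in>UNIV. \<Sum>q\<in>UNIV. A $ r $ p * B $ r $ q * (x $ p * y $ q))"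
    by (rule sum.swap)
  also have "\<dots> = (\<Sum>p\<in>UNIV. \<Sum>q\<in>UNIV. \<Sum>r\<in>UNIV. A $ r $ p * B $ r $ q * (x $ p * y $ q))"
    by (intro sum.cong refl sum.swap)
  finally show ?thesis by (simp add: sum_distrib_right)
qed

lemma inner_matrix_columns:
  fixes A B :: "real^'m::finite^'n::finite"
  shows "A \<bullet> B = (\<Sum>p\<in>UNIV. \<Sum>r\<in>UNIV. A $ r $ p * B $ r $ p)"
  by (simp add: inner_vec_def) (rule sum.swap)

lemma measure_Int_Ioc:
  "measure lborel ({s<..e} \<inter> {s'<..e'}) = max 0 (min e e' - max s s')" for s :: real
proof -
  have "{s<..e} \<inter> {s'<..e'} = {max s s'<..min e e'}" by auto
  then show ?thesis by (cases "max s s' \<le> min e e'") (auto simp: max_def)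
qed

lemma (in prob_space) indep_set_mono_right:
  assumes "indep_set A B" "B' \<subseteq> B"
  shows "indep_set A B'"
proof (rule indep_setI)
  show "A \<subseteq> events" "B' \<subseteq> events"
    using assms by (auto simp: indep_sets2_eq)
  show "prob (a \<inter> b) = prob a * prob b" if "a \<in> A" "b \<in> B'" for a b
    using indep_setD[OF assms(1) that(1) subsetD[OF assms(2) that(2)]] .
qed

context filtered_prob_space
begin

lemma measurable_F_M: "0 \<le> t \<Longrightarrow> Z \<in> measurable (F t) N \<Longrightarrow> Z \<in> measurable M N"
  using subalgebra_F measurable_from_subalg by blast

lemma space_F: "0 \<le> t \<Longrightarrow> space (F t) = space M"
  using subalgebra_F by (auto simp: subalgebra_def)

lemma subalgebra_F_mono: "0 \<le> s \<Longrightarrow> s \<le> t \<Longrightarrow> subalgebra (F t) (F s)"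
  using F_mono[of s t] space_F[of s] space_F[of t] by (auto simp: subalgebra_def)

lemma measurable_F_mono: "0 \<le> s \<Longrightarrow> s \<le> t \<Longrightarrow> Z \<in> measurable (F s) N \<Longrightarrow> Z \<in> measurable (F t) N"
  using subalgebra_F_mono measurable_from_subalg by blast

context
  fixes W :: "real \<Rightarrow> 'a \<Rightarrow> real^'m::finite"
  assumes bm: "brownian_motion W"
begin

lemma measurable_W: "0 \<le> t \<Longrightarrow> W t \<in> borel_measurable (F t)"
  using bm by (auto simp: brownian_motion_def adapted_def)

lemma measurable_W_M: "0 \<le> t \<Longrightarrow> W t \<in> borel_measurable M"
  using measurable_W measurable_F_M by blast

lemma measurable_dW: "0 \<le> s \<Longrightarrow> s \<le> t \<Longrightarrow> (\<lambda>\<omega>. W t \<omega> - W s \<omega>) \<in> borel_measurable (F t)"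
  using measurable_W[of t] measurable_F_mono[OF _ _ measurable_W, of s t] by simp

lemma gaussian_dW: "0 \<le> s \<Longrightarrow> s < t \<Longrightarrow> gaussian_vec (sqrt (t - s)) (\<lambda>\<omega>. W t \<omega> - W s \<omega>)"
  using bm by (auto simp: brownian_motion_def gaussian_vec_def)

text \<open>An event described through \<open>g\<close> of the increment is described through the
  increment itself, so the independence in \<open>brownian_motion\<close> is only restricted to a
  smaller family of events.\<close>

lemma indep_dW:
  assumes s: "0 \<le> s" "s < t" and C: "C \<in> borel_measurable (F s)" and g: "g \<in> borel_measurable borel"
  shows "indep_var borel C borel (\<lambda>\<omega>. g (W t \<omega> - W s \<omega>))"
proof (rule indep_set_indep_var[OF _ subalgebra_F[OF s(1)] C])
  let ?D = "\<lambda>\<omega>. W t \<omega> - W s \<omega>"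
  have [measurable]: "W s \<in> borel_measurable M" "W t \<in> borel_measurable M"
    using measurable_W_M s by auto
  show "(\<lambda>\<omega>. g (?D \<omega>)) \<in> borel_measurable M" using g by measurable
  have "indep_set (sets (F s)) {?D -` B \<inter> space M | B. B \<in> sets borel}"
    using bm s by (auto simp: brownian_motion_def)
  moreover have "{(\<lambda>\<omega>. g (?D \<omega>)) -` B \<inter> space M | B. B \<in> sets borel} \<subseteq> {?D -` B \<inter> space M | B. B \<in> sets borel}"
  proof safe
    fix B :: "'b set" assume "B \<in> sets borel"
    then show "\<exists>B'. (\<lambda>\<omega>. g (?D \<omega>)) -` B \<inter> space M = ?D -` B' \<inter> space M \<and> B' \<in> sets borel"
      using measurable_sets_borel[OF g] by (intro exI[of _ "g -` B"]) auto
  qed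
  ultimately show "indep_set (sets (F s)) {(\<lambda>\<omega>. g (?D \<omega>)) -` B \<inter> space M | B. B \<in> sets borel}"
    by (rule indep_set_mono_right)
qed

lemma
  fixes C :: "'a \<Rightarrow> real" and g :: "real^'m \<Rightarrow> real"
  assumes s: "0 \<le> s" "s < t" and C: "C \<in> borel_measurable (F s)" "integrable M C"
    and g: "g \<in> borel_measurable borel" "integrable M (\<lambda>\<omega>. g (W t \<omega> - W s \<omega>))"
  shows integrable_indep_dW: "integrable M (\<lambda>\<omega>. C \<omega> * g (W t \<omega> - W s \<omega>))"
    and expectation_indep_dW: "(\<integral>\<omega>. C \<omega> * g (W t \<omega> - W s \<omega>) \<partial>M)
      = (\<integral>\<omega>. C \<omega> \<partial>M) * (\<integral>\<omega>. g (W t \<omega> - W s \<omega>) \<partial>M)"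
proof -
  note i = indep_dW[OF s C(1) g(1)]
  show "integrable M (\<lambda>\<omega>. C \<omega> * g (W t \<omega> - W s \<omega>))"
    by (rule indep_var_integrable[OF i C(2) g(2)])
  show "(\<integral>\<omega>. C \<omega> * g (W t \<omega> - W s \<omega>) \<partial>M)
      = (\<integral>\<omega>. C \<omega> \<partial>M) * (\<integral>\<omega>. g (W t \<omega> - W s \<omega>) \<partial>M)"
    by (rule indep_var_lebesgue_integral[OF i C(2) g(2)])
qed

text \<open>Conditionally on \<open>F s\<close> the increment is centred. Equal times are included,
  with increment 0, because cutting an elementary process at some time produces empty intervals,
  whereas \<open>brownian_motion\<close> speaks of \<open>s < t\<close> only.\<close>

lemma
  assumes s: "0 \<le> s" "s \<le> t" and C: "C \<in> borel_measurable (F s)" "integrable M C"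
  shows integrable_mult_dW: "integrable M (\<lambda>\<omega>. C \<omega> * (W t \<omega> - W s \<omega>) $ p)" (is ?A)
    and expectation_mult_dW: "(\<integral>\<omega>. C \<omega> * (W t \<omega> - W s \<omega>) $ p \<partial>M) = 0" (is ?B)
proof -
  have "?A \<and> ?B"
  proof (cases "s < t")
    case True
    then show ?thesis
      using integrable_indep_dW[of s t C "\<lambda>x. x $ p"] expectation_indep_dW[of s t C "\<lambda>x. x $ p"]
        gaussian_vec_integrable1[OF gaussian_dW, of s t p] gaussian_vec_expectation1[OF gaussian_dW, of s t p]
        assms by simp
  qed (use s in simp)
  then show ?A ?B by auto
qed

lemma
  assumes s: "0 \<le> s" "s \<le> t" and C: "C \<in> borel_measurable (F s)" "integrable M C"
  shows integrable_mult_dW2: "integrable M (\<lambda>\<omega>. C \<omega> * ((W t \<omega> - W s \<omega>) $ p * (W t \<omega> - W s \<omega>) $ q))" (is ?A)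
    and expectation_mult_dW2: "(\<integral>\<omega>. C \<omega> * ((W t \<omega> - W s \<omega>) $ p * (W t \<omega> - W s \<omega>) $ q) \<partial>M)
      = (\<integral>\<omega>. C \<omega> \<partial>M) * (if p = q then t - s else 0)" (is ?B)
proof -
  have "?A \<and> ?B"
  proof (cases "s < t")
    case True
    then show ?thesis
      using integrable_indep_dW[of s t C "\<lambda>x. x $ p * x $ q"] expectation_indep_dW[of s t C "\<lambda>x. x $ p * x $ q"]
        gaussian_vec_integrable2[OF gaussian_dW, of s t p q] gaussian_vec_expectation2[OF gaussian_dW, of s t p q]
        assms by simp
  qed (use s in simp)
  then show ?A ?B by auto
qed

text \<open>By Cauchy-Schwarz over the coordinates, \<open>norm x ^ 4\<close> is at most
  \<open>CARD('m)\<close> times the sum of the fourth powers. That sum has \<open>CARD('m)\<close>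
  terms, each with mean \<open>3 * (t - s)\<^sup>2\<close>, which explains the constant.\<close>

lemma expectation_dW4:
  fixes s t :: real
  assumes s: "0 \<le> s" "s \<le> t"
  shows "integrable M (\<lambda>\<omega>. norm (W t \<omega> - W s \<omega>) ^ 4)" (is ?A)
    and "(\<integral>\<omega>. norm (W t \<omega> - W s \<omega>) ^ 4 \<partial>M) \<le> 3 * real CARD('m) ^ 2 * (t - s)\<^sup>2" (is ?B)
proof -
  have "?A \<and> ?B"
  proof (cases "s < t")
    case True
    have n4: "norm x ^ 4 \<le> real CARD('m) * (\<Sum>p\<in>UNIV. (x $ p) ^ 4)" for x :: "real^'m"
    proof -
      have "norm x ^ 4 = (\<Sum>p\<in>UNIV. (x $ p)\<^sup>2)\<^sup>2"
        by (simp add: norm_vec_def L2_set_def power4_eq_xxxx power2_eq_square sum_nonneg algebra_simps flip: power_mult_distrib)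
      also have "\<dots> \<le> (\<Sum>p\<in>(UNIV::'m set). 1\<^sup>2) * (\<Sum>p\<in>UNIV. ((x $ p)\<^sup>2)\<^sup>2)"
        using Cauchy_Schwarz_ineq_sum[of "\<lambda>_. 1" "\<lambda>p. (x $ p)\<^sup>2" "UNIV :: 'm set"] by simp
      finally show ?thesis by simp
    qed
    note i = gaussian_vec_integrable4[OF gaussian_dW[OF s(1) True]]
    have [measurable]: "W s \<in> borel_measurable M" "W t \<in> borel_measurable M"
      using measurable_W_M s by auto
    have m: "(\<lambda>\<omega>. norm (W t \<omega> - W s \<omega>) ^ 4) \<in> borel_measurable M"
      by measurable
    have j: "integrable M (\<lambda>\<omega>. real CARD('m) * (\<Sum>p\<in>UNIV. ((W t \<omega> - W s \<omega>) $ p) ^ 4))"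
      by (intro integrable_mult_right integrable_sum) (use i True in simp)
    have A: ?A
      by (rule Bochner_Integration.integrable_bound[OF j m], rule AE_I2)
        (use order_trans[OF n4 abs_ge_self, of "W t _ - W s _"] in \<open>simp only: real_norm_def abs_norm_cancel power_abs\<close>)
    have "(\<integral>\<omega>. norm (W t \<omega> - W s \<omega>) ^ 4 \<partial>M) \<le> (\<integral>\<omega>. real CARD('m) * (\<Sum>p\<in>UNIV. ((W t \<omega> - W s \<omega>) $ p) ^ 4) \<partial>M)"
      by (rule integral_mono[OF A j n4])
    also have "\<dots> = real CARD('m) * (\<Sum>p\<in>(UNIV::'m set). 3 * sqrt (t - s) ^ 4)"
      using i gaussian_vec_expectation4[OF gaussian_dW[OF s(1) True]] True by simp
    also have "sqrt (t - s) ^ 4 = (t - s)\<^sup>2"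
      using True by (simp add: power4_eq_xxxx power2_eq_square)
    finally show ?thesis using A by (simp add: power2_eq_square mult_ac)
  qed (use s in simp)
  then show ?A ?B by auto
qed

lemma integrable_dW:
  assumes s: "0 \<le> s" "s \<le> t"
  shows "integrable M (\<lambda>\<omega>. (W t \<omega> - W s \<omega>) $ p)"
proof (cases "s = t")
  case False
  then show ?thesis
    using gaussian_vec_integrable1[OF gaussian_dW[of s t], of p] s by simp
qed simp

text \<open>The longer increment is split at \<open>e\<close>. Its part up to \<open>e\<close> gives
  a second moment, and its part after \<open>e\<close> is centred against everything known at time
  \<open>e\<close>.\<close>

lemma dW_product_same_start:
  assumes s: "0 \<le> s" "s \<le> e" "e \<le> e'" and c: "c \<in> borel_measurable (F s)" "\<And>\<omega>. \<omega> \<in> space M \<Longrightarrow> \<bar>c \<omega>\<bar> \<le> K"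
  shows "integrable M (\<lambda>\<omega>. c \<omega> * ((W e \<omega> - W s \<omega>) $ p * (W e' \<omega> - W s \<omega>) $ q))" (is ?A)
    and "(\<integral>\<omega>. c \<omega> * ((W e \<omega> - W s \<omega>) $ p * (W e' \<omega> - W s \<omega>) $ q) \<partial>M)
      = (\<integral>\<omega>. c \<omega> \<partial>M) * (if p = q then e - s else 0)" (is ?B)
proof -
  have ci: "integrable M c"
    using c measurable_F_M[OF s(1) c(1)] by (intro integrable_const_bound[where B=K]) auto
  let ?C = "\<lambda>\<omega>. c \<omega> * (W e \<omega> - W s \<omega>) $ p"
  have [measurable]: "c \<in> borel_measurable (F e)"
    "(\<lambda>\<omega>. W e \<omega> - W s \<omega>) \<in> borel_measurable (F e)"
    using measurable_F_mono[OF s(1,2) c(1)] measurable_dW[OF s(1,2)] by auto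
  have C: "?C \<in> borel_measurable (F e)"
    by measurable
  note C = C integrable_mult_dW[OF s(1,2) c(1) ci, of p]
  note 1 = integrable_mult_dW2[OF s(1,2) c(1) ci, of p q] expectation_mult_dW2[OF s(1,2) c(1) ci, of p q]
  note 2 = integrable_mult_dW[OF _ s(3) C, of q] expectation_mult_dW[OF _ s(3) C, of q]
  have eq: "c \<omega> * ((W e \<omega> - W s \<omega>) $ p * (W e' \<omega> - W s \<omega>) $ q)
    = c \<omega> * ((W e \<omega> - W s \<omega>) $ p * (W e \<omega> - W s \<omega>) $ q) + ?C \<omega> * (W e' \<omega> - W e \<omega>) $ q" for \<omega>
    by (simp add: algebra_simps)
  show ?A ?B unfolding eq using 1 2 s by simp_all
qed

text \<open>The weight is known only at the later start \<open>s'\<close>. Whatever the first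
  increment collects before \<open>s'\<close> is then also known at \<open>s'\<close>, so it pairs
  to zero with an increment starting there (\<open>past\<close>). What remains of it starts at
  \<open>s'\<close> as well, which is the case of equal starts.\<close>

lemma dW_product_aux:
  assumes s: "0 \<le> s" "s \<le> e" "s \<le> s'" "s' \<le> e'"
    and c: "c \<in> borel_measurable (F s')" "\<And>\<omega>. \<omega> \<in> space M \<Longrightarrow> \<bar>c \<omega>\<bar> \<le> K"
  shows "integrable M (\<lambda>\<omega>. c \<omega> * ((W e \<omega> - W s \<omega>) $ p * (W e' \<omega> - W s' \<omega>) $ q)) \<and>
    (\<integral>\<omega>. c \<omega> * ((W e \<omega> - W s \<omega>) $ p * (W e' \<omega> - W s' \<omega>) $ q) \<partial>M)
      = (\<integral>\<omega>. c \<omega> \<partial>M) * (if p = q then measure lborel ({s<..e} \<inter> {s'<..e'}) else 0)"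
proof -
  have s': "0 \<le> s'" using s by simp
  have past: "integrable M (\<lambda>\<omega>. c \<omega> * ((W r \<omega> - W s \<omega>) $ p * (W e' \<omega> - W s' \<omega>) $ q)) \<and>
    (\<integral>\<omega>. c \<omega> * ((W r \<omega> - W s \<omega>) $ p * (W e' \<omega> - W s' \<omega>) $ q) \<partial>M) = 0"
    if r: "s \<le> r" "r \<le> s'" for r
  proof -
    let ?C = "\<lambda>\<omega>. c \<omega> * (W r \<omega> - W s \<omega>) $ p"
    have i: "integrable M (\<lambda>\<omega>. (W r \<omega> - W s \<omega>) $ p)"
      by (rule integrable_dW[OF s(1) r(1)])
    have [measurable]: "c \<in> borel_measurable (F s')"
      "(\<lambda>\<omega>. W r \<omega> - W s \<omega>) \<in> borel_measurable (F s')"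
      using c(1) measurable_F_mono[OF _ r(2) measurable_dW[OF s(1) r(1)]] s r by auto
    have m: "?C \<in> borel_measurable (F s')"
      by measurable
    have "integrable M ?C"
    proof (rule Bochner_Integration.integrable_bound[OF integrable_mult_right[OF i, of K]])
      show "AE \<omega> in M. norm (?C \<omega>) \<le> norm (K * (W r \<omega> - W s \<omega>) $ p)"
        using mult_right_mono[OF order_trans[OF c(2) abs_ge_self] abs_ge_zero]
        by (intro AE_I2) (simp only: real_norm_def abs_mult)
    qed (use m s' measurable_F_M in auto)
    then show ?thesis
      using integrable_mult_dW[OF s' s(4) m, of q] expectation_mult_dW[OF s' s(4) m, of q]
      by (simp add: mult.assoc)
  qed
  show ?thesis
  proof (cases "e \<le> s'")
    case True
    then show ?thesis using past[OF s(2) True] s by (simp add: measure_Int_Ioc)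
  next
    case False
    have eq: "c \<omega> * ((W e \<omega> - W s \<omega>) $ p * (W e' \<omega> - W s' \<omega>) $ q)
      = c \<omega> * ((W s' \<omega> - W s \<omega>) $ p * (W e' \<omega> - W s' \<omega>) $ q)
        + c \<omega> * ((W e \<omega> - W s' \<omega>) $ p * (W e' \<omega> - W s' \<omega>) $ q)" for \<omega>
      by (simp add: algebra_simps)
    have "integrable M (\<lambda>\<omega>. c \<omega> * ((W e \<omega> - W s' \<omega>) $ p * (W e' \<omega> - W s' \<omega>) $ q)) \<and>
      (\<integral>\<omega>. c \<omega> * ((W e \<omega> - W s' \<omega>) $ p * (W e' \<omega> - W s' \<omega>) $ q) \<partial>M)
        = (\<integral>\<omega>. c \<omega> \<partial>M) * (if p = q then min e e' - s' else 0)"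
    proof (cases "e \<le> e'")
      case True
      then show ?thesis using dW_product_same_start[OF s' _ True c, of p q] False by auto
    next
      case ne: False
      have eq: "(\<lambda>\<omega>. c \<omega> * ((W e \<omega> - W s' \<omega>) $ p * (W e' \<omega> - W s' \<omega>) $ q))
        = (\<lambda>\<omega>. c \<omega> * ((W e' \<omega> - W s' \<omega>) $ q * (W e \<omega> - W s' \<omega>) $ p))"
        by (simp add: mult.commute)
      show ?thesis
        using dW_product_same_start[OF s' s(4) _ c, of e q p] ne unfolding eq by auto
    qed
    then show ?thesis
      using past[OF s(3) order.refl] s False unfolding eq by (simp add: measure_Int_Ioc)
  qed
qed

lemma
  assumes s: "0 \<le> s" "s \<le> e" "0 \<le> s'" "s' \<le> e'"
    and c: "c \<in> borel_measurable (F (max s s'))" "\<And>\<omega>. \<omega> \<in> space M \<Longrightarrow> \<bar>c \<omega>\<bar> \<le> K"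
  shows integrable_dW_product:
      "integrable M (\<lambda>\<omega>. c \<omega> * ((W e \<omega> - W s \<omega>) $ p * (W e' \<omega> - W s' \<omega>) $ q))" (is ?A)
    and expectation_dW_product:
      "(\<integral>\<omega>. c \<omega> * ((W e \<omega> - W s \<omega>) $ p * (W e' \<omega> - W s' \<omega>) $ q) \<partial>M)
      = (\<integral>\<omega>. c \<omega> \<partial>M) * (if p = q then measure lborel ({s<..e} \<inter> {s'<..e'}) else 0)" (is ?B)
proof -
  have "?A \<and> ?B"
  proof (cases "s \<le> s'")
    case True
    then show ?thesis using dW_product_aux[OF s(1,2) True s(4) _ c(2), where p=p and q=q] c(1) by (simp add: max_def)
  next
    case False
    have eq: "(\<lambda>\<omega>. c \<omega> * ((W e \<omega> - W s \<omega>) $ p * (W e' \<omega> - W s' \<omega>) $ q))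
      = (\<lambda>\<omega>. c \<omega> * ((W e' \<omega> - W s' \<omega>) $ q * (W e \<omega> - W s \<omega>) $ p))"
      by (simp add: mult.commute)
    show ?thesis
      using dW_product_aux[OF s(3,4) _ s(2) _ c(2), where p=q and q=p] c(1) False
      unfolding eq by (simp add: max_def Int_commute eq_commute[of p])
  qed
  then show ?A ?B by auto
qed

end

end

section \<open>The Ito isometry for simple integrands\<close>

lemma norm_add3_squared_le: "(norm (a + b + c))\<^sup>2 \<le> 3 * ((norm a)\<^sup>2 + (norm b)\<^sup>2 + (norm c)\<^sup>2)"
proof -
  have "(norm (a + b + c))\<^sup>2 \<le> (norm a + norm b + norm c)\<^sup>2"
    by (intro power_mono norm_triangle_le add_mono norm_triangle_ineq order.refl norm_ge_zero)
  also have "\<dots> \<le> 3 * ((norm a)\<^sup>2 + (norm b)\<^sup>2 + (norm c)\<^sup>2)"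
    using sum_squares_ge_zero[of "norm a - norm b" "norm b - norm c"] zero_le_power2[of "norm a - norm c"]
    by (simp add: power2_eq_square algebra_simps)
  finally show ?thesis .
qed

lemma bounded_image_nth_nth:
  fixes A :: "'a \<Rightarrow> real^'m::finite^'n::finite"
  assumes "bounded (A ` S)"
  obtains K where "0 \<le> K" "\<And>\<omega> i j. \<omega> \<in> S \<Longrightarrow> \<bar>A \<omega> $ i $ j\<bar> \<le> K"
proof -
  obtain K where K: "\<And>\<omega>. \<omega> \<in> S \<Longrightarrow> norm (A \<omega>) \<le> K"
    using assms by (auto simp: bounded_iff)
  have "\<bar>A \<omega> $ i $ j\<bar> \<le> max 0 K" if "\<omega> \<in> S" for \<omega> i j
    using abs_vec_nth_nth_le[of "A \<omega>" i j] K[OF that] by linarith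
  then show ?thesis using that[of "max 0 K"] by auto
qed

context filtered_prob_space
begin

text \<open>Pairs of a simple integrand and its integral over the whole time axis. Unlike in
  \<open>elementary_process\<close>, the intervals may overlap and come in any order, so sums and
  differences stay in the class and no common refinement of partitions has to be formed. A time
  horizon is encoded in the intervals.\<close>

inductive ito_simple ::
  "(real \<Rightarrow> 'a \<Rightarrow> real^'m::finite) \<Rightarrow> (real \<Rightarrow> 'a \<Rightarrow> real^'m^'n::finite) \<Rightarrow> ('a \<Rightarrow> real^'n) \<Rightarrow> bool"
  for W where
  zero: "ito_simple W (\<lambda>_ _. 0) (\<lambda>_. 0)"
| step: "\<lbrakk>ito_simple W V S; 0 \<le> s; s \<le> e; A \<in> borel_measurable (F s); bounded (A ` space M)\<rbrakk> \<Longrightarrow>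
     ito_simple W (\<lambda>r \<omega>. indicator {s<..e} r *\<^sub>R A \<omega> + V r \<omega>) (\<lambda>\<omega>. A \<omega> *v (W e \<omega> - W s \<omega>) + S \<omega>)"

lemma ito_simple_add:
  "ito_simple W V S \<Longrightarrow> ito_simple W V' S' \<Longrightarrow>
    ito_simple W (\<lambda>r \<omega>. V r \<omega> + V' r \<omega>) (\<lambda>\<omega>. S \<omega> + S' \<omega>)"
proof (induction rule: ito_simple.induct)
  case (step V S s e A)
  from ito_simple.step[OF step.IH[OF step.prems] step.hyps(2-5)] show ?case
    by (simp add: add.assoc)
qed simp

lemma ito_simple_uminus: "ito_simple W V S \<Longrightarrow> ito_simple W (\<lambda>r \<omega>. - V r \<omega>) (\<lambda>\<omega>. - S \<omega>)"
proof (induction rule: ito_simple.induct)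
  case zero
  then show ?case using ito_simple.zero by simp
next
  case (step V S s e A)
  have "- (A \<omega>) *v x = - (A \<omega> *v x)" for \<omega> x
    using matrix_vector_mult_diff_rdistrib[of 0 "A \<omega>" x] by simp
  moreover have "bounded ((\<lambda>\<omega>. - A \<omega>) ` space M)"
    using step.hyps(5) by (simp add: bounded_iff)
  ultimately show ?case
    using ito_simple.step[OF step.IH step.hyps(2,3), of "\<lambda>\<omega>. - A \<omega>"] step.hyps(4) by simp
qed

lemma ito_simple_single:
  "\<lbrakk>0 \<le> s; s \<le> e; A \<in> borel_measurable (F s); bounded (A ` space M)\<rbrakk> \<Longrightarrow>
    ito_simple W (\<lambda>r \<omega>. indicator {s<..e} r *\<^sub>R A \<omega>) (\<lambda>\<omega>. A \<omega> *v (W e \<omega> - W s \<omega>))"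
  using ito_simple.step[OF ito_simple.zero, of s e A W] by simp

lemma ito_simple_sum:
  assumes "\<And>i. i \<in> I \<Longrightarrow> ito_simple W (V i) (S i)"
  shows "ito_simple W (\<lambda>r \<omega>. \<Sum>i\<in>I. V i r \<omega>) (\<lambda>\<omega>. \<Sum>i\<in>I. S i \<omega>)"
  using assms
proof (induction I rule: infinite_finite_induct)
  case (insert i I)
  then show ?case using ito_simple_add[of W "V i" "S i"] by simp
qed (simp_all add: ito_simple.zero)

text \<open>Stopping at \<open>t\<close> cuts every interval at \<open>t\<close>. If it starts by
  \<open>t\<close>, its left end is unchanged and \<open>A i\<close> is still measurable there; if
  it starts later, both the integrand and the increment vanish.\<close>

lemma ito_simple_elementary:
  assumes el: "elementary_process n \<tau> A" and t: "0 \<le> t"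
  shows "ito_simple W (\<lambda>r \<omega>. indicator {0<..t} r *\<^sub>R elementary_value n \<tau> A r \<omega>) (elementary_integral W n \<tau> A t)"
proof -
  have 1: "ito_simple W (\<lambda>r \<omega>. indicator {0<..t} r *\<^sub>R (indicator {\<tau> i<..\<tau> (Suc i)} r *\<^sub>R A i \<omega>))
     (\<lambda>\<omega>. A i \<omega> *v (W (min t (\<tau> (Suc i))) \<omega> - W (min t (\<tau> i)) \<omega>))" if "i \<in> {..<n}" for i
  proof (cases "\<tau> i \<le> t")
    case True
    have "(\<lambda>r \<omega>. indicator {0<..t} r *\<^sub>R (indicator {\<tau> i<..\<tau> (Suc i)} r *\<^sub>R A i \<omega>))
      = (\<lambda>r \<omega>. indicator {min t (\<tau> i)<..min t (\<tau> (Suc i))} r *\<^sub>R A i \<omega>)"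
      using that el True by (intro ext) (auto simp: indicator_def elementary_process_def)
    moreover have "0 \<le> \<tau> i" "\<tau> i \<le> \<tau> (Suc i)" "A i \<in> borel_measurable (F (\<tau> i))" "bounded (A i ` space M)"
      using that el by (auto simp: elementary_process_def)
    then have "ito_simple W (\<lambda>r \<omega>. indicator {min t (\<tau> i)<..min t (\<tau> (Suc i))} r *\<^sub>R A i \<omega>)
       (\<lambda>\<omega>. A i \<omega> *v (W (min t (\<tau> (Suc i))) \<omega> - W (min t (\<tau> i)) \<omega>))"
      using True t by (intro ito_simple_single) (auto simp: min_absorb2)
    ultimately show ?thesis by (simp only:)
  next
    case False
    then have "(\<lambda>r \<omega>. indicator {0<..t} r *\<^sub>R (indicator {\<tau> i<..\<tau> (Suc i)} r *\<^sub>R A i \<omega>)) = (\<lambda>_ _. 0)"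
      by (intro ext) (auto simp: indicator_def)
    moreover have "t \<le> \<tau> (Suc i)" using that el False by (fastforce simp: elementary_process_def)
    ultimately show ?thesis using False by (simp add: min_absorb1 ito_simple.zero)
  qed
  show ?thesis
    unfolding elementary_value_def elementary_integral_def scaleR_sum_right
    by (rule ito_simple_sum) (rule 1)
qed

context
  fixes W :: "real \<Rightarrow> 'a \<Rightarrow> real^'m::finite"
  assumes bm: "brownian_motion W"
begin

text \<open>The polarised Ito isometry, bundled with the integrability that is needed to add such
  identities. Being bilinear, it can be proved by induction over sums, which the isometry for norms
  cannot.\<close>

definition ito_pair :: "(real \<Rightarrow> 'a \<Rightarrow> real^'m^'n::finite) \<Rightarrow> ('a \<Rightarrow> real^'n) \<Rightarrow>
    (real \<Rightarrow> 'a \<Rightarrow> real^'m^'n) \<Rightarrow> ('a \<Rightarrow> real^'n) \<Rightarrow> bool" where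
  "ito_pair V S V' S' \<longleftrightarrow> integrable M (\<lambda>\<omega>. S \<omega> \<bullet> S' \<omega>) \<and>
     (\<forall>\<omega>. integrable lborel (\<lambda>r. V r \<omega> \<bullet> V' r \<omega>)) \<and>
     integrable M (\<lambda>\<omega>. \<integral>r. V r \<omega> \<bullet> V' r \<omega> \<partial>lborel) \<and>
     (\<integral>\<omega>. S \<omega> \<bullet> S' \<omega> \<partial>M) = (\<integral>\<omega>. (\<integral>r. V r \<omega> \<bullet> V' r \<omega> \<partial>lborel) \<partial>M)"

text \<open>The inner product expands into products of increment coordinates with bounded weights
  \<open>c p q\<close> known at the later start. The terms with \<open>p \<noteq> q\<close> have
  mean zero; the diagonal yields the length of the overlap times the Frobenius inner product of the
  two matrices.\<close>

lemma ito_pair_single: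
  fixes A A' :: "'a \<Rightarrow> real^'m^'n::finite"
  assumes s: "0 \<le> s" "s \<le> e" and A: "A \<in> borel_measurable (F s)" "bounded (A ` space M)"
    and s': "0 \<le> s'" "s' \<le> e'" and A': "A' \<in> borel_measurable (F s')" "bounded (A' ` space M)"
  shows "ito_pair (\<lambda>r \<omega>. indicator {s<..e} r *\<^sub>R A \<omega>) (\<lambda>\<omega>. A \<omega> *v (W e \<omega> - W s \<omega>))
    (\<lambda>r \<omega>. indicator {s'<..e'} r *\<^sub>R A' \<omega>) (\<lambda>\<omega>. A' \<omega> *v (W e' \<omega> - W s' \<omega>))"
proof -
  define c where "c p q \<omega> = (\<Sum>r\<in>UNIV. A \<omega> $ r $ p * A' \<omega> $ r $ q)" for p q \<omega>
  let ?s = "max s s'"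
  obtain K K' where K: "0 \<le> K" "\<And>\<omega> i j. \<omega> \<in> space M \<Longrightarrow> \<bar>A \<omega> $ i $ j\<bar> \<le> K"
    and K': "0 \<le> K'" "\<And>\<omega> i j. \<omega> \<in> space M \<Longrightarrow> \<bar>A' \<omega> $ i $ j\<bar> \<le> K'"
    using bounded_image_nth_nth[OF A(2)] bounded_image_nth_nth[OF A'(2)] by metis
  have [measurable]: "A \<in> borel_measurable (F ?s)" "A' \<in> borel_measurable (F ?s)"
    using measurable_F_mono[OF s(1) _ A(1), of ?s] measurable_F_mono[OF s'(1) _ A'(1), of ?s] by auto
  have cm: "c p q \<in> borel_measurable (F ?s)" for p q
    unfolding c_def by measurable
  have cb: "\<bar>c p q \<omega>\<bar> \<le> CARD('n) * (K * K')" if "\<omega> \<in> space M" for p q \<omega>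
  proof -
    have "\<bar>c p q \<omega>\<bar> \<le> (\<Sum>r\<in>(UNIV::'n set). K * K')"
      unfolding c_def
      by (rule order_trans[OF sum_abs sum_mono]) (use that K K' in \<open>auto simp: abs_mult intro!: mult_mono\<close>)
    then show ?thesis by simp
  qed
  have ci: "integrable M (c p q)" for p q
    using measurable_F_M[OF _ cm[of p q]] s cb
    by (intro integrable_const_bound[where B="CARD('n) * (K * K')"]) auto
  let ?m = "measure lborel ({s<..e} \<inter> {s'<..e'})"
  have S: "(A \<omega> *v (W e \<omega> - W s \<omega>)) \<bullet> (A' \<omega> *v (W e' \<omega> - W s' \<omega>)) =
    (\<Sum>p\<in>UNIV. \<Sum>q\<in>UNIV. c p q \<omega> * ((W e \<omega> - W s \<omega>) $ p * (W e' \<omega> - W s' \<omega>) $ q))" for \<omega>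
    by (simp only: inner_matrix_vector_mult_both c_def)
  have V: "(indicator {s<..e} r *\<^sub>R A \<omega>) \<bullet> (indicator {s'<..e'} r *\<^sub>R A' \<omega>) =
      indicator ({s<..e} \<inter> {s'<..e'}) r *\<^sub>R (\<Sum>p\<in>UNIV. c p p \<omega>)" for r \<omega>
    by (simp only: inner_scaleR_left inner_scaleR_right inner_matrix_columns[of "A \<omega>"] c_def)
      (auto simp: indicator_def)
  have fin: "emeasure lborel ({s<..e} \<inter> {s'<..e'}) < \<infinity>"
    by (rule le_less_trans[OF emeasure_mono[of _ "{s<..e}"]]) (use s in auto)
  have iV: "integrable lborel (\<lambda>r. (indicator {s<..e} r *\<^sub>R A \<omega>) \<bullet> (indicator {s'<..e'} r *\<^sub>R A' \<omega>))" for \<omega>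
    unfolding V by (rule integrable_indicator) (use fin in auto)
  have xV: "(\<integral>r. (indicator {s<..e} r *\<^sub>R A \<omega>) \<bullet> (indicator {s'<..e'} r *\<^sub>R A' \<omega>) \<partial>lborel) = ?m * (\<Sum>p\<in>UNIV. c p p \<omega>)" for \<omega>
    unfolding V by simp
  note d = integrable_dW_product[OF bm s s' cm cb] expectation_dW_product[OF bm s s' cm cb]
  show ?thesis
    unfolding ito_pair_def
  proof (intro conjI allI iV)
    show "integrable M (\<lambda>\<omega>. (A \<omega> *v (W e \<omega> - W s \<omega>)) \<bullet> (A' \<omega> *v (W e' \<omega> - W s' \<omega>)))"
      unfolding S using d(1) by (intro Bochner_Integration.integrable_sum) auto
    show "integrable M (\<lambda>\<omega>. \<integral>r. (indicator {s<..e} r *\<^sub>R A \<omega>) \<bullet> (indicator {s'<..e'} r *\<^sub>R A' \<omega>) \<partial>lborel)"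
      unfolding xV by (intro integrable_mult_right Bochner_Integration.integrable_sum ci)
    have "(\<integral>\<omega>. (A \<omega> *v (W e \<omega> - W s \<omega>)) \<bullet> (A' \<omega> *v (W e' \<omega> - W s' \<omega>)) \<partial>M)
      = (\<Sum>p\<in>UNIV. \<Sum>q\<in>UNIV. (\<integral>\<omega>. c p q \<omega> \<partial>M) * (if p = q then ?m else 0))"
      unfolding S using d by (simp only: Bochner_Integration.integral_sum Bochner_Integration.integrable_sum)
    also have "\<dots> = (\<integral>\<omega>. ?m * (\<Sum>p\<in>UNIV. c p p \<omega>) \<partial>M)"
      using ci by (simp add: if_distrib sum_distrib_left sum_distrib_right mult.commute cong: if_cong)
    finally show "(\<integral>\<omega>. (A \<omega> *v (W e \<omega> - W s \<omega>)) \<bullet> (A' \<omega> *v (W e' \<omega> - W s' \<omega>)) \<partial>M)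
      = (\<integral>\<omega>. (\<integral>r. (indicator {s<..e} r *\<^sub>R A \<omega>) \<bullet> (indicator {s'<..e'} r *\<^sub>R A' \<omega>) \<partial>lborel) \<partial>M)"
      unfolding xV .
  qed
qed

lemma ito_pair_zero: "ito_pair V S (\<lambda>_ _. 0) (\<lambda>_. 0)" "ito_pair (\<lambda>_ _. 0) (\<lambda>_. 0) V S"
  by (simp_all add: ito_pair_def)

lemma ito_pair_add_right:
  "ito_pair V S V1 S1 \<Longrightarrow> ito_pair V S V2 S2 \<Longrightarrow>
    ito_pair V S (\<lambda>r \<omega>. V1 r \<omega> + V2 r \<omega>) (\<lambda>\<omega>. S1 \<omega> + S2 \<omega>)"
  by (simp add: ito_pair_def inner_add_right)

lemma ito_pair_add_left:
  "ito_pair V1 S1 V S \<Longrightarrow> ito_pair V2 S2 V S \<Longrightarrow>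
    ito_pair (\<lambda>r \<omega>. V1 r \<omega> + V2 r \<omega>) (\<lambda>\<omega>. S1 \<omega> + S2 \<omega>) V S"
  by (simp add: ito_pair_def inner_add_left)

text \<open>Bilinearity reduces both arguments to single intervals: an induction over the second
  pair runs inside each step of the induction over the first.\<close>

lemma ito_pair_ito_simple:
  assumes "ito_simple W V S" "ito_simple W V' S'"
  shows "ito_pair V S V' S'"
  using assms(1)
proof (induction rule: ito_simple.induct)
  case (step V S s e A)
  have "ito_pair (\<lambda>r \<omega>. indicator {s<..e} r *\<^sub>R A \<omega>) (\<lambda>\<omega>. A \<omega> *v (W e \<omega> - W s \<omega>)) V' S'"
    using assms(2)
  proof (induction rule: ito_simple.induct)
    case step': (step V S s' e' A')
    then show ?case
      using step by (intro ito_pair_add_right ito_pair_single) auto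
  qed (rule ito_pair_zero)
  then show ?case using step by (intro ito_pair_add_left)
qed (rule ito_pair_zero)

lemma ito_simple_isometry:
  assumes "ito_simple W V S"
  shows "(\<integral>\<^sup>+\<omega>. ennreal ((norm (S \<omega>))\<^sup>2) \<partial>M)
      = (\<integral>\<^sup>+\<omega>. (\<integral>\<^sup>+r. ennreal ((norm (V r \<omega>))\<^sup>2) \<partial>lborel) \<partial>M)"
proof -
  note p = ito_pair_ito_simple[OF assms assms, unfolded ito_pair_def, folded power2_norm_eq_inner]
  have "(\<integral>\<^sup>+\<omega>. ennreal ((norm (S \<omega>))\<^sup>2) \<partial>M) = ennreal (\<integral>\<omega>. (\<integral>r. (norm (V r \<omega>))\<^sup>2 \<partial>lborel) \<partial>M)"
    using p by (subst nn_integral_eq_integral) auto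
  also have "\<dots> = (\<integral>\<^sup>+\<omega>. (\<integral>\<^sup>+r. ennreal ((norm (V r \<omega>))\<^sup>2) \<partial>lborel) \<partial>M)"
    using p by (subst nn_integral_eq_integral[symmetric]) (auto simp: nn_integral_eq_integral)
  finally show "(\<integral>\<^sup>+\<omega>. ennreal ((norm (S \<omega>))\<^sup>2) \<partial>M)
      = (\<integral>\<^sup>+\<omega>. (\<integral>\<^sup>+r. ennreal ((norm (V r \<omega>))\<^sup>2) \<partial>lborel) \<partial>M)" .
qed

text \<open>Only the parts of the intervals inside \<open>[t, t']\<close> contribute to the
  increment. On such a part both \<open>Z\<close> and \<open>A i\<close> are known at the left end,
  so each summand has mean zero.\<close>

lemma
  fixes Z :: "'a \<Rightarrow> real^'n::finite"
  assumes el: "elementary_process n \<tau> A" and t: "0 \<le> t" "t \<le> t'"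
    and Z: "Z \<in> borel_measurable (F t)" "bounded (Z ` space M)"
  shows integrable_elementary_increment:
      "integrable M (\<lambda>\<omega>. Z \<omega> \<bullet> (elementary_integral W n \<tau> A t' \<omega> - elementary_integral W n \<tau> A t \<omega>))"
    and expectation_elementary_increment:
      "(\<integral>\<omega>. Z \<omega> \<bullet> (elementary_integral W n \<tau> A t' \<omega> - elementary_integral W n \<tau> A t \<omega>) \<partial>M) = 0"
proof -
  define a b where "a i = max t (min t' (\<tau> i))" and "b i = max t (min t' (\<tau> (Suc i)))" for i
  define f where "f i \<omega> = Z \<omega> \<bullet> (A i \<omega> *v (W (b i) \<omega> - W (a i) \<omega>))" for i \<omega>
  obtain K where K: "0 \<le> K" "\<And>\<omega>. \<omega> \<in> space M \<Longrightarrow> norm (Z \<omega>) \<le> K"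
    using Z(2) by (auto simp: bounded_iff) (meson abs_ge_zero abs_ge_self order_trans)
  have f: "integrable M (f i) \<and> (\<integral>\<omega>. f i \<omega> \<partial>M) = 0" if i: "i < n" for i
  proof (cases "\<tau> i \<le> t'")
    case False
    then have "a i = b i"
      using el i t by (fastforce simp: elementary_process_def a_def b_def min_def)
    then show ?thesis by (simp add: f_def[abs_def])
  next
    case True
    have A: "0 \<le> \<tau> i" "\<tau> i \<le> \<tau> (Suc i)" "A i \<in> borel_measurable (F (\<tau> i))" "bounded (A i ` space M)"
      using el i by (auto simp: elementary_process_def)
    have ab: "0 \<le> a i" "a i \<le> b i" "t \<le> a i" "\<tau> i \<le> a i"
      using A t True by (auto simp: a_def b_def)
    define C where "C p \<omega> = (\<Sum>r\<in>UNIV. Z \<omega> $ r * A i \<omega> $ r $ p)" for p \<omega>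
    have [measurable]: "A i \<in> borel_measurable (F (a i))" "Z \<in> borel_measurable (F (a i))"
      using measurable_F_mono[OF A(1) ab(4) A(3)] measurable_F_mono[OF t(1) ab(3) Z(1)] .
    have Cm: "C p \<in> borel_measurable (F (a i))" for p
      unfolding C_def by measurable
    obtain L where L: "0 \<le> L" "\<And>\<omega> r p. \<omega> \<in> space M \<Longrightarrow> \<bar>A i \<omega> $ r $ p\<bar> \<le> L"
      using bounded_image_nth_nth[OF A(4)] by metis
    have Cb: "\<bar>C p \<omega>\<bar> \<le> CARD('n) * (K * L)" if "\<omega> \<in> space M" for p \<omega>
    proof -
      have "\<bar>C p \<omega>\<bar> \<le> (\<Sum>r\<in>(UNIV::'n set). K * L)"
        unfolding C_def
        by (rule order_trans[OF sum_abs sum_mono])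
          (use that K L in \<open>auto simp: abs_mult intro!: mult_mono order_trans[OF component_le_norm_cart[of "Z \<omega>"]]\<close>)
      then show ?thesis by simp
    qed
    have Ci: "integrable M (C p)" for p
      using measurable_F_M[OF ab(1) Cm[of p]] Cb
      by (intro integrable_const_bound[where B="CARD('n) * (K * L)"]) auto
    have f_eq: "f i = (\<lambda>\<omega>. \<Sum>p\<in>UNIV. C p \<omega> * (W (b i) \<omega> - W (a i) \<omega>) $ p)"
      unfolding f_def C_def inner_vec_def matrix_vector_mult_def fun_eq_iff
      by (intro allI, simp only: vec_lambda_beta inner_real_def sum_distrib_left sum_distrib_right mult.assoc) (rule sum.swap)
    show ?thesis
      unfolding f_eq using integrable_mult_dW[OF bm ab(1,2) Cm Ci] expectation_mult_dW[OF bm ab(1,2) Cm Ci] by simp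
  qed
  have eq: "Z \<omega> \<bullet> (elementary_integral W n \<tau> A t' \<omega> - elementary_integral W n \<tau> A t \<omega>) = (\<Sum>i<n. f i \<omega>)" for \<omega>
  proof -
    \<comment> \<open>Clamping the end points to \<open>[t, t']\<close>: the difference of the
      values at \<open>min t' y\<close> and \<open>min t y\<close> equals the one at
      \<open>max t (min t' y)\<close> and \<open>t\<close>, and the value at \<open>t\<close>
      cancels between \<open>x\<close> and \<open>y\<close>.\<close>
    have w: "(W (min t' y) \<omega> - W (min t' x) \<omega>) - (W (min t y) \<omega> - W (min t x) \<omega>)
      = W (max t (min t' y)) \<omega> - W (max t (min t' x)) \<omega>" for x y
      using t by (auto simp: min_def max_def)
    show ?thesis
      unfolding elementary_integral_def f_def a_def b_def
      by (simp only: sum_subtractf[symmetric] matrix_vector_mult_diff_distrib[symmetric] w inner_sum_right)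
  qed
  show "integrable M (\<lambda>\<omega>. Z \<omega> \<bullet> (elementary_integral W n \<tau> A t' \<omega> - elementary_integral W n \<tau> A t \<omega>))"
    "(\<integral>\<omega>. Z \<omega> \<bullet> (elementary_integral W n \<tau> A t' \<omega> - elementary_integral W n \<tau> A t \<omega>) \<partial>M) = 0"
    unfolding eq using f by auto
qed

end

end

section \<open>Increments of Ito integrals\<close>

lemma nn_integral_iterated_mono_add3:
  fixes f g h :: "'a \<Rightarrow> real \<Rightarrow> ennreal"
  assumes [measurable]: "(\<lambda>(\<omega>, r). f \<omega> r) \<in> borel_measurable (M \<Otimes>\<^sub>M lborel)"
    "(\<lambda>(\<omega>, r). g \<omega> r) \<in> borel_measurable (M \<Otimes>\<^sub>M lborel)"
    "(\<lambda>(\<omega>, r). h \<omega> r) \<in> borel_measurable (M \<Otimes>\<^sub>M lborel)"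
    and le: "\<And>\<omega> r. v \<omega> r \<le> 3 * (f \<omega> r + g \<omega> r + h \<omega> r)"
  shows "(\<integral>\<^sup>+\<omega>. (\<integral>\<^sup>+r. v \<omega> r \<partial>lborel) \<partial>M) \<le> 3 * ((\<integral>\<^sup>+\<omega>. (\<integral>\<^sup>+r. f \<omega> r \<partial>lborel) \<partial>M)
    + (\<integral>\<^sup>+\<omega>. (\<integral>\<^sup>+r. g \<omega> r \<partial>lborel) \<partial>M) + (\<integral>\<^sup>+\<omega>. (\<integral>\<^sup>+r. h \<omega> r \<partial>lborel) \<partial>M))"
proof -
  have "(\<integral>\<^sup>+\<omega>. (\<integral>\<^sup>+r. v \<omega> r \<partial>lborel) \<partial>M) \<le> (\<integral>\<^sup>+\<omega>. (\<integral>\<^sup>+r. 3 * (f \<omega> r + g \<omega> r + h \<omega> r) \<partial>lborel) \<partial>M)"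
    by (intro nn_integral_mono le)
  also have "\<dots> = (\<integral>\<^sup>+\<omega>. 3 * ((\<integral>\<^sup>+r. f \<omega> r \<partial>lborel) + (\<integral>\<^sup>+r. g \<omega> r \<partial>lborel) + (\<integral>\<^sup>+r. h \<omega> r \<partial>lborel)) \<partial>M)"
    by (intro nn_integral_cong) (simp add: nn_integral_cmult nn_integral_add)
  also have "\<dots> = 3 * ((\<integral>\<^sup>+\<omega>. (\<integral>\<^sup>+r. f \<omega> r \<partial>lborel) \<partial>M)
    + (\<integral>\<^sup>+\<omega>. (\<integral>\<^sup>+r. g \<omega> r \<partial>lborel) \<partial>M) + (\<integral>\<^sup>+\<omega>. (\<integral>\<^sup>+r. h \<omega> r \<partial>lborel) \<partial>M))"
    by (simp add: nn_integral_cmult nn_integral_add)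
  finally show ?thesis .
qed

lemma nn_integral_norm_add3_squared:
  fixes f g h :: "'a \<Rightarrow> 'b::euclidean_space"
  assumes [measurable]: "f \<in> borel_measurable M" "g \<in> borel_measurable M" "h \<in> borel_measurable M"
    and eq: "\<And>\<omega>. \<omega> \<in> space M \<Longrightarrow> v \<omega> = f \<omega> + g \<omega> + h \<omega>"
  shows "(\<integral>\<^sup>+\<omega>. ennreal ((norm (v \<omega>))\<^sup>2) \<partial>M) \<le> 3 * ((\<integral>\<^sup>+\<omega>. ennreal ((norm (f \<omega>))\<^sup>2) \<partial>M)
    + (\<integral>\<^sup>+\<omega>. ennreal ((norm (g \<omega>))\<^sup>2) \<partial>M) + (\<integral>\<^sup>+\<omega>. ennreal ((norm (h \<omega>))\<^sup>2) \<partial>M))"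
proof -
  have "(\<integral>\<^sup>+\<omega>. ennreal ((norm (v \<omega>))\<^sup>2) \<partial>M) \<le>
    (\<integral>\<^sup>+\<omega>. 3 * (ennreal ((norm (f \<omega>))\<^sup>2) + ennreal ((norm (g \<omega>))\<^sup>2) + ennreal ((norm (h \<omega>))\<^sup>2)) \<partial>M)"
  proof (intro nn_integral_mono)
    fix \<omega> assume "\<omega> \<in> space M"
    then have "ennreal ((norm (v \<omega>))\<^sup>2) \<le> ennreal (3 * ((norm (f \<omega>))\<^sup>2 + (norm (g \<omega>))\<^sup>2 + (norm (h \<omega>))\<^sup>2))"
      by (intro ennreal_leI) (simp only: eq norm_add3_squared_le)
    also have "\<dots> = 3 * (ennreal ((norm (f \<omega>))\<^sup>2) + ennreal ((norm (g \<omega>))\<^sup>2) + ennreal ((norm (h \<omega>))\<^sup>2))"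
      by (simp add: ennreal_mult ennreal_plus)
    finally show "ennreal ((norm (v \<omega>))\<^sup>2) \<le> 3 * (ennreal ((norm (f \<omega>))\<^sup>2) + ennreal ((norm (g \<omega>))\<^sup>2) + ennreal ((norm (h \<omega>))\<^sup>2))" .
  qed
  also have "\<dots> = 3 * ((\<integral>\<^sup>+\<omega>. ennreal ((norm (f \<omega>))\<^sup>2) \<partial>M)
    + (\<integral>\<^sup>+\<omega>. ennreal ((norm (g \<omega>))\<^sup>2) \<partial>M) + (\<integral>\<^sup>+\<omega>. ennreal ((norm (h \<omega>))\<^sup>2) \<partial>M))"
    by (simp add: nn_integral_cmult nn_integral_add)
  finally show ?thesis .
qed

lemma ennreal_add_mult:
  "0 \<le> a \<Longrightarrow> 0 \<le> b \<Longrightarrow> 0 \<le> c \<Longrightarrow> ennreal (a + b * c) = ennreal a + ennreal b * ennreal c"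
  by (simp add: ennreal_plus ennreal_mult)

lemma tendsto_3_add3_ennreal:
  fixes a b c :: "nat \<Rightarrow> ennreal"
  assumes "a \<longlonglongrightarrow> x" "b \<longlonglongrightarrow> y" "c \<longlonglongrightarrow> z"
  shows "(\<lambda>k. 3 * (a k + b k + c k)) \<longlonglongrightarrow> 3 * (x + y + z)"
  using assms by (intro ennreal_tendsto_cmult tendsto_add) auto

context filtered_prob_space
begin

context
  fixes W :: "real \<Rightarrow> 'a \<Rightarrow> real^'m::finite"
  assumes bm: "brownian_motion W"
begin

lemma measurable_elementary_value:
  assumes "elementary_process n \<tau> A"
  shows "(\<lambda>(\<omega>, r). elementary_value n \<tau> A r \<omega>) \<in> borel_measurable (M \<Otimes>\<^sub>M lborel)"
proof -
  have [measurable]: "A i \<in> borel_measurable M" if "i \<in> {..<n}" for i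
    using assms that measurable_F_M[of "\<tau> i" "A i"] by (auto simp: elementary_process_def)
  have [measurable]: "(\<lambda>x. A i (fst x)) \<in> borel_measurable (M \<Otimes>\<^sub>M lborel)" if "i \<in> {..<n}" for i
    using that by measurable
  have [measurable]: "(\<lambda>x. indicat_real {\<tau> i<..\<tau> (Suc i)} (snd x)) \<in> borel_measurable (M \<Otimes>\<^sub>M lborel)" for i
    by measurable
  show ?thesis
    unfolding elementary_value_def split_beta' by (intro borel_measurable_sum borel_measurable_scaleR) auto
qed

lemma measurable_elementary_integral:
  assumes "elementary_process n \<tau> A" "0 \<le> t"
  shows "elementary_integral W n \<tau> A t \<in> borel_measurable M"
proof -
  have [measurable]: "A i \<in> borel_measurable M" if "i \<in> {..<n}" for i
    using assms that measurable_F_M[of "\<tau> i" "A i"] by (auto simp: elementary_process_def)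
  have [measurable]: "W (min t (\<tau> i)) \<in> borel_measurable M" "W (min t (\<tau> (Suc i))) \<in> borel_measurable M" if "i \<in> {..<n}" for i
    using assms that by (auto intro!: measurable_W_M[OF bm] simp: elementary_process_def)
  show ?thesis
    unfolding elementary_integral_def[abs_def]
    by (intro borel_measurable_sum borel_measurable_matrix_vector_mult borel_measurable_diff) auto
qed

context
  fixes H :: "real \<Rightarrow> 'a \<Rightarrow> real^'m^'n::finite" and t t' :: real and J J' :: "'a \<Rightarrow> real^'n"
  assumes J: "has_Ito_integral W H t J" and J': "has_Ito_integral W H t' J'"
    and t: "0 \<le> t" "t \<le> t'"
    and Hm: "(\<lambda>(\<omega>, r). indicator {0..} r *\<^sub>R H r \<omega>) \<in> borel_measurable (M \<Otimes>\<^sub>M lborel)"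
begin

text \<open>Only times in \<open>{0..e}\<close> count, so \<open>H\<close> may be replaced by its
  cut-off to nonnegative times, whose joint measurability is \<open>Hm\<close>.\<close>

lemma measurable_elementary_minus_integrand:
  assumes "elementary_process n \<tau> A"
  shows "(\<lambda>(\<omega>, r). ennreal ((norm (elementary_value n \<tau> A r \<omega> - H r \<omega>))\<^sup>2) * indicator {0..e} r)
    \<in> borel_measurable (M \<Otimes>\<^sub>M lborel)"
proof -
  have [measurable]: "(\<lambda>x. elementary_value n \<tau> A (snd x) (fst x)) \<in> borel_measurable (M \<Otimes>\<^sub>M lborel)"
    "(\<lambda>x. indicator {0..} (snd x) *\<^sub>R H (snd x) (fst x)) \<in> borel_measurable (M \<Otimes>\<^sub>M lborel)"
    using Hm measurable_elementary_value[OF assms] by (simp_all add: split_beta')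
  have "(\<lambda>(\<omega>, r). ennreal ((norm (elementary_value n \<tau> A r \<omega> - H r \<omega>))\<^sup>2) * indicator {0..e} r)
    = (\<lambda>x. ennreal ((norm (elementary_value n \<tau> A (snd x) (fst x) - indicator {0..} (snd x) *\<^sub>R H (snd x) (fst x)))\<^sup>2) * indicator {0..e} (snd x))"
    by (auto simp: fun_eq_iff indicator_def)
  also have "\<dots> \<in> borel_measurable (M \<Otimes>\<^sub>M lborel)"
    by measurable
  finally show ?thesis .
qed

text \<open>The definition chooses an approximating sequence for each time separately. The sequence
  for the later time \<open>t'\<close> approximates \<open>H\<close> on \<open>[0, t]\<close> too,
  so by the isometry its integrals up to \<open>t\<close> approach those of the sequence belonging
  to \<open>t\<close>, and hence converge to \<open>J\<close>. One sequence then serves both ends of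
  the increment.\<close>

lemma common_ito_approximation:
  obtains n \<tau> A where "\<And>k. elementary_process (n k) (\<tau> k) (A k)"
    "(\<lambda>k. \<integral>\<^sup>+\<omega>. ennreal ((norm (elementary_integral W (n k) (\<tau> k) (A k) t' \<omega> - J' \<omega>))\<^sup>2) \<partial>M) \<longlonglongrightarrow> 0"
    "(\<lambda>k. \<integral>\<^sup>+\<omega>. ennreal ((norm (elementary_integral W (n k) (\<tau> k) (A k) t \<omega> - J \<omega>))\<^sup>2) \<partial>M) \<longlonglongrightarrow> 0"
    "(\<lambda>k. \<integral>\<^sup>+\<omega>. (\<integral>\<^sup>+r\<in>{0..t'}. ennreal ((norm (elementary_value (n k) (\<tau> k) (A k) r \<omega> - H r \<omega>))\<^sup>2) \<partial>lborel) \<partial>M) \<longlonglongrightarrow> 0"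
proof -
  from J' obtain n \<tau> A where el: "\<And>k. elementary_process (n k) (\<tau> k) (A k)"
    and c: "(\<lambda>k. \<integral>\<^sup>+\<omega>. (\<integral>\<^sup>+r\<in>{0..t'}. ennreal ((norm (elementary_value (n k) (\<tau> k) (A k) r \<omega> - H r \<omega>))\<^sup>2) \<partial>lborel) \<partial>M) \<longlonglongrightarrow> 0"
    and a: "(\<lambda>k. \<integral>\<^sup>+\<omega>. ennreal ((norm (elementary_integral W (n k) (\<tau> k) (A k) t' \<omega> - J' \<omega>))\<^sup>2) \<partial>M) \<longlonglongrightarrow> 0"
    unfolding has_Ito_integral_def by auto
  from J obtain n2 \<tau>2 A2 where el2: "\<And>k. elementary_process (n2 k) (\<tau>2 k) (A2 k)"
    and c2: "(\<lambda>k. \<integral>\<^sup>+\<omega>. (\<integral>\<^sup>+r\<in>{0..t}. ennreal ((norm (elementary_value (n2 k) (\<tau>2 k) (A2 k) r \<omega> - H r \<omega>))\<^sup>2) \<partial>lborel) \<partial>M) \<longlonglongrightarrow> 0"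
    and a2: "(\<lambda>k. \<integral>\<^sup>+\<omega>. ennreal ((norm (elementary_integral W (n2 k) (\<tau>2 k) (A2 k) t \<omega> - J \<omega>))\<^sup>2) \<partial>M) \<longlonglongrightarrow> 0"
    unfolding has_Ito_integral_def by auto
  have [measurable]: "J \<in> borel_measurable M" using J by (simp add: has_Ito_integral_def)
  let ?I = "\<lambda>k. elementary_integral W (n k) (\<tau> k) (A k) t" and ?I2 = "\<lambda>k. elementary_integral W (n2 k) (\<tau>2 k) (A2 k) t"
  let ?V = "\<lambda>k. elementary_value (n k) (\<tau> k) (A k)" and ?V2 = "\<lambda>k. elementary_value (n2 k) (\<tau>2 k) (A2 k)"
  have [measurable]: "?I k \<in> borel_measurable M" "?I2 k \<in> borel_measurable M" for k
    using measurable_elementary_integral[OF el t(1)] measurable_elementary_integral[OF el2 t(1)] by auto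
  let ?c = "\<lambda>k. \<integral>\<^sup>+\<omega>. (\<integral>\<^sup>+r\<in>{0..t'}. ennreal ((norm (?V k r \<omega> - H r \<omega>))\<^sup>2) \<partial>lborel) \<partial>M"
  let ?c2 = "\<lambda>k. \<integral>\<^sup>+\<omega>. (\<integral>\<^sup>+r\<in>{0..t}. ennreal ((norm (?V2 k r \<omega> - H r \<omega>))\<^sup>2) \<partial>lborel) \<partial>M"
  let ?a2 = "\<lambda>k. \<integral>\<^sup>+\<omega>. ennreal ((norm (?I2 k \<omega> - J \<omega>))\<^sup>2) \<partial>M"
  \<comment> \<open>The two simple integrands are compared by inserting \<open>H\<close> between
    them; the third slot of the three-term estimate is filled with 0.\<close>
  have S: "(\<integral>\<^sup>+\<omega>. ennreal ((norm (?I k \<omega> - ?I2 k \<omega>))\<^sup>2) \<partial>M) \<le> 3 * (?c k + ?c2 k + 0)" for k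
  proof -
    have "ito_simple W (\<lambda>r \<omega>. indicator {0<..t} r *\<^sub>R ?V k r \<omega> + - (indicator {0<..t} r *\<^sub>R ?V2 k r \<omega>)) (\<lambda>\<omega>. ?I k \<omega> + - ?I2 k \<omega>)"
      by (intro ito_simple_add ito_simple_uminus ito_simple_elementary el el2 t)
    from ito_simple_isometry[OF bm this]
    have "(\<integral>\<^sup>+\<omega>. ennreal ((norm (?I k \<omega> - ?I2 k \<omega>))\<^sup>2) \<partial>M)
      = (\<integral>\<^sup>+\<omega>. (\<integral>\<^sup>+r. ennreal ((norm (indicator {0<..t} r *\<^sub>R ?V k r \<omega> - indicator {0<..t} r *\<^sub>R ?V2 k r \<omega>))\<^sup>2) \<partial>lborel) \<partial>M)"
      by simp
    also have "\<dots> \<le> 3 * (?c k + ?c2 k + (\<integral>\<^sup>+\<omega>. (\<integral>\<^sup>+r. 0 \<partial>(lborel :: real measure)) \<partial>M))"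
    proof (rule nn_integral_iterated_mono_add3[where f="\<lambda>\<omega> r. ennreal ((norm (?V k r \<omega> - H r \<omega>))\<^sup>2) * indicator {0..t'} r"
          and g="\<lambda>\<omega> r. ennreal ((norm (?V2 k r \<omega> - H r \<omega>))\<^sup>2) * indicator {0..t} r" and h="\<lambda>_ _. 0"])
      fix \<omega> r
      show "ennreal ((norm (indicator {0<..t} r *\<^sub>R ?V k r \<omega> - indicator {0<..t} r *\<^sub>R ?V2 k r \<omega>))\<^sup>2)
         \<le> 3 * (ennreal ((norm (?V k r \<omega> - H r \<omega>))\<^sup>2) * indicator {0..t'} r
            + ennreal ((norm (?V2 k r \<omega> - H r \<omega>))\<^sup>2) * indicator {0..t} r + 0)"
      proof (cases "r \<in> {0<..t}")
        case True
        have "ennreal ((norm (?V k r \<omega> - ?V2 k r \<omega>))\<^sup>2) \<le> ennreal (3 * ((norm (?V k r \<omega> - H r \<omega>))\<^sup>2 + (norm (?V2 k r \<omega> - H r \<omega>))\<^sup>2))"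
          using norm_add3_squared_le[of "?V k r \<omega> - H r \<omega>" "H r \<omega> - ?V2 k r \<omega>" 0]
          by (intro ennreal_leI) (simp add: norm_minus_commute)
        then show ?thesis using True t by (simp add: ennreal_mult ennreal_plus)
      qed simp
    qed (use measurable_elementary_minus_integrand[OF el] measurable_elementary_minus_integrand[OF el2] in simp_all)
    finally show ?thesis by simp
  qed
  have b: "(\<lambda>k. \<integral>\<^sup>+\<omega>. ennreal ((norm (?I k \<omega> - J \<omega>))\<^sup>2) \<partial>M) \<longlonglongrightarrow> 0"
  proof (rule tendsto_sandwich[OF _ _ tendsto_const])
    have 0: "(\<lambda>k. 3 * (3 * (?c k + ?c2 k + 0) + ?a2 k + 0)) \<longlonglongrightarrow> 3 * (3 * (0 + 0 + 0) + 0 + 0)"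
      by (intro tendsto_3_add3_ennreal c c2 a2 tendsto_const)
    then show "(\<lambda>k. 3 * (3 * (?c k + ?c2 k + 0) + ?a2 k + 0)) \<longlonglongrightarrow> 0" by simp
    show "\<forall>\<^sub>F k in sequentially. (\<integral>\<^sup>+\<omega>. ennreal ((norm (?I k \<omega> - J \<omega>))\<^sup>2) \<partial>M) \<le> 3 * (3 * (?c k + ?c2 k + 0) + ?a2 k + 0)"
    proof (intro always_eventually allI)
      fix k
      have "(\<integral>\<^sup>+\<omega>. ennreal ((norm (?I k \<omega> - J \<omega>))\<^sup>2) \<partial>M) \<le>
        3 * ((\<integral>\<^sup>+\<omega>. ennreal ((norm (?I k \<omega> - ?I2 k \<omega>))\<^sup>2) \<partial>M) + ?a2 k + (\<integral>\<^sup>+\<omega>. ennreal ((norm (0::real^'n))\<^sup>2) \<partial>M))"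
        by (rule nn_integral_norm_add3_squared) auto
      also have "\<dots> \<le> 3 * (3 * (?c k + ?c2 k + 0) + ?a2 k + 0)"
        using S[of k] by (intro mult_left_mono add_mono) auto
      finally show "(\<integral>\<^sup>+\<omega>. ennreal ((norm (?I k \<omega> - J \<omega>))\<^sup>2) \<partial>M) \<le> 3 * (3 * (?c k + ?c2 k + 0) + ?a2 k + 0)" .
    qed
  qed simp
  show ?thesis by (rule that[OF el a b c])
qed

text \<open>On the level of elementary processes this is the isometry for the integrand restricted
  to \<open>(t, t']\<close> minus \<open>B\<close>. The factor 9 is 3 times 3: the three-term
  estimate is applied once to the integrands and once to the approximations of \<open>J\<close> and
  \<open>J'\<close>.\<close>

lemma ito_increment_bound:
  assumes B: "B \<in> borel_measurable (F t)" "bounded (B ` space M)"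
  shows "(\<integral>\<^sup>+\<omega>. ennreal ((norm (J' \<omega> - J \<omega> - B \<omega> *v (W t' \<omega> - W t \<omega>)))\<^sup>2) \<partial>M)
    \<le> 9 * (\<integral>\<^sup>+\<omega>. (\<integral>\<^sup>+r\<in>{t..t'}. ennreal ((norm (H r \<omega> - B \<omega>))\<^sup>2) \<partial>lborel) \<partial>M)" (is "?L \<le> 9 * ?E")
proof -
  obtain n \<tau> A where el: "\<And>k. elementary_process (n k) (\<tau> k) (A k)"
    and a: "(\<lambda>k. \<integral>\<^sup>+\<omega>. ennreal ((norm (elementary_integral W (n k) (\<tau> k) (A k) t' \<omega> - J' \<omega>))\<^sup>2) \<partial>M) \<longlonglongrightarrow> 0"
    and b: "(\<lambda>k. \<integral>\<^sup>+\<omega>. ennreal ((norm (elementary_integral W (n k) (\<tau> k) (A k) t \<omega> - J \<omega>))\<^sup>2) \<partial>M) \<longlonglongrightarrow> 0"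
    and c: "(\<lambda>k. \<integral>\<^sup>+\<omega>. (\<integral>\<^sup>+r\<in>{0..t'}. ennreal ((norm (elementary_value (n k) (\<tau> k) (A k) r \<omega> - H r \<omega>))\<^sup>2) \<partial>lborel) \<partial>M) \<longlonglongrightarrow> 0"
    by (rule common_ito_approximation) (rule that; assumption)
  have t': "0 \<le> t'" using t by simp
  let ?I = "\<lambda>k. elementary_integral W (n k) (\<tau> k) (A k)" and ?V = "\<lambda>k. elementary_value (n k) (\<tau> k) (A k)"
  let ?dW = "\<lambda>\<omega>. B \<omega> *v (W t' \<omega> - W t \<omega>)"
  have [measurable]: "J \<in> borel_measurable M" "J' \<in> borel_measurable M" "B \<in> borel_measurable M"
    "W t \<in> borel_measurable M" "W t' \<in> borel_measurable M"
    using J J' measurable_F_M[OF t(1) B(1)] measurable_W_M[OF bm] t by (auto simp: has_Ito_integral_def)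
  have [measurable]: "?I k t \<in> borel_measurable M" "?I k t' \<in> borel_measurable M" for k
    using measurable_elementary_integral[OF el] t by auto
  let ?a = "\<lambda>k. \<integral>\<^sup>+\<omega>. ennreal ((norm (?I k t' \<omega> - J' \<omega>))\<^sup>2) \<partial>M"
  let ?b = "\<lambda>k. \<integral>\<^sup>+\<omega>. ennreal ((norm (?I k t \<omega> - J \<omega>))\<^sup>2) \<partial>M"
  let ?c = "\<lambda>k. \<integral>\<^sup>+\<omega>. (\<integral>\<^sup>+r\<in>{0..t'}. ennreal ((norm (?V k r \<omega> - H r \<omega>))\<^sup>2) \<partial>lborel) \<partial>M"
  have S: "(\<integral>\<^sup>+\<omega>. ennreal ((norm (?I k t' \<omega> - ?I k t \<omega> - ?dW \<omega>))\<^sup>2) \<partial>M) \<le> 3 * (?c k + ?E + 0)" for k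
  proof -
    have "ito_simple W (\<lambda>r \<omega>. indicator {0<..t'} r *\<^sub>R ?V k r \<omega> + (- (indicator {0<..t} r *\<^sub>R ?V k r \<omega>) + - (indicator {t<..t'} r *\<^sub>R B \<omega>)))
        (\<lambda>\<omega>. ?I k t' \<omega> + (- ?I k t \<omega> + - ?dW \<omega>))"
      by (intro ito_simple_add ito_simple_uminus ito_simple_elementary ito_simple_single el t t' B)
    from ito_simple_isometry[OF bm this]
    have "(\<integral>\<^sup>+\<omega>. ennreal ((norm (?I k t' \<omega> - ?I k t \<omega> - ?dW \<omega>))\<^sup>2) \<partial>M)
      = (\<integral>\<^sup>+\<omega>. (\<integral>\<^sup>+r. ennreal ((norm (indicator {0<..t'} r *\<^sub>R ?V k r \<omega> - indicator {0<..t} r *\<^sub>R ?V k r \<omega> - indicator {t<..t'} r *\<^sub>R B \<omega>))\<^sup>2) \<partial>lborel) \<partial>M)"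
      by (simp only: diff_conv_add_uminus add.assoc)
    also have "\<dots> \<le> 3 * (?c k + ?E + (\<integral>\<^sup>+\<omega>. (\<integral>\<^sup>+r. 0 \<partial>(lborel :: real measure)) \<partial>M))"
    proof (rule nn_integral_iterated_mono_add3[where f="\<lambda>\<omega> r. ennreal ((norm (?V k r \<omega> - H r \<omega>))\<^sup>2) * indicator {0..t'} r"
          and g="\<lambda>\<omega> r. ennreal ((norm (H r \<omega> - B \<omega>))\<^sup>2) * indicator {t..t'} r" and h="\<lambda>_ _. 0"])
      fix \<omega> r
      show "ennreal ((norm (indicator {0<..t'} r *\<^sub>R ?V k r \<omega> - indicator {0<..t} r *\<^sub>R ?V k r \<omega> - indicator {t<..t'} r *\<^sub>R B \<omega>))\<^sup>2)
         \<le> 3 * (ennreal ((norm (?V k r \<omega> - H r \<omega>))\<^sup>2) * indicator {0..t'} r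
            + ennreal ((norm (H r \<omega> - B \<omega>))\<^sup>2) * indicator {t..t'} r + 0)"
      proof (cases "r \<in> {t<..t'}")
        case True
        have "ennreal ((norm (?V k r \<omega> - B \<omega>))\<^sup>2) \<le> ennreal (3 * ((norm (?V k r \<omega> - H r \<omega>))\<^sup>2 + (norm (H r \<omega> - B \<omega>))\<^sup>2))"
          using norm_add3_squared_le[of "?V k r \<omega> - H r \<omega>" "H r \<omega> - B \<omega>" 0]
          by (intro ennreal_leI) simp
        then show ?thesis using True t by (simp add: ennreal_mult ennreal_plus)
      next
        case False
        then have "indicator {0<..t'} r *\<^sub>R ?V k r \<omega> - indicator {0<..t} r *\<^sub>R ?V k r \<omega> - indicator {t<..t'} r *\<^sub>R B \<omega> = 0"
          using t by (auto simp: indicator_def)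
        then show ?thesis by simp
      qed
    next
      have [measurable]: "(\<lambda>x. indicator {0..} (snd x) *\<^sub>R H (snd x) (fst x)) \<in> borel_measurable (M \<Otimes>\<^sub>M lborel)"
        using Hm by (simp add: split_beta')
      have "(\<lambda>(\<omega>, r). ennreal ((norm (H r \<omega> - B \<omega>))\<^sup>2) * indicator {t..t'} r)
        = (\<lambda>x. ennreal ((norm (indicator {0..} (snd x) *\<^sub>R H (snd x) (fst x) - B (fst x)))\<^sup>2) * indicator {t..t'} (snd x))"
        using t by (auto simp: fun_eq_iff indicator_def)
      also have "\<dots> \<in> borel_measurable (M \<Otimes>\<^sub>M lborel)"
        by measurable
      finally show "(\<lambda>(\<omega>, r). ennreal ((norm (H r \<omega> - B \<omega>))\<^sup>2) * indicator {t..t'} r) \<in> borel_measurable (M \<Otimes>\<^sub>M lborel)" .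
    qed (use measurable_elementary_minus_integrand[OF el] in simp_all)
    finally show ?thesis by simp
  qed
  have "?L \<le> 3 * (?a k + ?b k + 3 * (?c k + ?E + 0))" for k
  proof -
    have "?L \<le> 3 * ((\<integral>\<^sup>+\<omega>. ennreal ((norm (J' \<omega> - ?I k t' \<omega>))\<^sup>2) \<partial>M) + ?b k
       + (\<integral>\<^sup>+\<omega>. ennreal ((norm (?I k t' \<omega> - ?I k t \<omega> - ?dW \<omega>))\<^sup>2) \<partial>M))"
      by (rule nn_integral_norm_add3_squared) auto
    also have "\<dots> \<le> 3 * (?a k + ?b k + 3 * (?c k + ?E + 0))"
      using S[of k] by (intro mult_left_mono add_mono) (auto simp: norm_minus_commute)
    finally show ?thesis .
  qed
  moreover have "(\<lambda>k. 3 * (?a k + ?b k + 3 * (?c k + ?E + 0))) \<longlonglongrightarrow> 3 * (0 + 0 + 3 * (0 + ?E + 0))"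
    by (intro tendsto_3_add3_ennreal a b c tendsto_const)
  ultimately have "?L \<le> 3 * (0 + 0 + 3 * (0 + ?E + 0))"
    by (intro LIMSEQ_le_const) auto
  then show ?thesis by (simp add: mult.assoc[symmetric])
qed

text \<open>The martingale property in tested form. It is exact for elementary integrands, and the
  mean square convergence of the common approximation at both times carries it over to the
  limit.\<close>

lemma ito_increment_mean:
  assumes Z: "Z \<in> borel_measurable (F t)" "bounded (Z ` space M)"
    and int: "integrable M (\<lambda>\<omega>. Z \<omega> \<bullet> (J' \<omega> - J \<omega>))"
  shows "(\<integral>\<omega>. Z \<omega> \<bullet> (J' \<omega> - J \<omega>) \<partial>M) = 0"
proof -
  obtain n \<tau> A where el: "\<And>k. elementary_process (n k) (\<tau> k) (A k)"
    and a: "(\<lambda>k. \<integral>\<^sup>+\<omega>. ennreal ((norm (elementary_integral W (n k) (\<tau> k) (A k) t' \<omega> - J' \<omega>))\<^sup>2) \<partial>M) \<longlonglongrightarrow> 0"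
    and b: "(\<lambda>k. \<integral>\<^sup>+\<omega>. ennreal ((norm (elementary_integral W (n k) (\<tau> k) (A k) t \<omega> - J \<omega>))\<^sup>2) \<partial>M) \<longlonglongrightarrow> 0"
    and "(\<lambda>k. \<integral>\<^sup>+\<omega>. (\<integral>\<^sup>+r\<in>{0..t'}. ennreal ((norm (elementary_value (n k) (\<tau> k) (A k) r \<omega> - H r \<omega>))\<^sup>2) \<partial>lborel) \<partial>M) \<longlonglongrightarrow> 0"
    by (rule common_ito_approximation) (rule that; assumption)
  have t': "0 \<le> t'" using t by simp
  let ?I = "\<lambda>k. elementary_integral W (n k) (\<tau> k) (A k)"
  have [measurable]: "J \<in> borel_measurable M" "J' \<in> borel_measurable M" "Z \<in> borel_measurable M"
    using J J' measurable_F_M[OF t(1) Z(1)] by (auto simp: has_Ito_integral_def)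
  have [measurable]: "?I k t \<in> borel_measurable M" "?I k t' \<in> borel_measurable M" for k
    using measurable_elementary_integral[OF el] t by auto
  let ?a = "\<lambda>k. \<integral>\<^sup>+\<omega>. ennreal ((norm (?I k t' \<omega> - J' \<omega>))\<^sup>2) \<partial>M"
  let ?b = "\<lambda>k. \<integral>\<^sup>+\<omega>. ennreal ((norm (?I k t \<omega> - J \<omega>))\<^sup>2) \<partial>M"
  obtain K where K: "0 < K" "\<And>\<omega>. \<omega> \<in> space M \<Longrightarrow> norm (Z \<omega>) \<le> K"
    using bounded_pos[THEN iffD1, OF Z(2)] by auto
  let ?Y = "\<lambda>k \<omega>. (J' \<omega> - J \<omega>) - (?I k t' \<omega> - ?I k t \<omega>)"
  \<comment> \<open>Elementary increments have mean zero against \<open>Z\<close>, so only the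
    approximation error \<open>?Y k\<close> is left. Here \<open>\<epsilon>\<close> stays fixed
    while \<open>k\<close> tends to infinity; afterwards \<open>\<epsilon>\<close> is made
    small.\<close>
  have le: "ennreal \<bar>\<integral>\<omega>. Z \<omega> \<bullet> (J' \<omega> - J \<omega>) \<partial>M\<bar> \<le> K * \<epsilon> + (K / \<epsilon>) * (3 * (?a k + ?b k + 0))"
    if \<epsilon>: "0 < \<epsilon>" for \<epsilon> :: real and k
  proof -
    note i = integrable_elementary_increment[OF bm el t Z] expectation_elementary_increment[OF bm el t Z]
    have "(\<integral>\<omega>. Z \<omega> \<bullet> ?Y k \<omega> \<partial>M) = (\<integral>\<omega>. Z \<omega> \<bullet> (J' \<omega> - J \<omega>) \<partial>M)"
      using i int by (subst inner_diff_right) simp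
    then have "ennreal \<bar>\<integral>\<omega>. Z \<omega> \<bullet> (J' \<omega> - J \<omega>) \<partial>M\<bar> \<le> (\<integral>\<^sup>+\<omega>. ennreal \<bar>Z \<omega> \<bullet> ?Y k \<omega>\<bar> \<partial>M)"
      using integral_norm_bound_ennreal[of M "\<lambda>\<omega>. Z \<omega> \<bullet> ?Y k \<omega>"] i int
      by (simp add: inner_diff_right)
    also have "\<dots> \<le> (\<integral>\<^sup>+\<omega>. ennreal (K * \<epsilon>) + ennreal (K / \<epsilon>) * ennreal ((norm (?Y k \<omega>))\<^sup>2) \<partial>M)"
    proof (intro nn_integral_mono)
      fix \<omega> assume \<omega>: "\<omega> \<in> space M"
      let ?y = "norm (?Y k \<omega>)"
      \<comment> \<open>This takes the place of Cauchy-Schwarz and its square root: either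
        \<open>?y \<le> \<epsilon>\<close> or
        \<open>?y \<le> ?y\<^sup>2 / \<epsilon>\<close>.\<close>
      have "?y \<le> \<epsilon> + ?y\<^sup>2 / \<epsilon>"
      proof (cases "?y \<le> \<epsilon>")
        case False
        then have "?y * 1 \<le> ?y * (?y / \<epsilon>)"
          using \<epsilon> by (intro mult_left_mono) (auto simp: field_simps)
        then show ?thesis using \<epsilon> by (simp add: power2_eq_square)
      qed (use \<epsilon> in \<open>simp add: add_increasing2\<close>)
      then have "K * ?y \<le> K * \<epsilon> + (K / \<epsilon>) * ?y\<^sup>2"
        using mult_left_mono[of ?y "\<epsilon> + ?y\<^sup>2 / \<epsilon>" K] K(1) by (simp add: distrib_left)
      moreover have "\<bar>Z \<omega> \<bullet> ?Y k \<omega>\<bar> \<le> K * ?y"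
        by (rule order_trans[OF Cauchy_Schwarz_ineq2]) (intro mult_right_mono K \<omega> norm_ge_zero)
      ultimately have "\<bar>Z \<omega> \<bullet> ?Y k \<omega>\<bar> \<le> K * \<epsilon> + (K / \<epsilon>) * ?y\<^sup>2" by linarith
      then have "ennreal \<bar>Z \<omega> \<bullet> ?Y k \<omega>\<bar> \<le> ennreal (K * \<epsilon> + (K / \<epsilon>) * ?y\<^sup>2)"
        by (rule ennreal_leI)
      also have "\<dots> = ennreal (K * \<epsilon>) + ennreal (K / \<epsilon>) * ennreal (?y\<^sup>2)"
        using K(1) \<epsilon> by (intro ennreal_add_mult) auto
      finally show "ennreal \<bar>Z \<omega> \<bullet> ?Y k \<omega>\<bar> \<le> ennreal (K * \<epsilon>) + ennreal (K / \<epsilon>) * ennreal (?y\<^sup>2)" .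
    qed
    also have "\<dots> = ennreal (K * \<epsilon>) + ennreal (K / \<epsilon>) * (\<integral>\<^sup>+\<omega>. ennreal ((norm (?Y k \<omega>))\<^sup>2) \<partial>M)"
      by (simp add: nn_integral_add nn_integral_cmult emeasure_space_1)
    also have "(\<integral>\<^sup>+\<omega>. ennreal ((norm (?Y k \<omega>))\<^sup>2) \<partial>M) \<le>
       3 * ((\<integral>\<^sup>+\<omega>. ennreal ((norm (J' \<omega> - ?I k t' \<omega>))\<^sup>2) \<partial>M) + ?b k + (\<integral>\<^sup>+\<omega>. ennreal ((norm (0::real^'n))\<^sup>2) \<partial>M))"
      by (rule nn_integral_norm_add3_squared) auto
    also have "\<dots> = 3 * (?a k + ?b k + 0)"
      by (simp add: norm_minus_commute)
    finally show ?thesis by (simp add: mult_left_mono add_left_mono)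
  qed
  have "\<bar>\<integral>\<omega>. Z \<omega> \<bullet> (J' \<omega> - J \<omega>) \<partial>M\<bar> \<le> K * \<epsilon>" if \<epsilon>: "0 < \<epsilon>" for \<epsilon>
  proof -
    have "(\<lambda>k. ennreal (K * \<epsilon>) + ennreal (K / \<epsilon>) * (3 * (?a k + ?b k + 0)))
      \<longlonglongrightarrow> ennreal (K * \<epsilon>) + ennreal (K / \<epsilon>) * (3 * (0 + 0 + 0))"
      by (intro tendsto_add tendsto_const ennreal_tendsto_cmult tendsto_3_add3_ennreal a b) auto
    then have "ennreal \<bar>\<integral>\<omega>. Z \<omega> \<bullet> (J' \<omega> - J \<omega>) \<partial>M\<bar> \<le> ennreal (K * \<epsilon>) + ennreal (K / \<epsilon>) * (3 * (0 + 0 + 0))"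
      using le[OF \<epsilon>] by (intro LIMSEQ_le_const) auto
    then show ?thesis using K(1) \<epsilon> by (simp add: ennreal_le_iff)
  qed
  then have "\<bar>\<integral>\<omega>. Z \<omega> \<bullet> (J' \<omega> - J \<omega>) \<partial>M\<bar> \<le> K * (\<epsilon> / K)" if "0 < \<epsilon>" for \<epsilon>
    using that K(1) by (meson divide_pos_pos)
  then have "\<bar>\<integral>\<omega>. Z \<omega> \<bullet> (J' \<omega> - J \<omega>) \<partial>M\<bar> \<le> 0 + \<epsilon>" if "0 < \<epsilon>" for \<epsilon>
    using that K(1) by simp
  then have "\<bar>\<integral>\<omega>. Z \<omega> \<bullet> (J' \<omega> - J \<omega>) \<partial>M\<bar> \<le> 0"
    by (rule field_le_epsilon)
  then show ?thesis by simp
qed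

end

end

end

section \<open>One-sided derivatives, bounded convergence and Taylor expansion\<close>

text \<open>Consider the points up to which \<open>f\<close> stays in a cone of slope
  \<open>\<epsilon>\<close> about its initial value. By continuity their supremum \<open>c\<close>
  still satisfies the bound, and by the right derivative at \<open>c\<close> the bound extends
  beyond \<open>c\<close> unless \<open>c = b\<close>. Letting the slope tend to 0 gives the
  claim.\<close>

lemma right_derivative_zero_const:
  fixes f :: "real \<Rightarrow> real"
  assumes ab: "a \<le> b" and cont: "continuous_on {a..b} f"
    and lim: "\<And>t. t \<in> {a..<b} \<Longrightarrow> ((\<lambda>h. (f (t + h) - f t) / h) \<longlongrightarrow> 0) (at_right 0)"
  shows "f b = f a"
proof -
  have "\<bar>f b - f a\<bar> \<le> \<epsilon> * (b - a)" if \<epsilon>: "0 < \<epsilon>" for \<epsilon>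
  proof -
    define S where "S = {x \<in> {a..b}. \<forall>y\<in>{a..x}. \<bar>f y - f a\<bar> \<le> \<epsilon> * (y - a)}"
    define c where "c = Sup S"
    have aS: "a \<in> S" using ab by (auto simp: S_def)
    have bdd: "bdd_above S" by (auto simp: S_def intro!: bdd_aboveI[of _ b])
    have c: "a \<le> c" "c \<le> b"
      unfolding c_def using cSup_upper[OF aS bdd] aS by (auto intro!: cSup_least simp: S_def)
    have less: "\<bar>f y - f a\<bar> \<le> \<epsilon> * (y - a)" if "a \<le> y" "y < c" for y
    proof -
      obtain x where "x \<in> S" "y < x" using \<open>y < c\<close> less_cSupE[of y S] aS by (auto simp: c_def)
      then show ?thesis using \<open>a \<le> y\<close> by (auto simp: S_def)
    qed
    have at_c: "\<bar>f c - f a\<bar> \<le> \<epsilon> * (c - a)"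
    proof (cases "a < c")
      case True
      have "continuous_on {a..c} (\<lambda>y. \<epsilon> * (y - a) - \<bar>f y - f a\<bar>)"
        using continuous_on_subset[OF cont, of "{a..c}"] c by (intro continuous_intros) auto
      moreover have "closure {a<..<c} = {a..c}" using True by (rule closure_greaterThanLessThan)
      ultimately have "0 \<le> \<epsilon> * (c - a) - \<bar>f c - f a\<bar>"
        using continuous_ge_on_closure[of "{a<..<c}" "\<lambda>y. \<epsilon> * (y - a) - \<bar>f y - f a\<bar>" c 0] less True by auto
      then show ?thesis by simp
    qed (use c in auto)
    have "c = b"
    proof (rule ccontr)
      assume "c \<noteq> b"
      then have cb: "c < b" using c by simp
      have "\<forall>\<^sub>F h in at_right 0. dist ((f (c + h) - f c) / h) 0 < \<epsilon>"
        using lim[of c] cb c \<epsilon> by (intro tendstoD) auto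
      then obtain d where d: "0 < d" "\<And>h. 0 < h \<Longrightarrow> h < d \<Longrightarrow> \<bar>(f (c + h) - f c) / h\<bar> < \<epsilon>"
        by (auto simp: eventually_at_right_field)
      \<comment> \<open>Halving \<open>d\<close> keeps all points up to \<open>c + e\<close>
        strictly within the range of the derivative estimate; the other entry keeps them in
        \<open>{a..b}\<close>.\<close>
      define e where "e = min (d / 2) (b - c)"
      have e: "0 < e" "e < d" "c + e \<le> b" using d cb by (auto simp: e_def min_def)
      have "c + e \<in> S"
        unfolding S_def
      proof (intro CollectI conjI ballI)
        show "c + e \<in> {a..b}" using c e by auto
        fix y assume y: "y \<in> {a..c + e}"
        consider "y < c" | "y = c" | "y > c" by linarith
        then show "\<bar>f y - f a\<bar> \<le> \<epsilon> * (y - a)"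
        proof cases
          case 3
          then have "\<bar>f y - f c\<bar> \<le> \<epsilon> * (y - c)"
            using d(2)[of "y - c"] y e by (simp add: field_simps)
          then show ?thesis using at_c by (simp add: algebra_simps)
        qed (use y less at_c in auto)
      qed
      then have "c + e \<le> c" unfolding c_def by (rule cSup_upper[OF _ bdd])
      then show False using e by simp
    qed
    then show ?thesis using at_c by simp
  qed
  note * = this
  have "\<bar>f b - f a\<bar> \<le> 0 + \<epsilon>" if "0 < \<epsilon>" for \<epsilon>
  proof (cases "a = b")
    case False
    then show ?thesis using *[of "\<epsilon> / (b - a)"] that ab by simp
  qed (use that in simp)
  then have "\<bar>f b - f a\<bar> \<le> 0" by (rule field_le_epsilon)
  then show ?thesis by simp
qed

text \<open>Limits from the right can thus be taken over a bounded interval, which keeps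
  \<open>t + h\<close> in the range where the integrands are measurable and bounded.\<close>

lemma at_right_eq_Ioo: "a < b \<Longrightarrow> at a within {a<..<b} = at_right a" for a b :: real
  by (rule at_within_nhd[of _ "{..<b}"]) auto

lemma DERIV_right_quotient:
  fixes f :: "real \<Rightarrow> real"
  assumes "(f has_real_derivative D) (at t within {a..b})" "a \<le> t" "t < b"
  shows "((\<lambda>h. (f (t + h) - f t) / h) \<longlongrightarrow> D) (at_right 0)"
proof -
  have "(f has_real_derivative D) (at t within {t<..<b})"
    by (rule DERIV_subset[OF assms(1)]) (use assms in auto)
  then have "((\<lambda>y. (f y - f t) / (y - t)) \<longlongrightarrow> D) (at_right t)"
    using assms by (simp add: has_field_derivative_iff at_right_eq_Ioo)
  then show ?thesis
    by (subst (asm) filterlim_at_right_to_0) (simp add: add.commute)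
qed

lemma integral_right_quotient:
  fixes c :: "real \<Rightarrow> real"
  assumes "continuous_on {a..b} c" "a \<le> t" "t < b"
  shows "((\<lambda>h. (integral {a..t + h} c - integral {a..t} c) / h) \<longlongrightarrow> c t) (at_right 0)"
  using assms by (intro DERIV_right_quotient[where a=a and b=b] integral_has_real_derivative) auto

lemma right_derivative_integral:
  fixes f :: "real \<Rightarrow> real"
  assumes ab: "a \<le> b" and f: "continuous_on {a..b} f" and g: "continuous_on {a..b} g"
    and lim: "\<And>t. t \<in> {a..<b} \<Longrightarrow> ((\<lambda>h. (f (t + h) - f t) / h) \<longlongrightarrow> g t) (at_right 0)"
  shows "f b - f a = integral {a..b} g"
proof -
  have "f b - integral {a..b} g = f a - integral {a..a} g"
  proof (rule right_derivative_zero_const[OF ab])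
    show "continuous_on {a..b} (\<lambda>t. f t - integral {a..t} g)"
      by (intro continuous_intros f indefinite_integral_continuous_1 integrable_continuous_real g)
    fix t assume t: "t \<in> {a..<b}"
    have "((\<lambda>h. (f (t + h) - f t) / h - (integral {a..t + h} g - integral {a..t} g) / h) \<longlongrightarrow> g t - g t) (at_right 0)"
      using t by (intro tendsto_diff lim integral_right_quotient[OF g]) auto
    then show "((\<lambda>h. (f (t + h) - integral {a..t + h} g - (f t - integral {a..t} g)) / h) \<longlongrightarrow> 0) (at_right 0)"
      by (simp add: diff_divide_distrib add_divide_distrib algebra_simps)
  qed
  then show ?thesis by simp
qed

section \<open>Bounded convergence and joint measurability\<close>

lemma (in finite_measure) bounded_convergence_within:
  fixes f :: "'b::metric_space \<Rightarrow> 'a \<Rightarrow> real"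
  assumes m: "\<And>h. h \<in> S - {x} \<Longrightarrow> f h \<in> borel_measurable M" "l \<in> borel_measurable M"
    and b: "\<And>h. h \<in> S - {x} \<Longrightarrow> AE \<omega> in M. \<bar>f h \<omega>\<bar> \<le> K"
    and lim: "\<And>\<omega>. \<omega> \<in> space M \<Longrightarrow> ((\<lambda>h. f h \<omega>) \<longlongrightarrow> l \<omega>) (at x within S)"
  shows "((\<lambda>h. \<integral>\<omega>. f h \<omega> \<partial>M) \<longlongrightarrow> (\<integral>\<omega>. l \<omega> \<partial>M)) (at x within S)"
  unfolding tendsto_at_iff_sequentially comp_def
proof (intro allI impI)
  fix X :: "nat \<Rightarrow> 'b" assume X: "\<forall>i. X i \<in> S - {x}" "X \<longlonglongrightarrow> x"
  show "(\<lambda>i. \<integral>\<omega>. f (X i) \<omega> \<partial>M) \<longlonglongrightarrow> (\<integral>\<omega>. l \<omega> \<partial>M)"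
  proof (rule integral_dominated_convergence[where w="\<lambda>_. K"])
    show "AE \<omega> in M. (\<lambda>i. f (X i) \<omega>) \<longlonglongrightarrow> l \<omega>"
    proof (rule AE_I2)
      fix \<omega> assume "\<omega> \<in> space M"
      from lim[OF this] X show "(\<lambda>i. f (X i) \<omega>) \<longlonglongrightarrow> l \<omega>"
        unfolding tendsto_at_iff_sequentially comp_def by blast
    qed
  qed (use m b X in auto)
qed

text \<open>Rounding the time down to a grid of mesh \<open>1 / Suc n\<close> leaves countably many
  time slices, and path continuity recovers the process in the limit. The sigma-algebra is left open
  so that the lemma applies to \<open>F t\<close> as well as to \<open>M\<close>.\<close>

lemma measurable_jointly_continuous_left:
  fixes Y :: "real \<Rightarrow> 'a \<Rightarrow> 'b::{metric_space, second_countable_topology}"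
  assumes m: "\<And>r. Y r \<in> borel_measurable N"
    and c: "\<And>\<omega>. \<omega> \<in> space N \<Longrightarrow> continuous_on UNIV (\<lambda>r. Y r \<omega>)"
  shows "(\<lambda>(\<omega>, r). Y r \<omega>) \<in> borel_measurable (N \<Otimes>\<^sub>M lborel)"
proof (rule borel_measurable_LIMSEQ_metric)
  let ?g = "\<lambda>(n::nat) (r::real). real_of_int \<lfloor>r * Suc n\<rfloor> / Suc n"
  fix n :: nat
  have "(\<lambda>x. Y (real_of_int i / Suc n) (fst x)) \<in> borel_measurable (N \<Otimes>\<^sub>M lborel)" for i :: int
    by (rule measurable_compose[OF measurable_fst m])
  moreover have "(\<lambda>x. \<lfloor>snd x * Suc n\<rfloor>) \<in> measurable (N \<Otimes>\<^sub>M lborel) (count_space UNIV)"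
    by measurable
  ultimately have "(\<lambda>x. Y (real_of_int \<lfloor>snd x * Suc n\<rfloor> / Suc n) (fst x)) \<in> borel_measurable (N \<Otimes>\<^sub>M lborel)"
    by (rule measurable_compose_countable)
  then show "(\<lambda>(\<omega>, r). Y (?g n r) \<omega>) \<in> borel_measurable (N \<Otimes>\<^sub>M lborel)"
    by (simp add: split_beta')
next
  let ?g = "\<lambda>(n::nat) (r::real). real_of_int \<lfloor>r * Suc n\<rfloor> / Suc n"
  fix x assume x: "x \<in> space (N \<Otimes>\<^sub>M (lborel :: real measure))"
  have "(\<lambda>n. ?g n (snd x)) \<longlonglongrightarrow> snd x"
  proof (rule LIMSEQ_I)
    fix e :: real assume "0 < e"
    then obtain N where N: "inverse (Suc N) < e" using reals_Archimedean by blast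
    show "\<exists>no. \<forall>n\<ge>no. norm (?g n (snd x) - snd x) < e"
    proof (intro exI allI impI)
      fix n assume n: "N \<le> n"
      have "?g n (snd x) - snd x = (real_of_int \<lfloor>snd x * Suc n\<rfloor> - snd x * Suc n) / Suc n"
        by (simp add: diff_divide_distrib)
      moreover have "\<bar>real_of_int \<lfloor>snd x * Suc n\<rfloor> - snd x * Suc n\<bar> \<le> 1" by linarith
      ultimately have "norm (?g n (snd x) - snd x) \<le> inverse (Suc n)"
        by (simp only: real_norm_def abs_divide inverse_eq_divide abs_of_nat) (intro divide_right_mono, auto)
      also have "\<dots> \<le> inverse (Suc N)" using n by (simp add: field_simps)
      finally show "norm (?g n (snd x) - snd x) < e" using N by simp
    qed
  qed
  then show "(\<lambda>n. (\<lambda>(\<omega>, r). Y (?g n r) \<omega>) x) \<longlonglongrightarrow> (\<lambda>(\<omega>, r). Y r \<omega>) x"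
    using continuous_on_tendsto_compose[OF c[of "fst x"], of "\<lambda>n. ?g n (snd x)" "snd x" sequentially] x
    by (simp add: split_beta' space_pair_measure mem_Times_iff)
qed

section \<open>Derivatives along lines and Taylor's formula\<close>

lemma frechet_derivative_partial:
  fixes \<phi> :: "real^'n::finite \<Rightarrow> real"
  assumes "\<phi> differentiable (at x)"
  shows "frechet_derivative \<phi> (at x) h = (\<Sum>i\<in>UNIV. h $ i * partial_deriv i \<phi> x)"
proof -
  have lin: "linear (frechet_derivative \<phi> (at x))" by (rule linear_frechet_derivative[OF assms])
  have "frechet_derivative \<phi> (at x) h = frechet_derivative \<phi> (at x) (\<Sum>i\<in>UNIV. h $ i *\<^sub>R axis i 1)"
    by (simp add: basis_expansion flip: scalar_mult_eq_scaleR)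
  then show ?thesis
    by (simp add: linear_sum[OF lin] linear_cmul[OF lin] partial_deriv_def)
qed

lemma has_real_derivative_along_line:
  fixes \<phi> :: "real^'n::finite \<Rightarrow> real"
  assumes "\<phi> differentiable (at (x + s *\<^sub>R h))"
  shows "((\<lambda>s. \<phi> (x + s *\<^sub>R h)) has_real_derivative (\<Sum>i\<in>UNIV. h $ i * partial_deriv i \<phi> (x + s *\<^sub>R h))) (at s)"
proof -
  have "((\<lambda>s. x + s *\<^sub>R h) has_derivative (\<lambda>r. r *\<^sub>R h)) (at s)"
    by (auto intro!: derivative_eq_intros)
  from has_derivative_compose[OF this assms[unfolded frechet_derivative_works]]
  have "((\<lambda>s. \<phi> (x + s *\<^sub>R h)) has_derivative (\<lambda>r. frechet_derivative \<phi> (at (x + s *\<^sub>R h)) (r *\<^sub>R h))) (at s)" .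
  then show ?thesis
    unfolding has_field_derivative_def
    by (rule has_derivative_eq_rhs) (simp add: frechet_derivative_partial[OF assms] fun_eq_iff sum_distrib_left mult_ac)
qed

text \<open>Maclaurin's formula on the segment from \<open>x\<close> to \<open>x + h\<close>. The
  Lagrange form of the remainder is chosen because subtracting the quadratic term at
  \<open>x\<close> then leaves a difference of two Hessians.\<close>

lemma taylor_second_order:
  fixes \<phi> :: "real^'n::finite \<Rightarrow> real"
  assumes d1: "\<And>x. \<phi> differentiable (at x)" and d2: "\<And>i x. partial_deriv i \<phi> differentiable (at x)"
  obtains \<theta> where "0 < \<theta>" "\<theta> < 1"
    "\<phi> (x + h) = \<phi> x + grad \<phi> x \<bullet> h + (1 / 2) * (h \<bullet> (Hess \<phi> (x + \<theta> *\<^sub>R h) *v h))"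
proof -
  define D where "D m s = (if m = 0 then \<phi> (x + s *\<^sub>R h)
    else if m = 1 then (\<Sum>i\<in>UNIV. h $ i * partial_deriv i \<phi> (x + s *\<^sub>R h))
    else (\<Sum>i\<in>UNIV. h $ i * (\<Sum>j\<in>UNIV. h $ j * partial_deriv j (partial_deriv i \<phi>) (x + s *\<^sub>R h))))" for m :: nat and s
  have "\<exists>t>0. t < 1 \<and> \<phi> (x + 1 *\<^sub>R h) = (\<Sum>m<2. D m 0 / fact m * 1 ^ m) + D 2 t / fact 2 * 1 ^ 2"
  proof (rule Maclaurin)
    show "\<forall>m t. m < 2 \<and> 0 \<le> t \<and> t \<le> 1 \<longrightarrow> (D m has_real_derivative D (Suc m) t) (at t)"
    proof (intro allI impI)
      fix m :: nat and t :: real assume "m < 2 \<and> 0 \<le> t \<and> t \<le> 1"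
      then consider "m = 0" | "m = 1" by linarith
      then show "(D m has_real_derivative D (Suc m) t) (at t)"
      proof cases
        case 1
        then show ?thesis using has_real_derivative_along_line[of \<phi> x t h, OF d1] by (simp add: D_def[abs_def])
      next
        case 2
        then show ?thesis
          using has_real_derivative_along_line[of "partial_deriv i \<phi>" x t h for i, OF d2]
          by (auto simp: D_def[abs_def] intro!: DERIV_sum DERIV_cmult)
      qed
    qed
  qed (auto simp: D_def)
  then obtain t where t: "0 < t" "t < 1" "\<phi> (x + h) = D 0 0 + D 1 0 + D 2 t / 2"
    by (auto simp: lessThan_Suc numeral_2_eq_2)
  have "D 1 0 = grad \<phi> x \<bullet> h"
    by (simp add: D_def grad_def inner_vec_def mult.commute)
  moreover have "D 2 t = h \<bullet> (Hess \<phi> (x + t *\<^sub>R h) *v h)"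
  proof -
    have "D 2 t = (\<Sum>i\<in>UNIV. \<Sum>j\<in>UNIV. h $ i * (h $ j * partial_deriv j (partial_deriv i \<phi>) (x + t *\<^sub>R h)))"
      by (simp add: D_def sum_distrib_left)
    \<comment> \<open>Exchanging the sums matches the index order in \<open>Hess\<close>, without an
      appeal to the symmetry of second derivatives.\<close>
    also have "\<dots> = (\<Sum>j\<in>UNIV. \<Sum>i\<in>UNIV. h $ i * (h $ j * partial_deriv j (partial_deriv i \<phi>) (x + t *\<^sub>R h)))"
      by (rule sum.swap)
    also have "\<dots> = h \<bullet> (Hess \<phi> (x + t *\<^sub>R h) *v h)"
      by (simp add: Hess_def inner_vec_def matrix_vector_mult_def sum_distrib_left mult_ac)
    finally show ?thesis .
  qed
  ultimately show ?thesis using t by (intro that[of t]) (auto simp: D_def)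
qed

section \<open>Second-order error estimates\<close>

lemma norm_matrix_vector_mult_le:
  fixes A :: "real^'m::finite^'n::finite"
  shows "norm (A *v x) \<le> norm A * norm x"
proof -
  have "(norm (A *v x))\<^sup>2 = (\<Sum>i\<in>UNIV. (A $ i \<bullet> x)\<^sup>2)"
    by (simp add: norm_vec_def L2_set_def sum_nonneg matrix_vector_mult_def inner_vec_def)
  also have "\<dots> \<le> (\<Sum>i\<in>UNIV. (norm (A $ i))\<^sup>2 * (norm x)\<^sup>2)"
  proof (rule sum_mono)
    fix i
    have "\<bar>A $ i \<bullet> x\<bar> \<le> \<bar>norm (A $ i) * norm x\<bar>" using Cauchy_Schwarz_ineq2[of "A $ i" x] by simp
    then show "(A $ i \<bullet> x)\<^sup>2 \<le> (norm (A $ i))\<^sup>2 * (norm x)\<^sup>2"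
      by (simp only: abs_le_square_iff power_mult_distrib)
  qed
  also have "\<dots> = (norm A)\<^sup>2 * (norm x)\<^sup>2"
    by (simp add: norm_vec_def[of A] L2_set_def sum_nonneg sum_distrib_right)
  also have "\<dots> = (norm A * norm x)\<^sup>2" by (simp add: power_mult_distrib)
  finally show ?thesis by (rule power2_le_imp_le) simp
qed

lemma abs_inner_matrix_vector_le:
  fixes A :: "real^'m::finite^'n::finite"
  shows "\<bar>x \<bullet> (A *v y)\<bar> \<le> norm A * (norm x * norm y)"
proof -
  have "\<bar>x \<bullet> (A *v y)\<bar> \<le> norm x * norm (A *v y)" by (rule Cauchy_Schwarz_ineq2)
  also have "\<dots> \<le> norm x * (norm A * norm y)"
    by (intro mult_left_mono norm_matrix_vector_mult_le) simp
  finally show ?thesis by (simp add: mult_ac)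
qed

text \<open>The factor 2 undoes the one half in \<open>diffusion_matrix\<close>. The right-hand side
  is the mean, per unit of time, of the quadratic form of \<open>H\<close> in the noise
  \<open>\<sigma> x *v dW\<close>, since only equal noise coordinates are correlated.\<close>

lemma trace_diffusion:
  fixes H :: "real^'n::finite^'n" and \<sigma> :: "real^'n \<Rightarrow> real^'m::finite^'n"
  shows "2 * trace (diffusion_matrix \<sigma> x ** H) = (\<Sum>p\<in>UNIV. \<Sum>r\<in>UNIV. \<sigma> x $ r $ p * (H ** \<sigma> x) $ r $ p)"
proof -
  have "2 * trace (diffusion_matrix \<sigma> x ** H) = (\<Sum>i\<in>UNIV. \<Sum>r\<in>UNIV. \<Sum>p\<in>UNIV. \<sigma> x $ i $ p * \<sigma> x $ r $ p * H $ r $ i)"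
    by (simp add: trace_def diffusion_matrix_def matrix_matrix_mult_def transpose_def sum_distrib_left sum_distrib_right mult_ac)
  also have "\<dots> = (\<Sum>r\<in>UNIV. \<Sum>i\<in>UNIV. \<Sum>p\<in>UNIV. \<sigma> x $ i $ p * \<sigma> x $ r $ p * H $ r $ i)"
    by (rule sum.swap)
  also have "\<dots> = (\<Sum>r\<in>UNIV. \<Sum>p\<in>UNIV. \<Sum>i\<in>UNIV. \<sigma> x $ i $ p * \<sigma> x $ r $ p * H $ r $ i)"
    by (intro sum.cong refl sum.swap)
  also have "\<dots> = (\<Sum>p\<in>UNIV. \<Sum>r\<in>UNIV. \<Sum>i\<in>UNIV. \<sigma> x $ i $ p * \<sigma> x $ r $ p * H $ r $ i)"
    by (rule sum.swap)
  also have "\<dots> = (\<Sum>p\<in>UNIV. \<Sum>r\<in>UNIV. \<sigma> x $ r $ p * (H ** \<sigma> x) $ r $ p)"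
    by (simp add: matrix_matrix_mult_def sum_distrib_left mult_ac)
  finally show ?thesis .
qed

text \<open>The parameter \<open>a\<close> is fixed first to make \<open>C * a\<close> small. The
  factor \<open>K a\<close> may be huge, but it multiplies a quantity tending to 0.\<close>

lemma tendsto_zero_if_small:
  fixes g :: "real \<Rightarrow> real"
  assumes le: "\<And>a. 0 < a \<Longrightarrow> \<forall>\<^sub>F h in G. \<bar>g h\<bar> \<le> C * a + K a * s h" and s: "(s \<longlongrightarrow> 0) G" and C: "0 \<le> C"
  shows "(g \<longlongrightarrow> 0) G"
proof (rule tendstoI)
  fix e :: real assume e: "0 < e"
  \<comment> \<open>The summand 1 covers the case \<open>C = 0\<close>.\<close>
  define a where "a = e / (2 * (C + 1))"
  have a: "0 < a" using e C by (simp add: a_def)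
  have Ca: "C * a \<le> e / 2" using e C by (simp add: a_def field_simps)
  have "((\<lambda>h. K a * s h) \<longlongrightarrow> K a * 0) G" by (intro tendsto_intros s)
  then have "\<forall>\<^sub>F h in G. dist (K a * s h) 0 < e / 2" using e by (intro tendstoD) auto
  then show "\<forall>\<^sub>F h in G. dist (g h) 0 < e"
    using le[OF a] by eventually_elim (use Ca in \<open>auto simp: abs_if split: if_splits\<close>)
qed

definition taylor2_error :: "(real^'n::finite \<Rightarrow> real) \<Rightarrow> real^'n \<Rightarrow> real^'n \<Rightarrow> real" where
  "taylor2_error \<phi> x v = \<phi> (x + v) - \<phi> x - grad \<phi> x \<bullet> v - (1 / 2) * (v \<bullet> (Hess \<phi> x *v v))"

text \<open>Relative to \<open>(norm v)\<^sup>2\<close> the error is at most half the distance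
  between the Hessians at \<open>x\<close> and at a point of the segment; boundedness and continuity
  of the Hessian give the two claims. As a quotient by 0 is 0, the limit holds along
  \<open>nhds 0\<close>, so increments that vanish are allowed in later compositions.\<close>

lemma
  fixes \<phi> :: "real^'n::finite \<Rightarrow> real"
  assumes d1: "\<And>x. \<phi> differentiable (at x)" and d2: "\<And>i x. partial_deriv i \<phi> differentiable (at x)"
  shows taylor2_error_bounded: "(\<And>x. norm (Hess \<phi> x) \<le> K) \<Longrightarrow> \<bar>taylor2_error \<phi> x v\<bar> / (norm v)\<^sup>2 \<le> K"
    and taylor2_error_tendsto: "continuous_on UNIV (Hess \<phi>) \<Longrightarrow>
      ((\<lambda>v. \<bar>taylor2_error \<phi> x v\<bar> / (norm v)\<^sup>2) \<longlongrightarrow> 0) (nhds 0)"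
proof -
  have *: "\<exists>\<theta>. 0 < \<theta> \<and> \<theta> < 1 \<and> \<bar>taylor2_error \<phi> x v\<bar> / (norm v)\<^sup>2 \<le> (1 / 2) * norm (Hess \<phi> (x + \<theta> *\<^sub>R v) - Hess \<phi> x)" for v
  proof -
    obtain \<theta> where \<theta>: "0 < \<theta>" "\<theta> < 1"
      "\<phi> (x + v) = \<phi> x + grad \<phi> x \<bullet> v + (1 / 2) * (v \<bullet> (Hess \<phi> (x + \<theta> *\<^sub>R v) *v v))"
      using taylor_second_order[OF d1 d2] by metis
    then have "taylor2_error \<phi> x v = (1 / 2) * (v \<bullet> ((Hess \<phi> (x + \<theta> *\<^sub>R v) - Hess \<phi> x) *v v))"
      by (simp add: taylor2_error_def matrix_vector_mult_diff_rdistrib inner_diff_right)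
    then have "\<bar>taylor2_error \<phi> x v\<bar> \<le> (1 / 2) * norm (Hess \<phi> (x + \<theta> *\<^sub>R v) - Hess \<phi> x) * (norm v)\<^sup>2"
      using abs_inner_matrix_vector_le[of v "Hess \<phi> (x + \<theta> *\<^sub>R v) - Hess \<phi> x" v]
      by (simp add: abs_mult power2_eq_square)
    then have "\<bar>taylor2_error \<phi> x v\<bar> / (norm v)\<^sup>2 \<le> (1 / 2) * norm (Hess \<phi> (x + \<theta> *\<^sub>R v) - Hess \<phi> x)"
      by (cases "v = 0") (simp_all add: field_simps)
    then show ?thesis using \<theta> by blast
  qed
  show "\<bar>taylor2_error \<phi> x v\<bar> / (norm v)\<^sup>2 \<le> K" if K: "\<And>x. norm (Hess \<phi> x) \<le> K"
  proof -
    obtain \<theta> where "\<bar>taylor2_error \<phi> x v\<bar> / (norm v)\<^sup>2 \<le> (1 / 2) * norm (Hess \<phi> (x + \<theta> *\<^sub>R v) - Hess \<phi> x)"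
      using * by blast
    also have "\<dots> \<le> (1 / 2) * (K + K)"
      using norm_triangle_ineq4[of "Hess \<phi> (x + \<theta> *\<^sub>R v)" "Hess \<phi> x"] K[of x] K[of "x + \<theta> *\<^sub>R v"] by simp
    finally show ?thesis by simp
  qed
  show "((\<lambda>v. \<bar>taylor2_error \<phi> x v\<bar> / (norm v)\<^sup>2) \<longlongrightarrow> 0) (nhds 0)" if c: "continuous_on UNIV (Hess \<phi>)"
  proof (rule tendstoI)
    fix e :: real assume e: "0 < e"
    obtain d where d: "0 < d" "\<And>y. dist y x < d \<Longrightarrow> dist (Hess \<phi> y) (Hess \<phi> x) < e"
      using c e unfolding continuous_on_iff by (metis UNIV_I)
    show "\<forall>\<^sub>F v in nhds 0. dist (\<bar>taylor2_error \<phi> x v\<bar> / (norm v)\<^sup>2) 0 < e"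
      unfolding eventually_nhds_metric
    proof (intro exI conjI allI impI)
      fix v :: "real^'n" assume v: "dist v 0 < d"
      obtain \<theta> where \<theta>: "0 < \<theta>" "\<theta> < 1" "\<bar>taylor2_error \<phi> x v\<bar> / (norm v)\<^sup>2 \<le> (1 / 2) * norm (Hess \<phi> (x + \<theta> *\<^sub>R v) - Hess \<phi> x)"
        using * by blast
      have "\<theta> * norm v \<le> 1 * norm v" using \<theta> by (intro mult_right_mono) auto
      then have "dist (x + \<theta> *\<^sub>R v) x < d" using v \<theta> by (simp add: dist_norm)
      have "0 \<le> \<bar>taylor2_error \<phi> x v\<bar> / (norm v)\<^sup>2" by simp
      with d(2)[OF \<open>dist (x + \<theta> *\<^sub>R v) x < d\<close>] \<theta>(3) show "dist (\<bar>taylor2_error \<phi> x v\<bar> / (norm v)\<^sup>2) 0 < e"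
        unfolding dist_norm real_norm_def by linarith
    qed (rule d)
  qed
qed

text \<open>The free parameter \<open>a\<close> comes from the arithmetic-geometric mean inequality.\<close>

lemma second_order_error_le:
  fixes H :: "real^'n::finite^'n"
  assumes H: "norm H \<le> K" and y: "norm y \<le> L * w" and v: "v = y + r" and \<delta>: "0 \<le> \<delta>" "\<delta> \<le> K"
    and e: "\<bar>e\<bar> \<le> \<delta> * (norm v)\<^sup>2" and pos: "0 < a" "0 < h" "0 \<le> w" "0 \<le> L"
  shows "\<bar>(1 / 2) * (v \<bullet> (H *v v)) - (1 / 2) * (y \<bullet> (H *v y)) + e\<bar>
    \<le> K * L * a * w\<^sup>2 + (K * L / a + 3 * K) * (norm r)\<^sup>2 + 2 * L\<^sup>2 * (\<delta>\<^sup>2 * h / a + a * w ^ 4 / h)"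
proof -
  have K0: "0 \<le> K" using \<delta> by simp
  let ?r = "norm r"
  have "v \<bullet> (H *v v) - y \<bullet> (H *v y) = y \<bullet> (H *v r) + r \<bullet> (H *v y) + r \<bullet> (H *v r)"
    by (simp add: v matrix_vector_right_distrib inner_add_left inner_add_right)
  then have "\<bar>v \<bullet> (H *v v) - y \<bullet> (H *v y)\<bar> \<le> norm H * (norm y * ?r) + norm H * (?r * norm y) + norm H * (?r * ?r)"
    using abs_inner_matrix_vector_le[of y H r] abs_inner_matrix_vector_le[of r H y] abs_inner_matrix_vector_le[of r H r] by linarith
  also have "\<dots> \<le> K * (L * w * ?r) + K * (?r * (L * w)) + K * (?r * ?r)"
    using H y K0 pos by (intro add_mono mult_mono) auto
  also have "\<dots> = 2 * (K * L * (w * ?r)) + K * ?r\<^sup>2"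
    by (simp add: power2_eq_square algebra_simps)
  finally have "\<bar>v \<bullet> (H *v v) - y \<bullet> (H *v y)\<bar> \<le> 2 * (K * L * (w * ?r)) + K * ?r\<^sup>2" .
  moreover have "0 \<le> K * ?r\<^sup>2" using K0 by simp
  ultimately have 1: "\<bar>(1 / 2) * (v \<bullet> (H *v v)) - (1 / 2) * (y \<bullet> (H *v y))\<bar> \<le> K * L * (w * ?r) + K * ?r\<^sup>2"
    by linarith
  have amgm: "x * z \<le> a * x\<^sup>2 + z\<^sup>2 / a" if "0 < a" for a x z :: real
  proof -
    have "0 \<le> (a * x - z)\<^sup>2 + (a * x)\<^sup>2 + z\<^sup>2" by simp
    then have "a * (x * z) \<le> a * (a * x\<^sup>2 + z\<^sup>2 / a)"
      using that by (simp add: power2_eq_square algebra_simps)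
    then show ?thesis using that by simp
  qed
  have 2: "K * L * (w * ?r) \<le> K * L * (a * w\<^sup>2 + ?r\<^sup>2 / a)"
    using amgm[OF pos(1)] K0 pos by (intro mult_left_mono) auto
  have "(norm v)\<^sup>2 \<le> 2 * (norm y)\<^sup>2 + 2 * ?r\<^sup>2"
  proof -
    have "(norm v)\<^sup>2 \<le> (norm y + ?r)\<^sup>2" unfolding v by (intro power_mono norm_triangle_ineq) simp
    also have "\<dots> \<le> 2 * (norm y)\<^sup>2 + 2 * ?r\<^sup>2"
      using zero_le_power2[of "norm y - ?r"] by (simp add: power2_eq_square algebra_simps)
    finally show ?thesis .
  qed
  also have "\<dots> \<le> 2 * (L * w)\<^sup>2 + 2 * ?r\<^sup>2"
    using y by (intro add_mono mult_left_mono power_mono) auto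
  finally have "\<delta> * (norm v)\<^sup>2 \<le> \<delta> * (2 * (L * w)\<^sup>2 + 2 * ?r\<^sup>2)" using \<delta> by (intro mult_left_mono) auto
  also have "\<dots> = 2 * L\<^sup>2 * (w\<^sup>2 * \<delta>) + 2 * \<delta> * ?r\<^sup>2" by (simp add: power_mult_distrib algebra_simps)
  \<comment> \<open>The weight \<open>a / h\<close> balances the orders: for a Brownian increment
    \<open>w ^ 4\<close> has mean of order \<open>h\<^sup>2\<close>, so both
    \<open>a * w ^ 4 / h\<close> and \<open>\<delta>\<^sup>2 * h / a\<close> come with a factor
    \<open>h\<close>.\<close>
  also have "\<dots> \<le> 2 * L\<^sup>2 * (\<delta>\<^sup>2 * h / a + a * w ^ 4 / h) + 2 * K * ?r\<^sup>2"
    using amgm[of "a / h" "w\<^sup>2" \<delta>] \<delta> pos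
    by (intro add_mono mult_left_mono mult_right_mono) (auto simp: field_simps)
  finally have 3: "\<bar>e\<bar> \<le> 2 * L\<^sup>2 * (\<delta>\<^sup>2 * h / a + a * w ^ 4 / h) + 2 * K * ?r\<^sup>2" using e by linarith
  have "\<bar>(1 / 2) * (v \<bullet> (H *v v)) - (1 / 2) * (y \<bullet> (H *v y)) + e\<bar>
    \<le> K * L * (a * w\<^sup>2 + ?r\<^sup>2 / a) + K * ?r\<^sup>2 + (2 * L\<^sup>2 * (\<delta>\<^sup>2 * h / a + a * w ^ 4 / h) + 2 * K * ?r\<^sup>2)"
    using 1 2 3 by linarith
  also have "\<dots> = K * L * a * w\<^sup>2 + (K * L / a + 3 * K) * ?r\<^sup>2 + 2 * L\<^sup>2 * (\<delta>\<^sup>2 * h / a + a * w ^ 4 / h)"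
    by (simp add: algebra_simps)
  finally show ?thesis .
qed

section \<open>Increments of the diffusion\<close>

context filtered_prob_space
begin

lemma expectation_dW_squared:
  fixes W :: "real \<Rightarrow> 'a \<Rightarrow> real^'m::finite" and s t :: real
  assumes bm: "brownian_motion W" and s: "0 \<le> s" "s \<le> t"
  shows "integrable M (\<lambda>\<omega>. (norm (W t \<omega> - W s \<omega>))\<^sup>2)"
    and "(\<integral>\<omega>. (norm (W t \<omega> - W s \<omega>))\<^sup>2 \<partial>M) = real CARD('m) * (t - s)"
proof -
  have eq: "(norm x)\<^sup>2 = (\<Sum>p\<in>UNIV. 1 * (x $ p * x $ p))" for x :: "real^'m"
    by (simp add: norm_vec_def L2_set_def sum_nonneg power2_eq_square)
  have c: "(\<lambda>_. 1 :: real) \<in> borel_measurable (F s)" "integrable M (\<lambda>_. 1 :: real)"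
    by simp_all
  show "integrable M (\<lambda>\<omega>. (norm (W t \<omega> - W s \<omega>))\<^sup>2)"
    unfolding eq by (intro Bochner_Integration.integrable_sum integrable_mult_dW2[OF bm s c])
  have "(\<integral>\<omega>. (norm (W t \<omega> - W s \<omega>))\<^sup>2 \<partial>M) = (\<Sum>p\<in>(UNIV :: 'm set). 1 * (t - s))"
    unfolding eq
    by (subst Bochner_Integration.integral_sum[OF integrable_mult_dW2[OF bm s c]])
      (simp only: expectation_mult_dW2[OF bm s c] if_True refl lebesgue_integral_const prob_space scaleR_one)
  then show "(\<integral>\<omega>. (norm (W t \<omega> - W s \<omega>))\<^sup>2 \<partial>M) = real CARD('m) * (t - s)" by simp
qed

end

text \<open>The stochastic estimates are carried out for an arbitrary bounded continuous drift and
  diffusion coefficient and a given solution. The form \<open>drift_hat f \<sigma>\<close> of the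
  drift is put in at the very end.\<close>

locale bounded_sde = filtered_prob_space M F for M :: "'a measure" and F +
  fixes W :: "real \<Rightarrow> 'a \<Rightarrow> real^'m::finite" and \<mu> :: "real^'n::finite \<Rightarrow> real^'n"
    and \<sigma> :: "real^'n \<Rightarrow> real^'m^'n" and \<xi> :: "'a \<Rightarrow> real^'n" and X :: "real \<Rightarrow> 'a \<Rightarrow> real^'n"
    and K\<mu> K\<sigma> :: real
  assumes bm: "brownian_motion W" and sde: "solves_SDE \<mu> \<sigma> W \<xi> X"
    and \<mu>: "continuous_on UNIV \<mu>" "\<And>x. norm (\<mu> x) \<le> K\<mu>"
    and \<sigma>: "continuous_on UNIV \<sigma>" "\<And>x. norm (\<sigma> x) \<le> K\<sigma>"
begin

lemma measurable_X: "0 \<le> t \<Longrightarrow> X t \<in> borel_measurable (F t)"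
  using sde by (auto simp: solves_SDE_def adapted_def)

lemma continuous_X: "\<omega> \<in> space M \<Longrightarrow> S \<subseteq> {0..} \<Longrightarrow> continuous_on S (\<lambda>t. X t \<omega>)"
  using sde continuous_on_subset by (fastforce simp: solves_SDE_def)

lemma measurable_fun_X:
  fixes g :: "real^'n \<Rightarrow> 'b::topological_space"
  shows "continuous_on UNIV g \<Longrightarrow> 0 \<le> t \<Longrightarrow> (\<lambda>\<omega>. g (X t \<omega>)) \<in> borel_measurable (F t)"
  using measurable_compose[OF measurable_X borel_measurable_continuous_onI] by blast

lemma measurable_fun_X_M:
  fixes g :: "real^'n \<Rightarrow> 'b::topological_space"
  shows "continuous_on UNIV g \<Longrightarrow> 0 \<le> t \<Longrightarrow> (\<lambda>\<omega>. g (X t \<omega>)) \<in> borel_measurable M"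
  using measurable_fun_X measurable_F_M by blast

lemma measurable_X_M: "0 \<le> s \<Longrightarrow> X s \<in> borel_measurable M"
  using measurable_X measurable_F_M by blast

lemma K_nonneg: "0 \<le> K\<mu>" "0 \<le> K\<sigma>"
  using order_trans[OF norm_ge_zero \<mu>(2)] order_trans[OF norm_ge_zero \<sigma>(2)] by auto

text \<open>Values of \<open>X\<close> at negative times are arbitrary; composing with
  \<open>max 0\<close> yields paths that are continuous on the whole line.\<close>

lemma measurable_X_joint: "(\<lambda>(\<omega>, r). X (max 0 r) \<omega>) \<in> borel_measurable (M \<Otimes>\<^sub>M lborel)"
proof (rule measurable_jointly_continuous_left)
  show "X (max 0 r) \<in> borel_measurable M" for r
    by (rule measurable_F_M[OF _ measurable_X]) auto
  show "continuous_on UNIV (\<lambda>r. X (max 0 r) \<omega>)" if "\<omega> \<in> space M" for \<omega>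
    by (rule continuous_on_compose2[OF continuous_X[OF that order.refl]]) (auto intro!: continuous_intros)
qed

lemma measurable_\<sigma>_X_joint:
  "(\<lambda>(\<omega>, r). indicator {0..} r *\<^sub>R \<sigma> (X r \<omega>)) \<in> borel_measurable (M \<Otimes>\<^sub>M lborel)"
proof -
  have [measurable]: "(\<lambda>x. \<sigma> (X (max 0 (snd x)) (fst x))) \<in> borel_measurable (M \<Otimes>\<^sub>M lborel)"
    using measurable_compose[OF measurable_X_joint borel_measurable_continuous_onI[OF \<sigma>(1)]]
    by (simp add: split_beta')
  have "(\<lambda>(\<omega>, r). indicator {0..} r *\<^sub>R \<sigma> (X r \<omega>)) = (\<lambda>x. indicator {0..} (snd x) *\<^sub>R \<sigma> (X (max 0 (snd x)) (fst x)))"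
    by (auto simp: fun_eq_iff indicator_def)
  also have "\<dots> \<in> borel_measurable (M \<Otimes>\<^sub>M lborel)"
    by measurable
  finally show ?thesis .
qed

lemma continuous_fun_X:
  fixes g :: "real^'n \<Rightarrow> 'b::topological_space"
  assumes "continuous_on UNIV g" "\<omega> \<in> space M" "S \<subseteq> {0..}"
  shows "continuous_on S (\<lambda>r. g (X r \<omega>))"
  by (rule continuous_on_compose2[OF assms(1) continuous_X[OF assms(2,3)]]) auto

lemma integral_eq_LBINT_X:
  fixes g :: "real^'n \<Rightarrow> 'b::euclidean_space"
  assumes "continuous_on UNIV g" "\<omega> \<in> space M" "0 \<le> s"
  shows "(LBINT r:{s..t}. g (X r \<omega>)) = integral {s..t} (\<lambda>r. g (X r \<omega>))"
  using continuous_fun_X[OF assms(1,2), of "{s..t}"] assms(3)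
  by (intro set_borel_integral_eq_integral(2) borel_integrable_atLeastAtMost') auto

lemma measurable_integral_X:
  fixes g :: "real^'n \<Rightarrow> 'b::euclidean_space"
  assumes g: "continuous_on UNIV g" and s: "0 \<le> s" "s \<le> t"
  shows "(\<lambda>\<omega>. integral {s..t} (\<lambda>r. g (X r \<omega>))) \<in> borel_measurable (F t)"
proof -
  have t: "0 \<le> t" using s by simp
  \<comment> \<open>Clamping the time to \<open>[0, t]\<close> makes every time slice measurable for
    \<open>F t\<close>, so the integral is adapted and not merely measurable.\<close>
  have "(\<lambda>(\<omega>, r). X (max 0 (min r t)) \<omega>) \<in> borel_measurable (F t \<Otimes>\<^sub>M lborel)"
  proof (rule measurable_jointly_continuous_left)
    show "X (max 0 (min r t)) \<in> borel_measurable (F t)" for r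
      by (rule measurable_F_mono[OF _ _ measurable_X]) (use t in auto)
    show "continuous_on UNIV (\<lambda>r. X (max 0 (min r t)) \<omega>)" if "\<omega> \<in> space (F t)" for \<omega>
      using that space_F[OF t]
      by (intro continuous_on_compose2[OF continuous_X[OF _ order.refl]]) (auto intro!: continuous_intros)
  qed
  from measurable_compose[OF this borel_measurable_continuous_onI[OF g]]
  have [measurable]: "(\<lambda>x. g (X (max 0 (min (snd x) t)) (fst x))) \<in> borel_measurable (F t \<Otimes>\<^sub>M lborel)"
    by (simp add: split_beta')
  have "(\<lambda>\<omega>. \<integral>r. indicator {s..t} r *\<^sub>R g (X (max 0 (min r t)) \<omega>) \<partial>lborel) \<in> borel_measurable (F t)"
    by (rule lborel.borel_measurable_lebesgue_integral) (simp add: split_beta')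
  moreover have "(\<integral>r. indicator {s..t} r *\<^sub>R g (X (max 0 (min r t)) \<omega>) \<partial>lborel) = integral {s..t} (\<lambda>r. g (X r \<omega>))"
    if "\<omega> \<in> space (F t)" for \<omega>
  proof -
    have "(\<integral>r. indicator {s..t} r *\<^sub>R g (X (max 0 (min r t)) \<omega>) \<partial>lborel) = (LBINT r:{s..t}. g (X r \<omega>))"
      unfolding set_lebesgue_integral_def using s
      by (intro Bochner_Integration.integral_cong refl) (auto simp: indicator_def)
    then show ?thesis using integral_eq_LBINT_X[OF g _ s(1)] that space_F[OF t] by simp
  qed
  ultimately show ?thesis by (simp cong: measurable_cong)
qed

lemma norm_integral_X_le:
  fixes g :: "real^'n \<Rightarrow> 'b::euclidean_space"
  assumes g: "continuous_on UNIV g" "\<And>x. norm (g x) \<le> K" and s: "0 \<le> s" "s \<le> t" and \<omega>: "\<omega> \<in> space M"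
  shows "norm (integral {s..t} (\<lambda>r. g (X r \<omega>))) \<le> K * (t - s)"
  using s g(2) by (intro integral_bound continuous_fun_X g \<omega>) auto

text \<open>Two instances of the equation are subtracted and the initial value cancels. The
  integrals \<open>J\<close> and \<open>J'\<close> come from separate choices, each with its own
  approximating sequence and null set.\<close>

lemma sde_increment:
  assumes t: "0 \<le> t" "t \<le> t'"
  obtains J J' where "has_Ito_integral W (\<lambda>s \<omega>. \<sigma> (X s \<omega>)) t J" "has_Ito_integral W (\<lambda>s \<omega>. \<sigma> (X s \<omega>)) t' J'"
    "AE \<omega> in M. X t' \<omega> - X t \<omega> = integral {t..t'} (\<lambda>r. \<mu> (X r \<omega>)) + (J' \<omega> - J \<omega>)"
proof -
  have t': "0 \<le> t'" using t by simp
  obtain J where J: "has_Ito_integral W (\<lambda>s \<omega>. \<sigma> (X s \<omega>)) t J"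
    "AE \<omega> in M. X t \<omega> = \<xi> \<omega> + (LBINT s:{0..t}. \<mu> (X s \<omega>)) + J \<omega>"
    using sde t by (auto simp: solves_SDE_def)
  obtain J' where J': "has_Ito_integral W (\<lambda>s \<omega>. \<sigma> (X s \<omega>)) t' J'"
    "AE \<omega> in M. X t' \<omega> = \<xi> \<omega> + (LBINT s:{0..t'}. \<mu> (X s \<omega>)) + J' \<omega>"
    using sde t' by (auto simp: solves_SDE_def)
  have "AE \<omega> in M. X t' \<omega> - X t \<omega> = integral {t..t'} (\<lambda>r. \<mu> (X r \<omega>)) + (J' \<omega> - J \<omega>)"
    using J(2) J'(2) AE_space
  proof eventually_elim
    fix \<omega> assume 1: "X t \<omega> = \<xi> \<omega> + (LBINT s:{0..t}. \<mu> (X s \<omega>)) + J \<omega>"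
      "X t' \<omega> = \<xi> \<omega> + (LBINT s:{0..t'}. \<mu> (X s \<omega>)) + J' \<omega>" and \<omega>: "\<omega> \<in> space M"
    have "integral {0..t} (\<lambda>r. \<mu> (X r \<omega>)) + integral {t..t'} (\<lambda>r. \<mu> (X r \<omega>)) = integral {0..t'} (\<lambda>r. \<mu> (X r \<omega>))"
      using t by (intro Henstock_Kurzweil_Integration.integral_combine integrable_continuous_real continuous_fun_X \<mu> \<omega>) auto
    then show "X t' \<omega> - X t \<omega> = integral {t..t'} (\<lambda>r. \<mu> (X r \<omega>)) + (J' \<omega> - J \<omega>)"
      by (simp add: 1 integral_eq_LBINT_X[OF \<mu>(1) \<omega> order.refl] algebra_simps)
  qed
  then show ?thesis using that J J' by blast
qed

context
  fixes t :: real
  assumes t: "0 \<le> t"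
begin

definition frozen_noise :: "real \<Rightarrow> 'a \<Rightarrow> real^'n" where
  "frozen_noise h \<omega> = \<sigma> (X t \<omega>) *v (W (t + h) \<omega> - W t \<omega>)"

text \<open>The drift over \<open>[t, t + h]\<close> is deliberately left in: it is of order
  \<open>h\<close>, so its square is negligible against \<open>h\<close>.\<close>

definition euler_error :: "real \<Rightarrow> 'a \<Rightarrow> real^'n" where
  "euler_error h \<omega> = X (t + h) \<omega> - X t \<omega> - frozen_noise h \<omega>"

lemma measurable_frozen_noise: "0 \<le> h \<Longrightarrow> frozen_noise h \<in> borel_measurable M"
  unfolding frozen_noise_def[abs_def] using t
  by (intro borel_measurable_matrix_vector_mult borel_measurable_diff measurable_fun_X_M \<sigma> measurable_W_M[OF bm]) auto

lemma measurable_euler_error: "0 \<le> h \<Longrightarrow> euler_error h \<in> borel_measurable M"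
  unfolding euler_error_def[abs_def] using t
  by (intro borel_measurable_diff measurable_X_M measurable_frozen_noise) auto

lemma bounded_\<sigma>_X: "bounded ((\<lambda>\<omega>. \<sigma> (X t \<omega>)) ` space M)"
  using \<sigma>(2) by (auto simp: bounded_iff)

text \<open>The drift contributes at most \<open>(K\<mu> * h)\<^sup>2\<close>. The noise contributes
  at most 9 times the time integral of the mean square oscillation of \<open>\<sigma> (X r)\<close>
  about \<open>\<sigma> (X t)\<close>, and this oscillation tends to 0 as \<open>r\<close> tends to
  \<open>t\<close>, by path continuity and the boundedness of \<open>\<sigma>\<close>.\<close>

lemma euler_error_small:
  assumes \<epsilon>: "0 < \<epsilon>"
  shows "\<forall>\<^sub>F h in at_right 0. (\<integral>\<^sup>+\<omega>. ennreal ((norm (euler_error h \<omega>))\<^sup>2) \<partial>M) \<le> ennreal (\<epsilon> * h)"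
proof -
  interpret P: pair_sigma_finite M "lborel :: real measure" ..
  \<comment> \<open>With the factor 3 of the three-term estimate and the factor 9 of
    \<open>ito_increment_bound\<close>, the noise uses up
    \<open>27 * \<epsilon>' = \<epsilon> / 2\<close>, half of what is allowed.\<close>
  define \<epsilon>' where "\<epsilon>' = \<epsilon> / 54"
  have "0 \<le> \<epsilon>'" using \<epsilon> by (simp add: \<epsilon>'_def)
  let ?e = "\<lambda>r. \<integral>\<omega>. (norm (\<sigma> (X r \<omega>) - \<sigma> (X t \<omega>)))\<^sup>2 \<partial>M"
  have b: "(norm (\<sigma> x - \<sigma> y))\<^sup>2 \<le> (2 * K\<sigma>)\<^sup>2" for x y
    using norm_triangle_ineq4[of "\<sigma> x" "\<sigma> y"] \<sigma>(2)[of x] \<sigma>(2)[of y] by (intro power_mono) auto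
  have m: "(\<lambda>\<omega>. (norm (\<sigma> (X r \<omega>) - \<sigma> (X t \<omega>)))\<^sup>2) \<in> borel_measurable M" if "0 \<le> r" for r
    using measurable_fun_X_M[OF \<sigma>(1) that] measurable_fun_X_M[OF \<sigma>(1) t] by measurable
  have "(?e \<longlongrightarrow> (\<integral>\<omega>. 0 \<partial>M)) (at t within {t..})"
  proof (rule bounded_convergence_within[where K="(2 * K\<sigma>)\<^sup>2"])
    fix \<omega> assume \<omega>: "\<omega> \<in> space M"
    have "((\<lambda>r. (norm (\<sigma> (X r \<omega>) - \<sigma> (X t \<omega>)))\<^sup>2) \<longlongrightarrow> (norm (\<sigma> (X t \<omega>) - \<sigma> (X t \<omega>)))\<^sup>2) (at t within {t..})"
      using continuous_fun_X[OF \<sigma>(1) \<omega>, of "{t..}"] t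
      by (intro tendsto_intros) (auto simp: continuous_on_def)
    then show "((\<lambda>r. (norm (\<sigma> (X r \<omega>) - \<sigma> (X t \<omega>)))\<^sup>2) \<longlongrightarrow> 0) (at t within {t..})" by simp
  qed (use t b m in auto)
  then have "\<forall>\<^sub>F r in at t within {t..}. dist (?e r) 0 < \<epsilon>'"
    using \<epsilon> by (intro tendstoD) (auto simp: \<epsilon>'_def)
  then obtain d where d: "0 < d" "\<And>r. r \<in> {t..} \<Longrightarrow> r \<noteq> t \<Longrightarrow> dist r t < d \<Longrightarrow> dist (?e r) 0 < \<epsilon>'"
    unfolding eventually_at by blast
  have e: "?e r \<le> \<epsilon>'" if "t \<le> r" "r < t + d" for r
    using d(2)[of r] that \<epsilon> by (cases "r = t") (auto simp: dist_real_def \<epsilon>'_def)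
  \<comment> \<open>The other half must cover \<open>3 * (K\<mu> * h)\<^sup>2\<close>, that is,
    \<open>6 * K\<mu>\<^sup>2 * h \<le> \<epsilon>\<close>. The summand 1 keeps the denominator
    positive.\<close>
  define d' where "d' = min d (\<epsilon> / (6 * K\<mu>\<^sup>2 + 1))"
  have d': "0 < d'" using d \<epsilon> by (auto simp: d'_def intro!: divide_pos_pos add_nonneg_pos)
  show ?thesis
    unfolding eventually_at_right_field
  proof (intro exI[of _ d'] conjI allI impI)
    show "0 < d'" by (rule d')
    fix h :: real assume h0: "0 < h" and hd: "h < d'"
    have h: "0 < h" "h < d" "t \<le> t + h" using h0 hd by (auto simp: d'_def)
    obtain J J' where J: "has_Ito_integral W (\<lambda>s \<omega>. \<sigma> (X s \<omega>)) t J" "has_Ito_integral W (\<lambda>s \<omega>. \<sigma> (X s \<omega>)) (t + h) J'"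
      and inc: "AE \<omega> in M. X (t + h) \<omega> - X t \<omega> = integral {t..t + h} (\<lambda>r. \<mu> (X r \<omega>)) + (J' \<omega> - J \<omega>)"
      using sde_increment[OF t h(3)] .
    have [measurable]: "J \<in> borel_measurable M" "J' \<in> borel_measurable M"
      using J by (auto simp: has_Ito_integral_def)
    have [measurable]: "frozen_noise h \<in> borel_measurable M" using h measurable_frozen_noise by simp
    have [measurable]: "(\<lambda>\<omega>. integral {t..t + h} (\<lambda>r. \<mu> (X r \<omega>))) \<in> borel_measurable M"
      using measurable_F_M[OF _ measurable_integral_X[OF \<mu>(1) t h(3)]] t h by auto
    have D: "(\<integral>\<^sup>+\<omega>. ennreal ((norm (J' \<omega> - J \<omega> - frozen_noise h \<omega>))\<^sup>2) \<partial>M) \<le> 9 * ennreal (\<epsilon>' * h)"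
    proof -
      have "(\<integral>\<^sup>+\<omega>. ennreal ((norm (J' \<omega> - J \<omega> - frozen_noise h \<omega>))\<^sup>2) \<partial>M)
        \<le> 9 * (\<integral>\<^sup>+\<omega>. (\<integral>\<^sup>+r\<in>{t..t + h}. ennreal ((norm (\<sigma> (X r \<omega>) - \<sigma> (X t \<omega>)))\<^sup>2) \<partial>lborel) \<partial>M)"
        unfolding frozen_noise_def
        by (rule ito_increment_bound[OF bm J t h(3) measurable_\<sigma>_X_joint measurable_fun_X[OF \<sigma>(1) t] bounded_\<sigma>_X])
      \<comment> \<open>Exchanging the integrals puts the expectation inside, where the bound on
        \<open>?e r\<close> holds for each single time.\<close>
      also have "(\<integral>\<^sup>+\<omega>. (\<integral>\<^sup>+r\<in>{t..t + h}. ennreal ((norm (\<sigma> (X r \<omega>) - \<sigma> (X t \<omega>)))\<^sup>2) \<partial>lborel) \<partial>M)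
        = (\<integral>\<^sup>+r. (\<integral>\<^sup>+\<omega>. ennreal ((norm (\<sigma> (X r \<omega>) - \<sigma> (X t \<omega>)))\<^sup>2) * indicator {t..t + h} r \<partial>M) \<partial>lborel)"
      proof (rule P.Fubini'[symmetric])
        have [measurable]: "(\<lambda>x. indicator {0..} (snd x) *\<^sub>R \<sigma> (X (snd x) (fst x))) \<in> borel_measurable (M \<Otimes>\<^sub>M lborel)"
          using measurable_\<sigma>_X_joint by (simp add: split_beta')
        have [measurable]: "(\<lambda>\<omega>. \<sigma> (X t \<omega>)) \<in> borel_measurable M" by (rule measurable_fun_X_M[OF \<sigma>(1) t])
        have "(\<lambda>(\<omega>, r). ennreal ((norm (\<sigma> (X r \<omega>) - \<sigma> (X t \<omega>)))\<^sup>2) * indicator {t..t + h} r)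
          = (\<lambda>x. ennreal ((norm (indicator {0..} (snd x) *\<^sub>R \<sigma> (X (snd x) (fst x)) - \<sigma> (X t (fst x))))\<^sup>2) * indicator {t..t + h} (snd x))"
          using t by (auto simp: fun_eq_iff indicator_def)
        also have "\<dots> \<in> borel_measurable (M \<Otimes>\<^sub>M lborel)" by measurable
        finally show "(\<lambda>(\<omega>, r). ennreal ((norm (\<sigma> (X r \<omega>) - \<sigma> (X t \<omega>)))\<^sup>2) * indicator {t..t + h} r)
          \<in> borel_measurable (M \<Otimes>\<^sub>M lborel)" .
      qed
      also have "\<dots> \<le> (\<integral>\<^sup>+r. ennreal \<epsilon>' * indicator {t..t + h} r \<partial>lborel)"
      proof (rule nn_integral_mono)
        fix r :: real
        show "(\<integral>\<^sup>+\<omega>. ennreal ((norm (\<sigma> (X r \<omega>) - \<sigma> (X t \<omega>)))\<^sup>2) * indicator {t..t + h} r \<partial>M) \<le> ennreal \<epsilon>' * indicator {t..t + h} r"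
        proof (cases "r \<in> {t..t + h}")
          case True
          then have r: "0 \<le> r" "?e r \<le> \<epsilon>'" using t h e[of r] by auto
          have "integrable M (\<lambda>\<omega>. (norm (\<sigma> (X r \<omega>) - \<sigma> (X t \<omega>)))\<^sup>2)"
            by (rule integrable_const_bound[where B="(2 * K\<sigma>)\<^sup>2"]) (use b m[OF r(1)] in auto)
          then have "(\<integral>\<^sup>+\<omega>. ennreal ((norm (\<sigma> (X r \<omega>) - \<sigma> (X t \<omega>)))\<^sup>2) \<partial>M) = ennreal (?e r)"
            by (intro nn_integral_eq_integral) auto
          then show ?thesis using True r by (simp add: ennreal_leI)
        qed simp
      qed
      also have "\<dots> = ennreal (\<epsilon>' * h)"
        using h \<epsilon> by (simp add: nn_integral_cmult \<epsilon>'_def flip: ennreal_mult)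
      finally show ?thesis by (simp add: mult_left_mono)
    qed
    have "(\<integral>\<^sup>+\<omega>. ennreal ((norm (euler_error h \<omega>))\<^sup>2) \<partial>M) =
      (\<integral>\<^sup>+\<omega>. ennreal ((norm (integral {t..t + h} (\<lambda>r. \<mu> (X r \<omega>)) + (J' \<omega> - J \<omega> - frozen_noise h \<omega>)))\<^sup>2) \<partial>M)"
      by (rule nn_integral_cong_AE) (use inc in eventually_elim, simp only: euler_error_def add_diff_eq)
    also have "\<dots> \<le> 3 * ((\<integral>\<^sup>+\<omega>. ennreal ((norm (integral {t..t + h} (\<lambda>r. \<mu> (X r \<omega>))))\<^sup>2) \<partial>M)
      + (\<integral>\<^sup>+\<omega>. ennreal ((norm (J' \<omega> - J \<omega> - frozen_noise h \<omega>))\<^sup>2) \<partial>M) + (\<integral>\<^sup>+\<omega>. ennreal ((norm (0::real^'n))\<^sup>2) \<partial>M))"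
      by (rule nn_integral_norm_add3_squared) auto
    also have "\<dots> \<le> 3 * (ennreal ((K\<mu> * h)\<^sup>2) + 9 * ennreal (\<epsilon>' * h) + 0)"
    proof (intro mult_left_mono add_mono D)
      have "(\<integral>\<^sup>+\<omega>. ennreal ((norm (integral {t..t + h} (\<lambda>r. \<mu> (X r \<omega>))))\<^sup>2) \<partial>M) \<le> (\<integral>\<^sup>+\<omega>. ennreal ((K\<mu> * h)\<^sup>2) \<partial>M)"
        using norm_integral_X_le[OF \<mu> t h(3)] by (intro nn_integral_mono ennreal_leI power_mono) auto
      then show "(\<integral>\<^sup>+\<omega>. ennreal ((norm (integral {t..t + h} (\<lambda>r. \<mu> (X r \<omega>))))\<^sup>2) \<partial>M) \<le> ennreal ((K\<mu> * h)\<^sup>2)"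
        by (simp add: emeasure_space_1)
    qed auto
    also have "\<dots> = ennreal (3 * ((K\<mu> * h)\<^sup>2 + 9 * (\<epsilon>' * h)))"
      using h \<open>0 \<le> \<epsilon>'\<close> by (simp add: ennreal_mult ennreal_plus)
    also have "\<dots> \<le> ennreal (\<epsilon> * h)"
    proof (rule ennreal_leI)
      have "h * (6 * K\<mu>\<^sup>2 + 1) \<le> \<epsilon>"
      proof -
        have "h \<le> \<epsilon> / (6 * K\<mu>\<^sup>2 + 1)" using hd by (auto simp: d'_def)
        moreover have "0 < 6 * K\<mu>\<^sup>2 + 1" by (intro add_nonneg_pos) auto
        ultimately show ?thesis by (simp add: field_simps)
      qed
      then have "h * (h * (6 * K\<mu>\<^sup>2 + 1)) \<le> h * \<epsilon>" using h by (intro mult_left_mono) auto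
      then show "3 * ((K\<mu> * h)\<^sup>2 + 9 * (\<epsilon>' * h)) \<le> \<epsilon> * h"
      proof -
        assume "h * (h * (6 * K\<mu>\<^sup>2 + 1)) \<le> h * \<epsilon>"
        then have "h * h + 6 * (K\<mu> * h)\<^sup>2 \<le> \<epsilon> * h"
          by (simp add: power2_eq_square algebra_simps)
        moreover have "0 \<le> h * h" by simp
        moreover have "3 * (x + 9 * (\<epsilon>' * h)) \<le> \<epsilon> * h" if "h * h + 6 * x \<le> \<epsilon> * h" "0 \<le> h * h" for x
        proof -
          have "3 * (x + 9 * (\<epsilon>' * h)) = 3 * x + \<epsilon> * h / 2" by (simp add: \<epsilon>'_def)
          then show ?thesis using that by linarith
        qed
        ultimately show ?thesis by blast
      qed
    qed
    finally show "(\<integral>\<^sup>+\<omega>. ennreal ((norm (euler_error h \<omega>))\<^sup>2) \<partial>M) \<le> ennreal (\<epsilon> * h)" .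
  qed
qed

lemma
  assumes fin: "(\<integral>\<^sup>+\<omega>. ennreal ((norm (euler_error h \<omega>))\<^sup>2) \<partial>M) \<le> ennreal c" and h: "0 \<le> h" and c: "0 \<le> c"
  shows integrable_euler_error: "integrable M (\<lambda>\<omega>. (norm (euler_error h \<omega>))\<^sup>2)"
    and expectation_euler_error_le: "(\<integral>\<omega>. (norm (euler_error h \<omega>))\<^sup>2 \<partial>M) \<le> c"
proof -
  have [measurable]: "euler_error h \<in> borel_measurable M" by (rule measurable_euler_error[OF h])
  show i: "integrable M (\<lambda>\<omega>. (norm (euler_error h \<omega>))\<^sup>2)"
    using le_less_trans[OF fin] by (intro integrableI_bounded) (auto simp: less_top)
  show "(\<integral>\<omega>. (norm (euler_error h \<omega>))\<^sup>2 \<partial>M) \<le> c"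
    using fin nn_integral_eq_integral[OF i] c by (simp add: ennreal_le_iff)
qed

lemma norm_frozen_noise_le: "norm (frozen_noise h \<omega>) \<le> K\<sigma> * norm (W (t + h) \<omega> - W t \<omega>)"
  unfolding frozen_noise_def
  by (rule order_trans[OF norm_matrix_vector_mult_le mult_right_mono[OF \<sigma>(2)]]) simp

lemma integrable_increment_squared:
  assumes i: "integrable M (\<lambda>\<omega>. (norm (euler_error h \<omega>))\<^sup>2)" and h: "0 \<le> h"
  shows "integrable M (\<lambda>\<omega>. (norm (X (t + h) \<omega> - X t \<omega>))\<^sup>2)"
proof (rule Bochner_Integration.integrable_bound)
  show "integrable M (\<lambda>\<omega>. 3 * (K\<sigma>\<^sup>2 * (norm (W (t + h) \<omega> - W t \<omega>))\<^sup>2 + (norm (euler_error h \<omega>))\<^sup>2))"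
    using expectation_dW_squared(1)[OF bm t, of "t + h"] h i by simp
  show "(\<lambda>\<omega>. (norm (X (t + h) \<omega> - X t \<omega>))\<^sup>2) \<in> borel_measurable M"
  proof -
    have [measurable]: "X (t + h) \<in> borel_measurable M" "X t \<in> borel_measurable M"
      using measurable_X_M t h by auto
    show ?thesis by measurable
  qed
  show "AE \<omega> in M. norm ((norm (X (t + h) \<omega> - X t \<omega>))\<^sup>2) \<le>
      norm (3 * (K\<sigma>\<^sup>2 * (norm (W (t + h) \<omega> - W t \<omega>))\<^sup>2 + (norm (euler_error h \<omega>))\<^sup>2))"
  proof (rule AE_I2)
    fix \<omega>
    have "(norm (frozen_noise h \<omega>))\<^sup>2 \<le> K\<sigma>\<^sup>2 * (norm (W (t + h) \<omega> - W t \<omega>))\<^sup>2"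
      using power_mono[OF norm_frozen_noise_le norm_ge_zero, of h \<omega> 2] by (simp add: power_mult_distrib)
    then show "norm ((norm (X (t + h) \<omega> - X t \<omega>))\<^sup>2) \<le>
      norm (3 * (K\<sigma>\<^sup>2 * (norm (W (t + h) \<omega> - W t \<omega>))\<^sup>2 + (norm (euler_error h \<omega>))\<^sup>2))"
      using norm_add3_squared_le[of "frozen_noise h \<omega>" "euler_error h \<omega>" 0]
      by (simp add: euler_error_def)
  qed
qed

text \<open>Testing with \<open>Z\<close> removes the stochastic integral and leaves the drift. The
  integrability that \<open>ito_increment_mean\<close> asks for is obtained from the almost sure
  identity with an increment of \<open>X\<close>, whose second moment is finite.\<close>

lemma
  fixes Z :: "'a \<Rightarrow> real^'n"
  assumes Z: "Z \<in> borel_measurable (F t)" "bounded (Z ` space M)" and h: "0 \<le> h"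
    and i: "integrable M (\<lambda>\<omega>. (norm (euler_error h \<omega>))\<^sup>2)"
  shows integrable_inner_increment: "integrable M (\<lambda>\<omega>. Z \<omega> \<bullet> (X (t + h) \<omega> - X t \<omega>))"
    and expectation_inner_increment: "(\<integral>\<omega>. Z \<omega> \<bullet> (X (t + h) \<omega> - X t \<omega>) \<partial>M)
      = (\<integral>\<omega>. Z \<omega> \<bullet> integral {t..t + h} (\<lambda>r. \<mu> (X r \<omega>)) \<partial>M)"
proof -
  have th: "t \<le> t + h" using h by simp
  obtain K where K: "\<And>\<omega>. \<omega> \<in> space M \<Longrightarrow> norm (Z \<omega>) \<le> K"
    using Z(2) by (auto simp: bounded_iff)
  have [measurable]: "Z \<in> borel_measurable M" "X (t + h) \<in> borel_measurable M" "X t \<in> borel_measurable M"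
    using measurable_F_M[OF t Z(1)] measurable_X_M t h by auto
  have [measurable]: "(\<lambda>\<omega>. integral {t..t + h} (\<lambda>r. \<mu> (X r \<omega>))) \<in> borel_measurable M"
    using measurable_F_M[OF _ measurable_integral_X[OF \<mu>(1) t th]] t h by auto
  show 1: "integrable M (\<lambda>\<omega>. Z \<omega> \<bullet> (X (t + h) \<omega> - X t \<omega>))"
  proof (rule Bochner_Integration.integrable_bound)
    show "integrable M (\<lambda>\<omega>. K * (1 + (norm (X (t + h) \<omega> - X t \<omega>))\<^sup>2))"
      using integrable_increment_squared[OF i h] by simp
    show "AE \<omega> in M. norm (Z \<omega> \<bullet> (X (t + h) \<omega> - X t \<omega>)) \<le> norm (K * (1 + (norm (X (t + h) \<omega> - X t \<omega>))\<^sup>2))"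
    proof (rule AE_I2)
      fix \<omega> assume \<omega>: "\<omega> \<in> space M"
      let ?x = "norm (X (t + h) \<omega> - X t \<omega>)"
      \<comment> \<open>Second moments control first moments through this inequality.\<close>
      have "2 * ?x \<le> 1 + ?x\<^sup>2"
        using zero_le_power2[of "?x - 1"] by (simp add: power2_eq_square algebra_simps)
      then have x: "?x \<le> 1 + ?x\<^sup>2"
        using norm_ge_zero[of "X (t + h) \<omega> - X t \<omega>"] by linarith
      have "norm (Z \<omega> \<bullet> (X (t + h) \<omega> - X t \<omega>)) \<le> norm (Z \<omega>) * ?x"
        using Cauchy_Schwarz_ineq2 by simp
      also have "\<dots> \<le> K * (1 + ?x\<^sup>2)"
        using K[OF \<omega>] x order_trans[OF norm_ge_zero K[OF \<omega>]] by (intro mult_mono) auto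
      finally show "norm (Z \<omega> \<bullet> (X (t + h) \<omega> - X t \<omega>)) \<le> norm (K * (1 + ?x\<^sup>2))" by simp
    qed
  qed measurable
  have 2: "integrable M (\<lambda>\<omega>. Z \<omega> \<bullet> integral {t..t + h} (\<lambda>r. \<mu> (X r \<omega>)))"
  proof (rule integrable_const_bound[where B="K * (K\<mu> * h)"])
    show "AE \<omega> in M. norm (Z \<omega> \<bullet> integral {t..t + h} (\<lambda>r. \<mu> (X r \<omega>))) \<le> K * (K\<mu> * h)"
    proof (rule AE_I2)
      fix \<omega> assume \<omega>: "\<omega> \<in> space M"
      have "norm (Z \<omega> \<bullet> integral {t..t + h} (\<lambda>r. \<mu> (X r \<omega>))) \<le> norm (Z \<omega>) * norm (integral {t..t + h} (\<lambda>r. \<mu> (X r \<omega>)))"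
        using Cauchy_Schwarz_ineq2 by simp
      also have "\<dots> \<le> K * (K\<mu> * h)"
        using norm_integral_X_le[OF \<mu> t th \<omega>] K[OF \<omega>] order_trans[OF norm_ge_zero K[OF \<omega>]]
        by (intro mult_mono) auto
      finally show "norm (Z \<omega> \<bullet> integral {t..t + h} (\<lambda>r. \<mu> (X r \<omega>))) \<le> K * (K\<mu> * h)" .
    qed
  qed measurable
  obtain J J' where J: "has_Ito_integral W (\<lambda>s \<omega>. \<sigma> (X s \<omega>)) t J" "has_Ito_integral W (\<lambda>s \<omega>. \<sigma> (X s \<omega>)) (t + h) J'"
    and inc: "AE \<omega> in M. X (t + h) \<omega> - X t \<omega> = integral {t..t + h} (\<lambda>r. \<mu> (X r \<omega>)) + (J' \<omega> - J \<omega>)"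
    using sde_increment[OF t th] .
  have [measurable]: "J \<in> borel_measurable M" "J' \<in> borel_measurable M"
    using J by (auto simp: has_Ito_integral_def)
  have ae: "AE \<omega> in M. Z \<omega> \<bullet> (J' \<omega> - J \<omega>) = Z \<omega> \<bullet> (X (t + h) \<omega> - X t \<omega>) - Z \<omega> \<bullet> integral {t..t + h} (\<lambda>r. \<mu> (X r \<omega>))"
    using inc by eventually_elim (simp add: inner_diff_right[symmetric])
  have 3: "integrable M (\<lambda>\<omega>. Z \<omega> \<bullet> (J' \<omega> - J \<omega>))"
    using integrable_cong_AE[OF _ _ ae] 1 2 by auto
  have "0 = (\<integral>\<omega>. Z \<omega> \<bullet> (J' \<omega> - J \<omega>) \<partial>M)"
    using ito_increment_mean[OF bm J t th measurable_\<sigma>_X_joint Z 3] by simp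
  also have "\<dots> = (\<integral>\<omega>. Z \<omega> \<bullet> (X (t + h) \<omega> - X t \<omega>) - Z \<omega> \<bullet> integral {t..t + h} (\<lambda>r. \<mu> (X r \<omega>)) \<partial>M)"
    by (rule integral_cong_AE[OF _ _ ae]) auto
  finally show "(\<integral>\<omega>. Z \<omega> \<bullet> (X (t + h) \<omega> - X t \<omega>) \<partial>M)
      = (\<integral>\<omega>. Z \<omega> \<bullet> integral {t..t + h} (\<lambda>r. \<mu> (X r \<omega>)) \<partial>M)"
    using 1 2 by simp
qed

text \<open>Expanded in the coordinates of the Brownian increment, the quadratic form has weights
  known at time \<open>t\<close>. Unequal coordinates have mean zero and equal ones give
  \<open>h\<close>, so by \<open>trace_diffusion\<close> the second-order part of the generator
  appears exactly, without an error term.\<close>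

lemma
  fixes Z :: "'a \<Rightarrow> real" and H :: "real^'n \<Rightarrow> real^'n^'n"
  assumes Z: "Z \<in> borel_measurable (F t)" "bounded (Z ` space M)" and h: "0 \<le> h"
    and H: "continuous_on UNIV H" "\<And>x. norm (H x) \<le> K"
  shows integrable_frozen_noise_quadratic:
      "integrable M (\<lambda>\<omega>. Z \<omega> * ((1 / 2) * (frozen_noise h \<omega> \<bullet> (H (X t \<omega>) *v frozen_noise h \<omega>))))"
    and expectation_frozen_noise_quadratic:
      "(\<integral>\<omega>. Z \<omega> * ((1 / 2) * (frozen_noise h \<omega> \<bullet> (H (X t \<omega>) *v frozen_noise h \<omega>))) \<partial>M)
        = h * (\<integral>\<omega>. Z \<omega> * trace (diffusion_matrix \<sigma> (X t \<omega>) ** H (X t \<omega>)) \<partial>M)"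
proof -
  have th: "t \<le> t + h" using h by simp
  define s where "s p q \<omega> = (\<Sum>r\<in>UNIV. \<sigma> (X t \<omega>) $ r $ p * (H (X t \<omega>) ** \<sigma> (X t \<omega>)) $ r $ q)" for p q \<omega>
  define c where "c p q \<omega> = Z \<omega> * (1 / 2 * s p q \<omega>)" for p q \<omega>
  obtain KZ where KZ: "0 < KZ" "\<And>\<omega>. \<omega> \<in> space M \<Longrightarrow> \<bar>Z \<omega>\<bar> \<le> KZ"
    using bounded_pos[THEN iffD1, OF Z(2)] by auto
  have K0: "0 \<le> K" using order_trans[OF norm_ge_zero H(2)] .
  note [measurable] = Z(1) measurable_fun_X[OF \<sigma>(1) t] measurable_fun_X[OF H(1) t]
  have cm: "c p q \<in> borel_measurable (F t)" for p q
    unfolding c_def s_def matrix_matrix_mult_def by simp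
  have Hs: "\<bar>(H x ** \<sigma> x) $ r $ q\<bar> \<le> CARD('n) * (K * K\<sigma>)" for x r q
  proof -
    have "\<bar>(H x ** \<sigma> x) $ r $ q\<bar> \<le> (\<Sum>j\<in>(UNIV::'n set). K * K\<sigma>)"
      unfolding matrix_matrix_mult_def
      by (simp only: vec_lambda_beta, rule order_trans[OF sum_abs sum_mono])
        (auto simp: abs_mult intro!: mult_mono order_trans[OF abs_vec_nth_nth_le] H \<sigma> K0)
    then show ?thesis by simp
  qed
  have cb: "\<bar>c p q \<omega>\<bar> \<le> KZ * (1 / 2 * (CARD('n) * (K\<sigma> * (CARD('n) * (K * K\<sigma>)))))" if \<omega>: "\<omega> \<in> space M" for p q \<omega>
  proof -
    have "\<bar>\<Sum>r\<in>UNIV. \<sigma> (X t \<omega>) $ r $ p * (H (X t \<omega>) ** \<sigma> (X t \<omega>)) $ r $ q\<bar>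
      \<le> (\<Sum>r\<in>(UNIV::'n set). K\<sigma> * (CARD('n) * (K * K\<sigma>)))"
      by (rule order_trans[OF sum_abs sum_mono])
        (auto simp only: abs_mult intro!: mult_mono Hs order_trans[OF abs_vec_nth_nth_le] \<sigma> K_nonneg abs_ge_zero)
    then have "\<bar>1 / 2 * (\<Sum>r\<in>UNIV. \<sigma> (X t \<omega>) $ r $ p * (H (X t \<omega>) ** \<sigma> (X t \<omega>)) $ r $ q)\<bar>
      \<le> 1 / 2 * (CARD('n) * (K\<sigma> * (CARD('n) * (K * K\<sigma>))))" by (simp add: abs_mult)
    then show ?thesis
      unfolding c_def s_def abs_mult[of "Z \<omega>"] using KZ \<omega> by (intro mult_mono) auto
  qed
  have ci: "integrable M (c p q)" for p q
    by (rule integrable_const_bound[where B="KZ * (1 / 2 * (CARD('n) * (K\<sigma> * (CARD('n) * (K * K\<sigma>)))))"])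
      (use cb measurable_F_M[OF t cm] in \<open>auto simp only: real_norm_def intro!: AE_I2\<close>)
  have eq: "Z \<omega> * ((1 / 2) * (frozen_noise h \<omega> \<bullet> (H (X t \<omega>) *v frozen_noise h \<omega>)))
    = (\<Sum>p\<in>UNIV. \<Sum>q\<in>UNIV. c p q \<omega> * ((W (t + h) \<omega> - W t \<omega>) $ p * (W (t + h) \<omega> - W t \<omega>) $ q))" for \<omega>
    unfolding frozen_noise_def matrix_vector_mul_assoc inner_matrix_vector_mult_both c_def s_def[symmetric]
    by (simp only: sum_distrib_left mult.assoc)
  have tr: "(\<Sum>p\<in>UNIV. c p p \<omega>) = Z \<omega> * trace (diffusion_matrix \<sigma> (X t \<omega>) ** H (X t \<omega>))" for \<omega>
    unfolding c_def s_def sum_distrib_left[symmetric] trace_diffusion[symmetric] by simp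
  note 1 = integrable_mult_dW2[OF bm t th cm ci] expectation_mult_dW2[OF bm t th cm ci]
  show "integrable M (\<lambda>\<omega>. Z \<omega> * ((1 / 2) * (frozen_noise h \<omega> \<bullet> (H (X t \<omega>) *v frozen_noise h \<omega>))))"
    unfolding eq by (intro Bochner_Integration.integrable_sum 1(1))
  have "(\<integral>\<omega>. Z \<omega> * ((1 / 2) * (frozen_noise h \<omega> \<bullet> (H (X t \<omega>) *v frozen_noise h \<omega>))) \<partial>M)
    = (\<Sum>p\<in>UNIV. \<Sum>q\<in>UNIV. (\<integral>\<omega>. c p q \<omega> \<partial>M) * (if p = q then t + h - t else 0))"
    unfolding eq by (simp only: 1 Bochner_Integration.integral_sum Bochner_Integration.integrable_sum)
  also have "\<dots> = h * (\<integral>\<omega>. (\<Sum>p\<in>UNIV. c p p \<omega>) \<partial>M)"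
    using ci by (simp add: if_distrib sum_distrib_left mult.commute cong: if_cong)
  finally show "(\<integral>\<omega>. Z \<omega> * ((1 / 2) * (frozen_noise h \<omega> \<bullet> (H (X t \<omega>) *v frozen_noise h \<omega>))) \<partial>M)
        = h * (\<integral>\<omega>. Z \<omega> * trace (diffusion_matrix \<sigma> (X t \<omega>) ** H (X t \<omega>)) \<partial>M)"
    unfolding tr .
qed

end

end

section \<open>The generator of the diffusion\<close>

context bounded_sde
begin

lemma tendsto_X_right:
  assumes "0 \<le> t" "\<omega> \<in> space M"
  shows "((\<lambda>h. X (t + h) \<omega>) \<longlongrightarrow> X t \<omega>) (at_right 0)"
proof -
  have "((\<lambda>r. X r \<omega>) \<longlongrightarrow> X t \<omega>) (at_right t)"
    using continuous_X[OF assms(2), of "{t..}"] assms(1)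
    by (auto simp: continuous_on_def intro: tendsto_within_subset[of _ _ t "{t..}"])
  then show ?thesis by (subst (asm) filterlim_at_right_to_0) (simp add: add.commute)
qed

lemma euler_error_ratio_tendsto:
  assumes t: "0 \<le> t"
  shows "((\<lambda>h. (\<integral>\<omega>. (norm (euler_error t h \<omega>))\<^sup>2 \<partial>M) / h) \<longlongrightarrow> 0) (at_right 0)"
proof (rule tendstoI)
  fix e :: real assume e: "0 < e"
  have "\<forall>\<^sub>F h in at_right 0. (\<integral>\<^sup>+\<omega>. ennreal ((norm (euler_error t h \<omega>))\<^sup>2) \<partial>M) \<le> ennreal (e / 2 * h)"
    using e by (intro euler_error_small[OF t]) simp
  moreover have "\<forall>\<^sub>F h in at_right 0. (0::real) < h" by (simp add: eventually_at_right_less)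
  ultimately show "\<forall>\<^sub>F h in at_right 0. dist ((\<integral>\<omega>. (norm (euler_error t h \<omega>))\<^sup>2 \<partial>M) / h) 0 < e"
  proof eventually_elim
    case (elim h)
    then have "(\<integral>\<omega>. (norm (euler_error t h \<omega>))\<^sup>2 \<partial>M) \<le> e / 2 * h"
      using e by (intro expectation_euler_error_le[OF t]) auto
    moreover have "0 \<le> (\<integral>\<omega>. (norm (euler_error t h \<omega>))\<^sup>2 \<partial>M)" by simp
    moreover have "e / 2 * h < e * h" using e elim by simp
    ultimately show ?case using elim by (simp add: field_simps)
  qed
qed

text \<open>Only an \<open>L\<^sup>2\<close> bound on the Euler error is available, so the Taylor remainder is controlled by
  splitting off the Gaussian part, whose fourth moment is known.\<close>

lemma second_order_remainder_tendsto:
  fixes Z :: "'a \<Rightarrow> real" and \<phi> :: "real^'n \<Rightarrow> real"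
  assumes t: "0 \<le> t" and Z: "Z \<in> borel_measurable (F t)" "bounded (Z ` space M)"
    and d1: "\<And>x. \<phi> differentiable (at x)" and d2: "\<And>i x. partial_deriv i \<phi> differentiable (at x)"
    and g: "continuous_on UNIV (grad \<phi>)" and H: "continuous_on UNIV (Hess \<phi>)" "\<And>x. norm (Hess \<phi> x) \<le> K"
  defines "v \<equiv> \<lambda>h \<omega>. X (t + h) \<omega> - X t \<omega>"
  defines "E \<equiv> \<lambda>h \<omega>. (1 / 2) * (v h \<omega> \<bullet> (Hess \<phi> (X t \<omega>) *v v h \<omega>))
      - (1 / 2) * (frozen_noise t h \<omega> \<bullet> (Hess \<phi> (X t \<omega>) *v frozen_noise t h \<omega>)) + taylor2_error \<phi> (X t \<omega>) (v h \<omega>)"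
  shows "\<forall>\<^sub>F h in at_right 0. integrable M (\<lambda>\<omega>. Z \<omega> * E h \<omega>)"
    and "((\<lambda>h. (\<integral>\<omega>. Z \<omega> * E h \<omega> \<partial>M) / h) \<longlongrightarrow> 0) (at_right 0)"
proof -
  have K0: "0 \<le> K" using order_trans[OF norm_ge_zero H(2)] .
  obtain KZ where KZ: "0 < KZ" "\<And>\<omega>. \<omega> \<in> space M \<Longrightarrow> \<bar>Z \<omega>\<bar> \<le> KZ"
    using bounded_pos[THEN iffD1, OF Z(2)] by auto
  have \<phi>c: "continuous_on UNIV \<phi>"
    using d1 by (intro differentiable_imp_continuous_on) (auto simp: differentiable_on_def)
  \<comment> \<open>The relative Taylor error is bounded by \<open>K\<close> and tends to 0 on every
    path, so the mean of its square tends to 0 whatever the moments of the increment are.\<close>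
  define \<delta> where "\<delta> h \<omega> = \<bar>taylor2_error \<phi> (X t \<omega>) (v h \<omega>)\<bar> / (norm (v h \<omega>))\<^sup>2" for h \<omega>
  let ?w = "\<lambda>h \<omega>. norm (W (t + h) \<omega> - W t \<omega>)" and ?r = "\<lambda>h \<omega>. norm (euler_error t h \<omega>)"
  note [measurable] = measurable_fun_X_M[OF H(1) t] measurable_fun_X_M[OF g t] measurable_fun_X_M[OF \<phi>c t]
    measurable_F_M[OF t Z(1)] measurable_X_M[OF t]
  have [measurable]: "frozen_noise t h \<in> borel_measurable M" "euler_error t h \<in> borel_measurable M"
    "(\<lambda>\<omega>. \<phi> (X (t + h) \<omega>)) \<in> borel_measurable M" "v h \<in> borel_measurable M" if "0 \<le> h" for h
    using that t measurable_frozen_noise[OF t] measurable_euler_error[OF t] measurable_fun_X_M[OF \<phi>c]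
      measurable_X_M[OF t] measurable_X_M[of "t + h"] by (auto simp: v_def)
  have vX: "\<phi> (X t \<omega> + v h \<omega>) = \<phi> (X (t + h) \<omega>)" for h \<omega> by (simp add: v_def)
  have tm[measurable]: "(\<lambda>\<omega>. taylor2_error \<phi> (X t \<omega>) (v h \<omega>)) \<in> borel_measurable M" if "0 \<le> h" for h
    unfolding taylor2_error_def vX using that by measurable
  have \<delta>m[measurable]: "\<delta> h \<in> borel_measurable M" if "0 \<le> h" for h
    unfolding \<delta>_def[abs_def] using that by measurable
  have \<delta>: "0 \<le> \<delta> h \<omega>" "\<delta> h \<omega> \<le> K" for h \<omega>
    unfolding \<delta>_def using taylor2_error_bounded[OF d1 d2 H(2)] by auto
  have \<delta>2: "(\<delta> h \<omega>)\<^sup>2 \<le> K\<^sup>2" for h \<omega> using \<delta> by (intro power_mono) auto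
  have \<delta>i: "integrable M (\<lambda>\<omega>. (\<delta> h \<omega>)\<^sup>2)" if "0 \<le> h" for h
    by (rule integrable_const_bound[where B="K\<^sup>2"]) (use \<delta>2 \<delta>m[OF that] in auto)
  have e: "\<bar>taylor2_error \<phi> (X t \<omega>) (v h \<omega>)\<bar> \<le> \<delta> h \<omega> * (norm (v h \<omega>))\<^sup>2" for h \<omega>
    by (cases "v h \<omega> = 0") (auto simp: \<delta>_def taylor2_error_def)
  \<comment> \<open>Increments of \<open>X\<close> may vanish for some \<open>h\<close>; this is
    harmless since \<open>taylor2_error_tendsto\<close> includes the point 0.\<close>
  have \<delta>lim: "((\<lambda>h. \<integral>\<omega>. (\<delta> h \<omega>)\<^sup>2 \<partial>M) \<longlongrightarrow> (\<integral>\<omega>. 0 \<partial>M)) (at 0 within {0<..<1})"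
  proof (rule bounded_convergence_within[where K="K\<^sup>2"])
    fix \<omega> assume \<omega>: "\<omega> \<in> space M"
    have "((\<lambda>h. v h \<omega>) \<longlongrightarrow> X t \<omega> - X t \<omega>) (at_right 0)"
      unfolding v_def by (intro tendsto_diff tendsto_X_right[OF t \<omega>] tendsto_const)
    then have "((\<lambda>h. v h \<omega>) \<longlongrightarrow> 0) (at_right 0)" by simp
    from filterlim_compose[OF taylor2_error_tendsto[OF d1 d2 H(1)] this]
    have "((\<lambda>h. \<delta> h \<omega>) \<longlongrightarrow> 0) (at_right 0)" by (simp add: \<delta>_def)
    from tendsto_power[OF this, of 2]
    show "((\<lambda>h. (\<delta> h \<omega>)\<^sup>2) \<longlongrightarrow> 0) (at 0 within {0<..<1})" by (simp add: at_right_eq_Ioo)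
  qed (use \<delta>2 \<delta>m in auto)
  have fin: "\<forall>\<^sub>F h in at_right 0. 0 < h \<and> integrable M (\<lambda>\<omega>. (?r h \<omega>)\<^sup>2)"
    using euler_error_small[OF t zero_less_one] eventually_at_right_less
  proof eventually_elim
    case (elim h)
    then show ?case using integrable_euler_error[OF t, of h "1 * h"] by simp
  qed
  \<comment> \<open>\<open>C\<close> collects the coefficients of \<open>a\<close>, after division
    by \<open>h\<close>, using the mean \<open>CARD('m) * h\<close> of the squared increment and the
    bound \<open>3 * CARD('m)\<^sup>2 * h\<^sup>2\<close> for its fourth power. \<open>L a\<close>
    dominates the coefficients of the two quantities that vanish with \<open>h\<close>.\<close>
  define C where "C = KZ * (K * K\<sigma> * CARD('m) + 2 * K\<sigma>\<^sup>2 * (3 * (real CARD('m))\<^sup>2))"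
  define L where "L a = KZ * (K * K\<sigma> / a + 3 * K + 2 * K\<sigma>\<^sup>2 / a)" for a
  have main: "integrable M (\<lambda>\<omega>. Z \<omega> * E h \<omega>) \<and>
     \<bar>(\<integral>\<omega>. Z \<omega> * E h \<omega> \<partial>M) / h\<bar> \<le> C * a + L a * ((\<integral>\<omega>. (?r h \<omega>)\<^sup>2 \<partial>M) / h + (\<integral>\<omega>. (\<delta> h \<omega>)\<^sup>2 \<partial>M))"
    if h: "0 < h" and i: "integrable M (\<lambda>\<omega>. (?r h \<omega>)\<^sup>2)" and a: "0 < a" for h a
  proof -
    have h0: "0 \<le> h" and th: "t \<le> t + h" using h by auto
    let ?b = "\<lambda>\<omega>. KZ * (K * K\<sigma> * a * (?w h \<omega>)\<^sup>2 + (K * K\<sigma> / a + 3 * K) * (?r h \<omega>)\<^sup>2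
      + 2 * K\<sigma>\<^sup>2 * ((\<delta> h \<omega>)\<^sup>2 * h / a + a * (?w h \<omega>) ^ 4 / h))"
    note w2 = expectation_dW_squared[OF bm t th] and w4 = expectation_dW4[OF bm t th]
    have bi: "integrable M ?b"
      using w2(1) w4(1) i \<delta>i[OF h0] by (intro integrable_mult_right Bochner_Integration.integrable_add) auto
    have le: "\<bar>Z \<omega> * E h \<omega>\<bar> \<le> ?b \<omega>" if \<omega>: "\<omega> \<in> space M" for \<omega>
    proof -
      have "\<bar>E h \<omega>\<bar> \<le> K * K\<sigma> * a * (?w h \<omega>)\<^sup>2 + (K * K\<sigma> / a + 3 * K) * (?r h \<omega>)\<^sup>2
        + 2 * K\<sigma>\<^sup>2 * ((\<delta> h \<omega>)\<^sup>2 * h / a + a * (?w h \<omega>) ^ 4 / h)"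
        unfolding E_def
        by (rule second_order_error_le[OF H(2) norm_frozen_noise_le[OF t] _ \<delta> e a h])
          (use K_nonneg in \<open>auto simp: euler_error_def[OF t] v_def\<close>)
      then show ?thesis unfolding abs_mult using KZ \<omega> by (intro mult_mono) auto
    qed
    have Em: "(\<lambda>\<omega>. Z \<omega> * E h \<omega>) \<in> borel_measurable M"
      unfolding E_def using h0 by measurable
    have Ei: "integrable M (\<lambda>\<omega>. Z \<omega> * E h \<omega>)"
      by (rule Bochner_Integration.integrable_bound[OF bi Em]) (use le in \<open>auto intro!: AE_I2 intro: order_trans[OF _ abs_ge_self]\<close>)
    have "\<bar>\<integral>\<omega>. Z \<omega> * E h \<omega> \<partial>M\<bar> \<le> (\<integral>\<omega>. \<bar>Z \<omega> * E h \<omega>\<bar> \<partial>M)"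
      by (rule integral_abs_bound)
    also have "\<dots> \<le> (\<integral>\<omega>. ?b \<omega> \<partial>M)"
      by (rule integral_mono[OF integrable_abs[OF Ei] bi le])
    also have "\<dots> = KZ * (K * K\<sigma> * a * (\<integral>\<omega>. (?w h \<omega>)\<^sup>2 \<partial>M) + (K * K\<sigma> / a + 3 * K) * (\<integral>\<omega>. (?r h \<omega>)\<^sup>2 \<partial>M)
      + 2 * K\<sigma>\<^sup>2 * ((\<integral>\<omega>. (\<delta> h \<omega>)\<^sup>2 \<partial>M) * h / a + a * (\<integral>\<omega>. (?w h \<omega>) ^ 4 \<partial>M) / h))"
      using w2(1) w4(1) i \<delta>i[OF h0] by simp
    also have "\<dots> \<le> KZ * (K * K\<sigma> * a * (CARD('m) * h) + (K * K\<sigma> / a + 3 * K) * (\<integral>\<omega>. (?r h \<omega>)\<^sup>2 \<partial>M)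
      + 2 * K\<sigma>\<^sup>2 * ((\<integral>\<omega>. (\<delta> h \<omega>)\<^sup>2 \<partial>M) * h / a + a * (3 * (real CARD('m))\<^sup>2 * h\<^sup>2) / h))"
      using w2(2) w4(2) KZ a h K0 K_nonneg
      by (intro mult_left_mono add_mono divide_right_mono) auto
    finally have "\<bar>\<integral>\<omega>. Z \<omega> * E h \<omega> \<partial>M\<bar> / h \<le> KZ * (K * K\<sigma> * a * (CARD('m) * h) + (K * K\<sigma> / a + 3 * K) * (\<integral>\<omega>. (?r h \<omega>)\<^sup>2 \<partial>M)
      + 2 * K\<sigma>\<^sup>2 * ((\<integral>\<omega>. (\<delta> h \<omega>)\<^sup>2 \<partial>M) * h / a + a * (3 * (real CARD('m))\<^sup>2 * h\<^sup>2) / h)) / h"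
      using h by (intro divide_right_mono) auto
    also have "\<dots> = C * a + KZ * (K * K\<sigma> / a + 3 * K) * ((\<integral>\<omega>. (?r h \<omega>)\<^sup>2 \<partial>M) / h)
       + KZ * (2 * K\<sigma>\<^sup>2 / a) * (\<integral>\<omega>. (\<delta> h \<omega>)\<^sup>2 \<partial>M)"
      using h a by (simp add: C_def field_simps power2_eq_square)
    also have "\<dots> \<le> C * a + (L a * ((\<integral>\<omega>. (?r h \<omega>)\<^sup>2 \<partial>M) / h) + L a * (\<integral>\<omega>. (\<delta> h \<omega>)\<^sup>2 \<partial>M))"
    proof -
      have "KZ * (K * K\<sigma> / a + 3 * K) \<le> L a" "KZ * (2 * K\<sigma>\<^sup>2 / a) \<le> L a"
        unfolding L_def using KZ K0 K_nonneg a by (auto intro!: mult_left_mono simp del: times_divide_eq_right)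
      then have "KZ * (K * K\<sigma> / a + 3 * K) * ((\<integral>\<omega>. (?r h \<omega>)\<^sup>2 \<partial>M) / h) \<le> L a * ((\<integral>\<omega>. (?r h \<omega>)\<^sup>2 \<partial>M) / h)"
        "KZ * (2 * K\<sigma>\<^sup>2 / a) * (\<integral>\<omega>. (\<delta> h \<omega>)\<^sup>2 \<partial>M) \<le> L a * (\<integral>\<omega>. (\<delta> h \<omega>)\<^sup>2 \<partial>M)"
        using h by (auto intro!: mult_right_mono simp del: times_divide_eq_right times_divide_eq_left)
      then show ?thesis by linarith
    qed
    finally have "\<bar>\<integral>\<omega>. Z \<omega> * E h \<omega> \<partial>M\<bar> / h \<le> C * a + L a * ((\<integral>\<omega>. (?r h \<omega>)\<^sup>2 \<partial>M) / h + (\<integral>\<omega>. (\<delta> h \<omega>)\<^sup>2 \<partial>M))"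
      by (simp add: distrib_left)
    then show ?thesis using Ei h by simp
  qed
  show "\<forall>\<^sub>F h in at_right 0. integrable M (\<lambda>\<omega>. Z \<omega> * E h \<omega>)"
    using fin by eventually_elim (use main[of _ 1] in auto)
  show "((\<lambda>h. (\<integral>\<omega>. Z \<omega> * E h \<omega> \<partial>M) / h) \<longlongrightarrow> 0) (at_right 0)"
  proof (rule tendsto_zero_if_small[where C=C and K=L])
    show "\<forall>\<^sub>F h in at_right 0. \<bar>(\<integral>\<omega>. Z \<omega> * E h \<omega> \<partial>M) / h\<bar> \<le> C * a + L a * ((\<integral>\<omega>. (?r h \<omega>)\<^sup>2 \<partial>M) / h + (\<integral>\<omega>. (\<delta> h \<omega>)\<^sup>2 \<partial>M))"
      if "0 < a" for a
      using fin by eventually_elim (use main[OF _ _ that] in auto)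
    show "((\<lambda>h. (\<integral>\<omega>. (?r h \<omega>)\<^sup>2 \<partial>M) / h + (\<integral>\<omega>. (\<delta> h \<omega>)\<^sup>2 \<partial>M)) \<longlongrightarrow> 0) (at_right 0)"
      using tendsto_add[OF euler_error_ratio_tendsto[OF t]] \<delta>lim by (simp add: at_right_eq_Ioo)
    show "0 \<le> C" unfolding C_def using KZ K0 K_nonneg by (intro mult_nonneg_nonneg add_nonneg_nonneg) auto
  qed
qed

text \<open>A crude entrywise estimate that also drops the one half in
  \<open>diffusion_matrix\<close>. What matters is independence of \<open>x\<close>, since the bound
  enters \<open>Cku\<close>.\<close>

lemma abs_trace_diffusion_le:
  assumes H: "norm H \<le> K"
  shows "\<bar>trace (diffusion_matrix \<sigma> x ** H)\<bar> \<le> (\<Sum>i\<in>(UNIV::'n set). \<Sum>j\<in>(UNIV::'n set). (\<Sum>p\<in>(UNIV::'m set). K\<sigma> * K\<sigma>) * K)"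
proof -
  have K0: "0 \<le> K" using order_trans[OF norm_ge_zero H] .
  have s: "\<bar>diffusion_matrix \<sigma> x $ i $ j\<bar> \<le> (\<Sum>p\<in>(UNIV::'m set). K\<sigma> * K\<sigma>)" for i j
  proof -
    have "\<bar>\<Sum>p\<in>UNIV. \<sigma> x $ i $ p * \<sigma> x $ j $ p\<bar> \<le> (\<Sum>p\<in>(UNIV::'m set). K\<sigma> * K\<sigma>)"
      by (rule order_trans[OF sum_abs sum_mono])
        (auto simp only: abs_mult intro!: mult_mono order_trans[OF abs_vec_nth_nth_le] \<sigma> K_nonneg abs_ge_zero)
    moreover have "diffusion_matrix \<sigma> x $ i $ j = 1 / 2 * (\<Sum>p\<in>UNIV. \<sigma> x $ i $ p * \<sigma> x $ j $ p)"
      by (simp add: diffusion_matrix_def matrix_matrix_mult_def transpose_def)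
    ultimately show ?thesis by (simp add: abs_mult)
  qed
  have "trace (diffusion_matrix \<sigma> x ** H) = (\<Sum>i\<in>UNIV. \<Sum>j\<in>UNIV. diffusion_matrix \<sigma> x $ i $ j * H $ j $ i)"
    by (simp add: trace_def matrix_matrix_mult_def)
  also have "\<bar>\<dots>\<bar> \<le> (\<Sum>i\<in>(UNIV::'n set). \<Sum>j\<in>(UNIV::'n set). (\<Sum>p\<in>(UNIV::'m set). K\<sigma> * K\<sigma>) * K)"
    by (intro order_trans[OF sum_abs sum_mono] order_trans[OF sum_abs sum_mono] ; simp only: abs_mult)
      (intro mult_mono s order_trans[OF abs_vec_nth_nth_le] H sum_nonneg mult_nonneg_nonneg K_nonneg abs_ge_zero)
  finally show ?thesis .
qed

text \<open>On each path the average over \<open>[t, t + h]\<close> tends to the value at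
  \<open>t\<close>, and the averages are bounded by the product of the bounds on \<open>G\<close>
  and \<open>\<mu>\<close>.\<close>

lemma drift_average_tendsto:
  fixes G :: "'a \<Rightarrow> real^'n"
  assumes t: "0 \<le> t" and G: "G \<in> borel_measurable M" "bounded (G ` space M)"
  shows "((\<lambda>h. (\<integral>\<omega>. G \<omega> \<bullet> integral {t..t + h} (\<lambda>r. \<mu> (X r \<omega>)) \<partial>M) / h) \<longlongrightarrow> (\<integral>\<omega>. G \<omega> \<bullet> \<mu> (X t \<omega>) \<partial>M)) (at_right 0)"
proof -
  obtain KG where KG: "0 < KG" "\<And>\<omega>. \<omega> \<in> space M \<Longrightarrow> norm (G \<omega>) \<le> KG"
    using bounded_pos[THEN iffD1, OF G(2)] by auto
  let ?I = "\<lambda>h \<omega>. integral {t..t + h} (\<lambda>r. \<mu> (X r \<omega>))"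
  have m: "(\<lambda>\<omega>. G \<omega> \<bullet> ?I h \<omega> / h) \<in> borel_measurable M" if "0 < h" for h
  proof -
    have [measurable]: "?I h \<in> borel_measurable M"
      using measurable_F_M[OF _ measurable_integral_X[OF \<mu>(1) t, of "t + h"]] t that by auto
    show ?thesis using G(1) by measurable
  qed
  have b: "\<bar>G \<omega> \<bullet> ?I h \<omega> / h\<bar> \<le> KG * K\<mu>" if h: "0 < h" and \<omega>: "\<omega> \<in> space M" for h \<omega>
  proof -
    have "\<bar>G \<omega> \<bullet> ?I h \<omega>\<bar> \<le> KG * (K\<mu> * h)"
      using norm_integral_X_le[OF \<mu> t _ \<omega>, of "t + h"] KG(1) KG(2)[OF \<omega>] h
      by (intro order_trans[OF Cauchy_Schwarz_ineq2] mult_mono) auto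
    then show ?thesis using h by (simp add: field_simps)
  qed
  have lim: "((\<lambda>h. G \<omega> \<bullet> ?I h \<omega> / h) \<longlongrightarrow> G \<omega> \<bullet> \<mu> (X t \<omega>)) (at_right 0)" if \<omega>: "\<omega> \<in> space M" for \<omega>
  proof -
    have c: "continuous_on S (\<lambda>r. \<mu> (X r \<omega>))" if "S \<subseteq> {0..}" for S
      by (rule continuous_fun_X[OF \<mu>(1) \<omega> that])
    have "((\<lambda>h. (integral {t..t + h} (\<lambda>r. G \<omega> \<bullet> \<mu> (X r \<omega>)) - integral {t..t} (\<lambda>r. G \<omega> \<bullet> \<mu> (X r \<omega>))) / h)
      \<longlongrightarrow> G \<omega> \<bullet> \<mu> (X t \<omega>)) (at_right 0)"
      using t by (intro integral_right_quotient[where b="t + 1"] continuous_intros c) auto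
    moreover have "integral {t..t + h} (\<lambda>r. G \<omega> \<bullet> \<mu> (X r \<omega>)) = G \<omega> \<bullet> ?I h \<omega>" for h
    proof -
      have "(\<lambda>r. \<mu> (X r \<omega>)) integrable_on {t..t + h}"
        using t by (intro integrable_continuous_real c) auto
      from integral_linear[OF this bounded_linear_inner_right[of "G \<omega>"]]
      show ?thesis by (simp add: comp_def)
    qed
    ultimately show ?thesis by simp
  qed
  have "((\<lambda>h. \<integral>\<omega>. G \<omega> \<bullet> ?I h \<omega> / h \<partial>M) \<longlongrightarrow> (\<integral>\<omega>. G \<omega> \<bullet> \<mu> (X t \<omega>) \<partial>M)) (at 0 within {0<..<1})"
  proof (rule bounded_convergence_within[where K="KG * K\<mu>"])
    have [measurable]: "(\<lambda>\<omega>. \<mu> (X t \<omega>)) \<in> borel_measurable M" by (rule measurable_fun_X_M[OF \<mu>(1) t])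
    show "(\<lambda>\<omega>. G \<omega> \<bullet> \<mu> (X t \<omega>)) \<in> borel_measurable M" using G(1) by measurable
  qed (use m b lim in \<open>auto simp: at_right_eq_Ioo intro!: AE_I2\<close>)
  then show ?thesis by (simp add: at_right_eq_Ioo)
qed

lemma dynkin_derivative:
  fixes Z :: "'a \<Rightarrow> real" and \<phi> :: "real^'n \<Rightarrow> real"
  assumes t: "0 \<le> t" and Z: "Z \<in> borel_measurable (F t)" "bounded (Z ` space M)"
    and d1: "\<And>x. \<phi> differentiable (at x)" and d2: "\<And>i x. partial_deriv i \<phi> differentiable (at x)"
    and g: "continuous_on UNIV (grad \<phi>)" "\<And>x. norm (grad \<phi> x) \<le> Kg"
    and H: "continuous_on UNIV (Hess \<phi>)" "\<And>x. norm (Hess \<phi> x) \<le> K"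
  shows "((\<lambda>h. (\<integral>\<omega>. Z \<omega> * (\<phi> (X (t + h) \<omega>) - \<phi> (X t \<omega>)) \<partial>M) / h) \<longlongrightarrow>
    (\<integral>\<omega>. Z \<omega> * (trace (diffusion_matrix \<sigma> (X t \<omega>) ** Hess \<phi> (X t \<omega>)) + \<mu> (X t \<omega>) \<bullet> grad \<phi> (X t \<omega>)) \<partial>M)) (at_right 0)"
proof -
  define G where "G \<omega> = Z \<omega> *\<^sub>R grad \<phi> (X t \<omega>)" for \<omega>
  let ?v = "\<lambda>h \<omega>. X (t + h) \<omega> - X t \<omega>"
  define E where "E h \<omega> = (1 / 2) * (?v h \<omega> \<bullet> (Hess \<phi> (X t \<omega>) *v ?v h \<omega>))
      - (1 / 2) * (frozen_noise t h \<omega> \<bullet> (Hess \<phi> (X t \<omega>) *v frozen_noise t h \<omega>)) + taylor2_error \<phi> (X t \<omega>) (?v h \<omega>)" for h \<omega>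
  let ?Q = "\<lambda>h \<omega>. Z \<omega> * ((1 / 2) * (frozen_noise t h \<omega> \<bullet> (Hess \<phi> (X t \<omega>) *v frozen_noise t h \<omega>)))"
  let ?tr = "\<lambda>\<omega>. Z \<omega> * trace (diffusion_matrix \<sigma> (X t \<omega>) ** Hess \<phi> (X t \<omega>))"
  let ?I = "\<lambda>h \<omega>. integral {t..t + h} (\<lambda>r. \<mu> (X r \<omega>))"
  obtain KZ where KZ: "0 < KZ" "\<And>\<omega>. \<omega> \<in> space M \<Longrightarrow> \<bar>Z \<omega>\<bar> \<le> KZ"
    using bounded_pos[THEN iffD1, OF Z(2)] by auto
  have "norm (G \<omega>) \<le> KZ * Kg" if "\<omega> \<in> space M" for \<omega>
    unfolding G_def using KZ that g(2) by (auto intro!: mult_mono)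
  then have Gb: "bounded (G ` space M)" by (auto simp: bounded_iff)
  have Gm: "G \<in> borel_measurable (F t)"
    unfolding G_def[abs_def] by (intro borel_measurable_scaleR Z measurable_fun_X[OF g(1) t])
  note Zm = measurable_F_M[OF t Z(1)]
  have E: "\<forall>\<^sub>F h in at_right 0. integrable M (\<lambda>\<omega>. Z \<omega> * E h \<omega>)"
    "((\<lambda>h. (\<integral>\<omega>. Z \<omega> * E h \<omega> \<partial>M) / h) \<longlongrightarrow> 0) (at_right 0)"
    unfolding E_def by (rule second_order_remainder_tendsto[OF t Z d1 d2 g(1) H])+
  have "((\<lambda>h. (\<integral>\<omega>. G \<omega> \<bullet> ?I h \<omega> \<partial>M) / h + (\<integral>\<omega>. ?tr \<omega> \<partial>M) + (\<integral>\<omega>. Z \<omega> * E h \<omega> \<partial>M) / h)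
      \<longlongrightarrow> (\<integral>\<omega>. G \<omega> \<bullet> \<mu> (X t \<omega>) \<partial>M) + (\<integral>\<omega>. ?tr \<omega> \<partial>M) + 0) (at_right 0)"
    by (intro tendsto_add tendsto_const E drift_average_tendsto[OF t measurable_F_M[OF t Gm] Gb])
  moreover have "\<forall>\<^sub>F h in at_right 0. (\<integral>\<omega>. G \<omega> \<bullet> ?I h \<omega> \<partial>M) / h + (\<integral>\<omega>. ?tr \<omega> \<partial>M) + (\<integral>\<omega>. Z \<omega> * E h \<omega> \<partial>M) / h
    = (\<integral>\<omega>. Z \<omega> * (\<phi> (X (t + h) \<omega>) - \<phi> (X t \<omega>)) \<partial>M) / h"
    using E(1) euler_error_small[OF t zero_less_one] eventually_at_right_less
  proof eventually_elim
    case (elim h)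
    then have h: "0 < h" "0 \<le> h" by auto
    have i: "integrable M (\<lambda>\<omega>. (norm (euler_error t h \<omega>))\<^sup>2)"
      using elim h integrable_euler_error[OF t, of h "1 * h"] by simp
    have eq: "Z \<omega> * (\<phi> (X (t + h) \<omega>) - \<phi> (X t \<omega>)) = G \<omega> \<bullet> ?v h \<omega> + ?Q h \<omega> + Z \<omega> * E h \<omega>" for \<omega>
      by (simp add: E_def G_def taylor2_error_def algebra_simps)
    have "(\<integral>\<omega>. Z \<omega> * (\<phi> (X (t + h) \<omega>) - \<phi> (X t \<omega>)) \<partial>M)
      = (\<integral>\<omega>. G \<omega> \<bullet> ?v h \<omega> \<partial>M) + (\<integral>\<omega>. ?Q h \<omega> \<partial>M) + (\<integral>\<omega>. Z \<omega> * E h \<omega> \<partial>M)"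
      unfolding eq
      using integrable_inner_increment[OF t Gm Gb h(2) i] integrable_frozen_noise_quadratic[OF t Z h(2) H] elim(1)
      by (simp only: Bochner_Integration.integral_add Bochner_Integration.integrable_add)
    also have "(\<integral>\<omega>. G \<omega> \<bullet> ?v h \<omega> \<partial>M) = (\<integral>\<omega>. G \<omega> \<bullet> ?I h \<omega> \<partial>M)"
      by (rule expectation_inner_increment[OF t Gm Gb h(2) i])
    also have "(\<integral>\<omega>. ?Q h \<omega> \<partial>M) = h * (\<integral>\<omega>. ?tr \<omega> \<partial>M)"
      by (rule expectation_frozen_noise_quadratic[OF t Z h(2) H])
    finally show ?case using h by (simp add: add_divide_distrib)
  qed
  ultimately have "((\<lambda>h. (\<integral>\<omega>. Z \<omega> * (\<phi> (X (t + h) \<omega>) - \<phi> (X t \<omega>)) \<partial>M) / h)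
      \<longlongrightarrow> (\<integral>\<omega>. G \<omega> \<bullet> \<mu> (X t \<omega>) \<partial>M) + (\<integral>\<omega>. ?tr \<omega> \<partial>M) + 0) (at_right 0)"
    by (rule Lim_transform_eventually)
  moreover have "(\<integral>\<omega>. Z \<omega> * (trace (diffusion_matrix \<sigma> (X t \<omega>) ** Hess \<phi> (X t \<omega>)) + \<mu> (X t \<omega>) \<bullet> grad \<phi> (X t \<omega>)) \<partial>M)
    = (\<integral>\<omega>. G \<omega> \<bullet> \<mu> (X t \<omega>) \<partial>M) + (\<integral>\<omega>. ?tr \<omega> \<partial>M) + 0"
  proof -
    have [measurable]: "G \<in> borel_measurable M" "(\<lambda>\<omega>. \<mu> (X t \<omega>)) \<in> borel_measurable M"
      using measurable_F_M[OF t Gm] measurable_fun_X_M[OF \<mu>(1) t] by auto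
    have 1: "integrable M (\<lambda>\<omega>. G \<omega> \<bullet> \<mu> (X t \<omega>))"
    proof (rule integrable_const_bound[where B="KZ * Kg * K\<mu>"])
      show "AE \<omega> in M. norm (G \<omega> \<bullet> \<mu> (X t \<omega>)) \<le> KZ * Kg * K\<mu>"
      proof (rule AE_I2)
        fix \<omega> assume \<omega>: "\<omega> \<in> space M"
        have "norm (G \<omega> \<bullet> \<mu> (X t \<omega>)) \<le> norm (G \<omega>) * norm (\<mu> (X t \<omega>))"
          using Cauchy_Schwarz_ineq2 by simp
        also have "\<dots> \<le> KZ * Kg * K\<mu>"
          using KZ \<omega> g(2) \<mu>(2) order_trans[OF norm_ge_zero g(2)]
          by (intro mult_mono) (auto simp: G_def intro!: mult_mono)
        finally show "norm (G \<omega> \<bullet> \<mu> (X t \<omega>)) \<le> KZ * Kg * K\<mu>" .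
      qed
    qed measurable
    have 2: "integrable M ?tr"
    proof -
      have "continuous_on UNIV (\<lambda>x. trace (diffusion_matrix \<sigma> x ** Hess \<phi> x))"
        unfolding trace_def diffusion_matrix_def matrix_matrix_mult_def transpose_def
        by (simp, intro continuous_intros \<sigma> H, auto)
      from measurable_fun_X_M[OF this t] Zm have m: "?tr \<in> borel_measurable M" by measurable
      show ?thesis
      proof (rule integrable_const_bound[OF _ m])
        show "AE \<omega> in M. norm (?tr \<omega>) \<le> KZ * (\<Sum>i\<in>(UNIV::'n set). \<Sum>j\<in>(UNIV::'n set). (\<Sum>p\<in>(UNIV::'m set). K\<sigma> * K\<sigma>) * K)"
          using KZ by (intro AE_I2) (simp only: real_norm_def abs_mult, intro mult_mono abs_trace_diffusion_le H, auto)
      qed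
    qed
    have "Z \<omega> * (trace (diffusion_matrix \<sigma> (X t \<omega>) ** Hess \<phi> (X t \<omega>)) + \<mu> (X t \<omega>) \<bullet> grad \<phi> (X t \<omega>))
      = G \<omega> \<bullet> \<mu> (X t \<omega>) + ?tr \<omega>" for \<omega>
      by (simp add: G_def algebra_simps inner_commute)
    then show ?thesis using 1 2 by simp
  qed
  ultimately show ?thesis by simp
qed

end

section \<open>The solution of the Cauchy problem along the diffusion\<close>

lemma abs_exp_minus_diff_le: "0 \<le> a \<Longrightarrow> 0 \<le> b \<Longrightarrow> \<bar>exp (- a) - exp (- b)\<bar> \<le> \<bar>a - b\<bar>" for a b :: real
proof (induction a b rule: linorder_wlog)
  case (le a b)
  have "1 - exp (- (b - a)) \<le> b - a"
    using exp_ge_add_one_self[of "- (b - a)"] by linarith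
  then have "exp (- a) * (1 - exp (- (b - a))) \<le> 1 * (b - a)"
    using le by (intro mult_mono) auto
  moreover have "exp (- a) * (1 - exp (- (b - a))) = exp (- a) - exp (- b)"
    by (simp add: right_diff_distrib flip: exp_add)
  ultimately show ?case using le by simp
qed (simp add: abs_minus_commute)

text \<open>\<open>u'\<close> is the time derivative of \<open>u\<close>. Joint continuity is
  demanded of these two, where time and position move together along a path; the space derivatives
  are evaluated at one fixed time and are continuous there.\<close>

locale cauchy_sde = bounded_sde M F W \<mu> \<sigma> \<xi> X K\<mu> K\<sigma>
  for M :: "'a measure" and F and W :: "real \<Rightarrow> 'a \<Rightarrow> real^'m::finite" and \<mu> :: "real^'n::finite \<Rightarrow> real^'n"
    and \<sigma> :: "real^'n \<Rightarrow> real^'m^'n" and \<xi> X K\<mu> K\<sigma> +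
  fixes T :: real and k \<psi> :: "real^'n \<Rightarrow> real" and u u' :: "real \<Rightarrow> real^'n \<Rightarrow> real" and Cu Ct Kg KH :: real
  assumes T: "0 < T" and k: "continuous_on UNIV k" "\<And>x. 0 \<le> k x"
    and u: "continuous_on ({0<..T} \<times> UNIV) (\<lambda>(s, x). u s x)" "\<And>s x. s \<in> {0<..T} \<Longrightarrow> \<bar>u s x\<bar> \<le> Cu"
    and u': "continuous_on ({0<..T} \<times> UNIV) (\<lambda>(s, x). u' s x)" "\<And>s x. s \<in> {0<..T} \<Longrightarrow> \<bar>u' s x\<bar> \<le> Ct"
      "\<And>s x. s \<in> {0<..T} \<Longrightarrow> ((\<lambda>r. u r x) has_real_derivative u' s x) (at s within {0<..T})"
    and d1: "\<And>s x. s \<in> {0<..T} \<Longrightarrow> u s differentiable (at x)"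
    and d2: "\<And>s i x. s \<in> {0<..T} \<Longrightarrow> partial_deriv i (u s) differentiable (at x)"
    and g: "\<And>s. s \<in> {0<..T} \<Longrightarrow> continuous_on UNIV (grad (u s))" "\<And>s x. s \<in> {0<..T} \<Longrightarrow> norm (grad (u s) x) \<le> Kg"
    and H: "\<And>s. s \<in> {0<..T} \<Longrightarrow> continuous_on UNIV (Hess (u s))" "\<And>s x. s \<in> {0<..T} \<Longrightarrow> norm (Hess (u s) x) \<le> KH"
    and pde: "\<And>s x. s \<in> {0<..T} \<Longrightarrow> u' s x + k x * u s x
      = trace (diffusion_matrix \<sigma> x ** Hess (u s) x) + \<mu> x \<bullet> grad (u s) x"
    and initial: "\<And>x. ((\<lambda>s. u s x) \<longlongrightarrow> \<psi> x) (at_right 0)"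
begin

definition Cku :: real where
  "Cku = (\<Sum>i\<in>(UNIV::'n set). \<Sum>j\<in>(UNIV::'n set). (\<Sum>p\<in>(UNIV::'m set). K\<sigma> * K\<sigma>) * KH) + K\<mu> * Kg + Ct"

text \<open>\<open>k\<close> need not be bounded, but by the equation \<open>k u\<close> is.\<close>

lemma abs_k_u_le:
  assumes s: "s \<in> {0<..T}"
  shows "\<bar>k x * u s x\<bar> \<le> Cku"
proof -
  have "\<bar>\<mu> x \<bullet> grad (u s) x\<bar> \<le> K\<mu> * Kg"
    using \<mu>(2) g(2)[OF s] K_nonneg
    by (intro order_trans[OF Cauchy_Schwarz_ineq2] mult_mono) auto
  then show ?thesis
    using pde[OF s, of x] abs_trace_diffusion_le[OF H(2)[OF s, of x], of x] u'(2)[OF s, of x]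
    unfolding Cku_def by linarith
qed

lemma continuous_u: "s \<in> {0<..T} \<Longrightarrow> continuous_on UNIV (u s)"
  using d1 by (intro differentiable_imp_continuous_on) (auto simp: differentiable_on_def)

lemma continuous_u': "s \<in> {0<..T} \<Longrightarrow> continuous_on UNIV (u' s)"
  using continuous_on_compose2[OF u'(1) continuous_on_Pair[OF continuous_on_const[where c=s] continuous_on_id[of UNIV]]]
  by (auto simp: image_subset_iff)

text \<open>The derivative at \<open>T\<close> is one-sided, so the mean value theorem is used with
  derivatives within the closed interval.\<close>

lemma u_time_increment:
  assumes "0 < r" "r < s" "s \<le> T"
  obtains q where "q \<in> {r<..<s}" "u s x - u r x = u' q x * (s - r)"
proof -
  have "\<exists>q\<in>{r<..<s}. u s x - u r x = u' q x * (s - r)"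
  proof (rule mvt_simple[OF assms(2), where f="\<lambda>r. u r x"])
    fix q assume "r \<le> q" "q \<le> s"
    then have "((\<lambda>r. u r x) has_real_derivative u' q x) (at q within {r..s})"
      using assms by (intro DERIV_subset[OF u'(3)]) auto
    then show "((\<lambda>r. u r x) has_derivative (\<lambda>z. u' q x * z)) (at q within {r..s})"
      by (simp add: has_field_derivative_def)
  qed
  then show ?thesis using that by blast
qed

lemma u_space_lipschitz:
  assumes s: "s \<in> {0<..T}"
  shows "\<bar>u s x - u s y\<bar> \<le> Kg * norm (x - y)"
proof -
  have "\<exists>r\<in>{0<..<1}. u s (y + 1 *\<^sub>R (x - y)) - u s (y + 0 *\<^sub>R (x - y))
    = (\<Sum>i\<in>UNIV. (x - y) $ i * partial_deriv i (u s) (y + r *\<^sub>R (x - y))) * (1 - 0)"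
  proof (rule mvt_simple[where f="\<lambda>r. u s (y + r *\<^sub>R (x - y))"])
    fix r :: real
    have "((\<lambda>r. u s (y + r *\<^sub>R (x - y))) has_real_derivative
        (\<Sum>i\<in>UNIV. (x - y) $ i * partial_deriv i (u s) (y + r *\<^sub>R (x - y)))) (at r within {0..1})"
      by (rule has_field_derivative_at_within[OF has_real_derivative_along_line[OF d1[OF s]]])
    then show "((\<lambda>r. u s (y + r *\<^sub>R (x - y))) has_derivative
        (*) (\<Sum>i\<in>UNIV. (x - y) $ i * partial_deriv i (u s) (y + r *\<^sub>R (x - y)))) (at r within {0..1})"
      by (simp only: has_field_derivative_def)
  qed simp
  then obtain r where "u s x - u s y = (\<Sum>i\<in>UNIV. (x - y) $ i * partial_deriv i (u s) (y + r *\<^sub>R (x - y)))"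
    by auto
  also have "\<dots> = grad (u s) (y + r *\<^sub>R (x - y)) \<bullet> (x - y)"
    by (simp add: grad_def inner_vec_def mult.commute)
  also have "\<bar>\<dots>\<bar> \<le> Kg * norm (x - y)"
    using g(2)[OF s] by (intro order_trans[OF Cauchy_Schwarz_ineq2] mult_right_mono) auto
  finally show ?thesis .
qed

text \<open>The time of \<open>u\<close> runs backwards along the path: \<open>T - t\<close> is the
  time that remains. Facts about \<open>w t\<close> are restricted to \<open>t < T\<close>, because
  at \<open>T\<close> the function is evaluated at time 0, outside the range of the regularity
  assumptions.\<close>

definition w :: "real \<Rightarrow> 'a \<Rightarrow> real" where
  "w t \<omega> = u (T - t) (X t \<omega>)"

lemma measurable_w: "0 \<le> t \<Longrightarrow> t < T \<Longrightarrow> w t \<in> borel_measurable M"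
  unfolding w_def[abs_def] by (intro measurable_fun_X_M continuous_u) auto

lemma abs_w_le: "0 \<le> t \<Longrightarrow> t < T \<Longrightarrow> \<bar>w t \<omega>\<bar> \<le> Cu"
  unfolding w_def by (intro u) auto

lemma abs_k_w_le: "0 \<le> t \<Longrightarrow> t < T \<Longrightarrow> \<bar>k (X t \<omega>) * w t \<omega>\<bar> \<le> Cku"
  unfolding w_def by (intro abs_k_u_le) auto

lemma continuous_w:
  assumes "\<omega> \<in> space M"
  shows "continuous_on {0..<T} (\<lambda>t. w t \<omega>)"
proof -
  have "continuous_on {0..<T} (\<lambda>t. (T - t, X t \<omega>))"
    by (intro continuous_intros continuous_X assms) auto
  from continuous_on_compose2[OF u(1) this] show ?thesis by (auto simp: w_def image_subset_iff)
qed

lemma tendsto_w_right: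
  assumes "0 \<le> t" "t < T" "\<omega> \<in> space M"
  shows "((\<lambda>h. w (t + h) \<omega>) \<longlongrightarrow> w t \<omega>) (at_right 0)"
proof -
  have "((\<lambda>r. w r \<omega>) \<longlongrightarrow> w t \<omega>) (at t within {0..<T})"
    using continuous_w[OF assms(3)] assms by (auto simp: continuous_on_def)
  then have "((\<lambda>r. w r \<omega>) \<longlongrightarrow> w t \<omega>) (at t within {t<..<T})"
    by (rule tendsto_within_subset) (use assms in auto)
  then show ?thesis
    using assms by (simp add: at_right_eq_Ioo) (subst (asm) filterlim_at_right_to_0, simp add: add.commute)
qed

text \<open>The time increment is taken at the moved point \<open>X (t + h)\<close>, so that the
  remaining space increment has \<open>u\<close> frozen at \<open>T - t\<close>, as
  \<open>dynkin_derivative\<close> requires. By the mean value theorem the quotient is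
  \<open>- u'\<close> at an intermediate time, and joint continuity gives the limit.\<close>

lemma time_part_derivative:
  fixes Z :: "'a \<Rightarrow> real"
  assumes t: "0 \<le> t" "t < T" and Z: "Z \<in> borel_measurable M" "bounded (Z ` space M)"
  shows "((\<lambda>h. (\<integral>\<omega>. Z \<omega> * (w (t + h) \<omega> - u (T - t) (X (t + h) \<omega>)) \<partial>M) / h) \<longlongrightarrow>
    (\<integral>\<omega>. Z \<omega> * - u' (T - t) (X t \<omega>) \<partial>M)) (at_right 0)"
proof -
  obtain KZ where KZ: "0 < KZ" "\<And>\<omega>. \<omega> \<in> space M \<Longrightarrow> \<bar>Z \<omega>\<bar> \<le> KZ"
    using bounded_pos[THEN iffD1, OF Z(2)] by auto
  let ?q = "\<lambda>h \<omega>. (w (t + h) \<omega> - u (T - t) (X (t + h) \<omega>)) / h"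
  have q: "\<exists>r\<in>{T - t - h<..<T - t}. ?q h \<omega> = - u' r (X (t + h) \<omega>)" if h: "h \<in> {0<..<T - t}" for h \<omega>
  proof -
    obtain r where r: "r \<in> {T - t - h<..<T - t}"
      "u (T - t) (X (t + h) \<omega>) - u (T - t - h) (X (t + h) \<omega>) = u' r (X (t + h) \<omega>) * (T - t - (T - t - h))"
      by (rule u_time_increment[of "T - t - h" "T - t"]) (use h t in auto)
    then have "w (t + h) \<omega> - u (T - t) (X (t + h) \<omega>) = - u' r (X (t + h) \<omega>) * h"
      by (simp add: w_def diff_diff_eq)
    then have "?q h \<omega> = - u' r (X (t + h) \<omega>)" using h by simp
    then show ?thesis using r by blast
  qed
  have "((\<lambda>h. \<integral>\<omega>. Z \<omega> * ?q h \<omega> \<partial>M) \<longlongrightarrow> (\<integral>\<omega>. Z \<omega> * - u' (T - t) (X t \<omega>) \<partial>M)) (at 0 within {0<..<T - t})"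
  proof (rule bounded_convergence_within[where K="KZ * Ct"])
    fix h assume h: "h \<in> {0<..<T - t} - {0}"
    have [measurable]: "w (t + h) \<in> borel_measurable M" "(\<lambda>\<omega>. u (T - t) (X (t + h) \<omega>)) \<in> borel_measurable M"
      using h t by (auto intro!: measurable_w measurable_fun_X_M continuous_u)
    show "(\<lambda>\<omega>. Z \<omega> * ?q h \<omega>) \<in> borel_measurable M" using Z(1) by measurable
    show "AE \<omega> in M. \<bar>Z \<omega> * ?q h \<omega>\<bar> \<le> KZ * Ct"
    proof (rule AE_I2)
      fix \<omega> assume \<omega>: "\<omega> \<in> space M"
      obtain r where "r \<in> {T - t - h<..<T - t}" "?q h \<omega> = - u' r (X (t + h) \<omega>)" using q[of h \<omega>] h by auto
      then have "\<bar>?q h \<omega>\<bar> \<le> Ct" using u'(2)[of r "X (t + h) \<omega>"] t h by simp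
      then show "\<bar>Z \<omega> * ?q h \<omega>\<bar> \<le> KZ * Ct"
        unfolding abs_mult using KZ \<omega> by (intro mult_mono) auto
    qed
  next
    show "(\<lambda>\<omega>. Z \<omega> * - u' (T - t) (X t \<omega>)) \<in> borel_measurable M"
      using t by (intro borel_measurable_times Z borel_measurable_uminus measurable_fun_X_M continuous_u') auto
  next
    fix \<omega> assume \<omega>: "\<omega> \<in> space M"
    \<comment> \<open>The intermediate times are chosen for one fixed path. Only the quotient itself
      is integrated, so how they depend on \<open>\<omega>\<close> does not matter.\<close>
    have "\<forall>h. \<exists>r. h \<in> {0<..<T - t} \<longrightarrow> r \<in> {T - t - h<..<T - t} \<and> ?q h \<omega> = - u' r (X (t + h) \<omega>)"
      using q by blast
    then obtain r where r: "\<And>h. h \<in> {0<..<T - t} \<Longrightarrow> r h \<in> {T - t - h<..<T - t} \<and> ?q h \<omega> = - u' (r h) (X (t + h) \<omega>)"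
      by metis
    have ev: "\<forall>\<^sub>F h in at_right 0. h \<in> {0<..<T - t}"
      using t by (intro eventually_at_right_real) auto
    have "((\<lambda>h. T - t - h) \<longlongrightarrow> T - t - 0) (at_right 0)" by (intro tendsto_intros)
    then have r0: "(r \<longlongrightarrow> T - t) (at_right 0)"
      by (intro tendsto_sandwich[of "\<lambda>h. T - t - h" r _ "\<lambda>_. T - t"])
        (use r in \<open>auto intro!: eventually_mono[OF ev] less_imp_le\<close>)
    have "((\<lambda>h. (\<lambda>(s, x). u' s x) (r h, X (t + h) \<omega>)) \<longlongrightarrow> (\<lambda>(s, x). u' s x) (T - t, X t \<omega>)) (at_right 0)"
    proof (rule continuous_on_tendsto_compose[OF u'(1)])
      show "((\<lambda>h. (r h, X (t + h) \<omega>)) \<longlongrightarrow> (T - t, X t \<omega>)) (at_right 0)"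
        by (intro tendsto_Pair r0 tendsto_X_right t \<omega>)
      show "\<forall>\<^sub>F h in at_right 0. (r h, X (t + h) \<omega>) \<in> {0<..T} \<times> UNIV"
        using ev
      proof eventually_elim
        case (elim h)
        then show ?case using r[of h] t by auto
      qed
    qed (use t in auto)
    then have "((\<lambda>h. - u' (r h) (X (t + h) \<omega>)) \<longlongrightarrow> - u' (T - t) (X t \<omega>)) (at_right 0)"
      by (auto intro: tendsto_minus)
    then have "((\<lambda>h. ?q h \<omega>) \<longlongrightarrow> - u' (T - t) (X t \<omega>)) (at_right 0)"
      by (rule Lim_transform_eventually) (use r in \<open>auto intro!: eventually_mono[OF ev]\<close>)
    then show "((\<lambda>h. Z \<omega> * ?q h \<omega>) \<longlongrightarrow> Z \<omega> * - u' (T - t) (X t \<omega>)) (at 0 within {0<..<T - t})"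
      using t by (simp only: at_right_eq_Ioo diff_gt_0_iff_gt) (intro tendsto_mult tendsto_const)
  qed
  then show ?thesis using t by (simp add: at_right_eq_Ioo)
qed

text \<open>Time and space parts add up to \<open>- u'\<close> plus the generator applied to
  \<open>u\<close>, which the equation turns into \<open>k u\<close>.\<close>

lemma w_derivative:
  fixes Z :: "'a \<Rightarrow> real"
  assumes t: "0 \<le> t" "t < T" and Z: "Z \<in> borel_measurable (F t)" "bounded (Z ` space M)"
  shows "((\<lambda>h. (\<integral>\<omega>. Z \<omega> * (w (t + h) \<omega> - w t \<omega>) \<partial>M) / h) \<longlongrightarrow> (\<integral>\<omega>. Z \<omega> * (k (X t \<omega>) * w t \<omega>) \<partial>M)) (at_right 0)"
proof -
  obtain KZ where KZ: "0 < KZ" "\<And>\<omega>. \<omega> \<in> space M \<Longrightarrow> \<bar>Z \<omega>\<bar> \<le> KZ"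
    using bounded_pos[THEN iffD1, OF Z(2)] by auto
  have Tt: "T - t \<in> {0<..T}" using t by auto
  note Zm = measurable_F_M[OF t(1) Z(1)]
  have bi: "integrable M (\<lambda>\<omega>. Z \<omega> * Y \<omega>)" if "Y \<in> borel_measurable M" "\<And>\<omega>. \<bar>Y \<omega>\<bar> \<le> C" for Y C
  proof (rule integrable_const_bound[where B="KZ * C"])
    show "AE \<omega> in M. norm (Z \<omega> * Y \<omega>) \<le> KZ * C"
      using KZ that(2) order_trans[OF abs_ge_zero that(2)]
      by (intro AE_I2) (auto simp: abs_mult intro!: mult_mono)
  qed (use that Zm in measurable)
  let ?L = "\<lambda>x. trace (diffusion_matrix \<sigma> x ** Hess (u (T - t)) x) + \<mu> x \<bullet> grad (u (T - t)) x"
  have "((\<lambda>h. (\<integral>\<omega>. Z \<omega> * (w (t + h) \<omega> - u (T - t) (X (t + h) \<omega>)) \<partial>M) / h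
      + (\<integral>\<omega>. Z \<omega> * (u (T - t) (X (t + h) \<omega>) - u (T - t) (X t \<omega>)) \<partial>M) / h) \<longlongrightarrow>
      (\<integral>\<omega>. Z \<omega> * - u' (T - t) (X t \<omega>) \<partial>M) + (\<integral>\<omega>. Z \<omega> * ?L (X t \<omega>) \<partial>M)) (at_right 0)"
    by (intro tendsto_add time_part_derivative[OF t Zm Z(2)]
        dynkin_derivative[OF t(1) Z d1[OF Tt] d2[OF Tt] g(1)[OF Tt] g(2)[OF Tt] H(1)[OF Tt] H(2)[OF Tt]])
  moreover have "\<forall>\<^sub>F h in at_right 0. (\<integral>\<omega>. Z \<omega> * (w (t + h) \<omega> - u (T - t) (X (t + h) \<omega>)) \<partial>M) / h
      + (\<integral>\<omega>. Z \<omega> * (u (T - t) (X (t + h) \<omega>) - u (T - t) (X t \<omega>)) \<partial>M) / h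
    = (\<integral>\<omega>. Z \<omega> * (w (t + h) \<omega> - w t \<omega>) \<partial>M) / h"
  proof -
    have "\<forall>\<^sub>F h in at_right 0. h \<in> {0<..<T - t}"
      using t by (intro eventually_at_right_real) auto
    then show ?thesis
    proof eventually_elim
      case (elim h)
      have m: "w (t + h) \<in> borel_measurable M" "(\<lambda>\<omega>. u (T - t) (X (t + h) \<omega>)) \<in> borel_measurable M"
        "(\<lambda>\<omega>. u (T - t) (X t \<omega>)) \<in> borel_measurable M"
        using elim t by (auto intro!: measurable_w measurable_fun_X_M continuous_u)
      have 1: "integrable M (\<lambda>\<omega>. Z \<omega> * (w (t + h) \<omega> - u (T - t) (X (t + h) \<omega>)))"
        using abs_w_le[of "t + h"] u(2)[OF Tt] elim t
        by (intro bi[of _ "Cu + Cu"] borel_measurable_diff m order_trans[OF abs_triangle_ineq4 add_mono]) auto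
      have 2: "integrable M (\<lambda>\<omega>. Z \<omega> * (u (T - t) (X (t + h) \<omega>) - u (T - t) (X t \<omega>)))"
        using u(2)[OF Tt]
        by (intro bi[of _ "Cu + Cu"] borel_measurable_diff m order_trans[OF abs_triangle_ineq4 add_mono]) auto
      show ?case
        unfolding add_divide_distrib[symmetric] Bochner_Integration.integral_add[OF 1 2, symmetric]
        by (simp add: w_def right_diff_distrib)
    qed
  qed
  ultimately have "((\<lambda>h. (\<integral>\<omega>. Z \<omega> * (w (t + h) \<omega> - w t \<omega>) \<partial>M) / h) \<longlongrightarrow>
      (\<integral>\<omega>. Z \<omega> * - u' (T - t) (X t \<omega>) \<partial>M) + (\<integral>\<omega>. Z \<omega> * ?L (X t \<omega>) \<partial>M)) (at_right 0)"
    by (rule Lim_transform_eventually)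
  also have "(\<integral>\<omega>. Z \<omega> * - u' (T - t) (X t \<omega>) \<partial>M) + (\<integral>\<omega>. Z \<omega> * ?L (X t \<omega>) \<partial>M) = (\<integral>\<omega>. Z \<omega> * (k (X t \<omega>) * w t \<omega>) \<partial>M)"
  proof -
    have L: "?L x = u' (T - t) x + k x * u (T - t) x" for x
      using pde[OF Tt] by simp
    have 1: "integrable M (\<lambda>\<omega>. Z \<omega> * - u' (T - t) (X t \<omega>))"
      using u'(2)[OF Tt] t by (intro bi[of _ Ct] borel_measurable_uminus measurable_fun_X_M continuous_u') auto
    have 2: "integrable M (\<lambda>\<omega>. Z \<omega> * (u' (T - t) (X t \<omega>) + k (X t \<omega>) * u (T - t) (X t \<omega>)))"
      using u'(2)[OF Tt] abs_k_u_le[OF Tt] t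
      by (intro bi[of _ "Ct + Cku"] borel_measurable_add borel_measurable_times measurable_fun_X_M continuous_u' continuous_u k
          order_trans[OF abs_triangle_ineq add_mono]) auto
    show ?thesis
      unfolding L Bochner_Integration.integral_add[OF 1 2, symmetric] by (simp add: w_def algebra_simps)
  qed
  finally show ?thesis .
qed

end

section \<open>The Feynman-Kac identity\<close>

context cauchy_sde
begin

definition kt :: "nat \<Rightarrow> real^'n \<Rightarrow> real" where
  "kt n x = min (k x) (real n)"

definition discount :: "nat \<Rightarrow> real \<Rightarrow> 'a \<Rightarrow> real" where
  "discount n t \<omega> = exp (- integral {0..t} (\<lambda>r. kt n (X r \<omega>)))"

lemma kt: "continuous_on UNIV (kt n)" "0 \<le> kt n x" "\<bar>kt n x\<bar> \<le> n" "kt n x \<le> k x"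
  using k by (auto simp: kt_def[abs_def] intro!: continuous_intros)

lemma integral_kt_nonneg: "\<omega> \<in> space M \<Longrightarrow> 0 \<le> s \<Longrightarrow> 0 \<le> integral {s..t} (\<lambda>r. kt n (X r \<omega>))"
  by (intro integral_nonneg integrable_continuous_real continuous_fun_X kt) auto

lemma discount_bounds: "\<omega> \<in> space M \<Longrightarrow> 0 \<le> discount n t \<omega>" "\<omega> \<in> space M \<Longrightarrow> discount n t \<omega> \<le> 1"
  using integral_kt_nonneg by (auto simp: discount_def)

lemma measurable_discount: "0 \<le> t \<Longrightarrow> discount n t \<in> borel_measurable (F t)"
  unfolding discount_def[abs_def]
  using measurable_integral_X[OF kt(1), of 0 t] by measurable

lemma measurable_discount_M: "0 \<le> t \<Longrightarrow> discount n t \<in> borel_measurable M"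
  using measurable_discount measurable_F_M by blast

text \<open>The constant is the same for all paths. This is the purpose of truncating
  \<open>k\<close>: it bounds the difference quotients in
  \<open>discounted_right_derivative\<close>.\<close>

lemma discount_lipschitz:
  assumes "0 \<le> t" "0 \<le> h" and \<omega>: "\<omega> \<in> space M"
  shows "\<bar>discount n (t + h) \<omega> - discount n t \<omega>\<bar> \<le> n * h"
proof -
  have "integral {0..t} (\<lambda>r. kt n (X r \<omega>)) + integral {t..t + h} (\<lambda>r. kt n (X r \<omega>)) = integral {0..t + h} (\<lambda>r. kt n (X r \<omega>))"
    using assms by (intro Henstock_Kurzweil_Integration.integral_combine integrable_continuous_real continuous_fun_X kt) auto
  moreover have "norm (integral {t..t + h} (\<lambda>r. kt n (X r \<omega>))) \<le> n * (t + h - t)"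
    using assms by (intro norm_integral_X_le kt) (auto intro: kt)
  moreover have "\<bar>discount n (t + h) \<omega> - discount n t \<omega>\<bar>
      \<le> \<bar>integral {0..t + h} (\<lambda>r. kt n (X r \<omega>)) - integral {0..t} (\<lambda>r. kt n (X r \<omega>))\<bar>"
    unfolding discount_def using assms by (intro abs_exp_minus_diff_le integral_kt_nonneg) auto
  ultimately show ?thesis by simp
qed

lemma discount_right_quotient:
  assumes "0 \<le> t" and \<omega>: "\<omega> \<in> space M"
  shows "((\<lambda>h. (discount n (t + h) \<omega> - discount n t \<omega>) / h) \<longlongrightarrow> - (discount n t \<omega> * kt n (X t \<omega>))) (at_right 0)"
proof (rule DERIV_right_quotient[where a=0 and b="t + 1"])
  have "((\<lambda>u. integral {0..u} (\<lambda>r. kt n (X r \<omega>))) has_real_derivative kt n (X t \<omega>)) (at t within {0..t + 1})"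
    using assms by (intro integral_has_real_derivative continuous_fun_X kt) auto
  then show "((\<lambda>t. discount n t \<omega>) has_real_derivative - (discount n t \<omega> * kt n (X t \<omega>))) (at t within {0..t + 1})"
    unfolding discount_def by (auto intro!: derivative_eq_intros)
qed (use assms in auto)

lemma continuous_discount:
  assumes \<omega>: "\<omega> \<in> space M"
  shows "continuous_on {0..t} (\<lambda>t. discount n t \<omega>)"
  unfolding discount_def
  by (intro continuous_intros indefinite_integral_continuous_1 integrable_continuous_real continuous_fun_X kt \<omega>) auto

text \<open>On a compact time interval \<open>k\<close> is bounded along a continuous path, so the
  truncation is inactive from some index on. The index depends on the path.\<close>

lemma kt_eventually_eq:
  assumes \<omega>: "\<omega> \<in> space M"
  obtains N where "\<And>n s. N \<le> n \<Longrightarrow> s \<in> {0..t} \<Longrightarrow> kt n (X s \<omega>) = k (X s \<omega>)"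
proof -
  have "compact ((\<lambda>s. k (X s \<omega>)) ` {0..t})"
    by (intro compact_continuous_image continuous_fun_X k \<omega>) auto
  then have "\<exists>B. \<forall>s\<in>{0..t}. \<bar>k (X s \<omega>)\<bar> \<le> B"
    by (auto simp: bounded_iff dest!: compact_imp_bounded)
  then obtain B where B: "\<And>s. s \<in> {0..t} \<Longrightarrow> \<bar>k (X s \<omega>)\<bar> \<le> B"
    by blast
  obtain N :: nat where N: "B \<le> real N" using real_arch_simple by blast
  have "kt n (X s \<omega>) = k (X s \<omega>)" if "N \<le> n" "s \<in> {0..t}" for n s
    using B[OF that(2)] N that(1) by (auto simp: kt_def min_def)
  then show ?thesis using that by blast
qed

text \<open>The initial value is attained pointwise in space, while along the path time and position
  change together. The Lipschitz bound first replaces \<open>X t\<close> by \<open>X T\<close>; then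
  the pointwise limit applies.\<close>

lemma tendsto_w_T:
  assumes \<omega>: "\<omega> \<in> space M"
  shows "((\<lambda>t. w t \<omega>) \<longlongrightarrow> \<psi> (X T \<omega>)) (at T within {0..<T})"
proof -
  have X: "((\<lambda>t. X t \<omega>) \<longlongrightarrow> X T \<omega>) (at T within {0..<T})"
    using continuous_X[OF \<omega>, of "{0..T}"] T
    by (auto simp: continuous_on_def intro: tendsto_within_subset[of _ _ T "{0..T}"])
  have "((\<lambda>t. Kg * norm (X t \<omega> - X T \<omega>)) \<longlongrightarrow> Kg * norm (X T \<omega> - X T \<omega>)) (at T within {0..<T})"
    by (intro tendsto_intros X)
  then have 0: "((\<lambda>t. Kg * norm (X t \<omega> - X T \<omega>)) \<longlongrightarrow> 0) (at T within {0..<T})" by simp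
  have ev: "\<forall>\<^sub>F t in at T within {0..<T}. t \<in> {0..<T}"
    by (simp add: eventually_at_filter)
  have 1: "((\<lambda>t. w t \<omega> - u (T - t) (X T \<omega>)) \<longlongrightarrow> 0) (at T within {0..<T})"
  proof (rule Lim_null_comparison[OF _ 0])
    show "\<forall>\<^sub>F t in at T within {0..<T}. norm (w t \<omega> - u (T - t) (X T \<omega>)) \<le> Kg * norm (X t \<omega> - X T \<omega>)"
      using ev
    proof eventually_elim
      case (elim t)
      then show ?case using u_space_lipschitz[of "T - t" "X t \<omega>" "X T \<omega>"] by (simp add: w_def)
    qed
  qed
  have "((\<lambda>t. T - t) \<longlongrightarrow> T - T) (at T within {0..<T})" by (intro tendsto_intros)
  then have "filterlim (\<lambda>t. T - t) (at_right 0) (at T within {0..<T})"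
    by (simp add: filterlim_at eventually_at_filter)
  from filterlim_compose[OF initial this]
  have "((\<lambda>t. u (T - t) (X T \<omega>)) \<longlongrightarrow> \<psi> (X T \<omega>)) (at T within {0..<T})" .
  from tendsto_add[OF 1 this] show ?thesis by simp
qed

text \<open>Measurability of \<open>\<psi>\<close> is derived: it is the pointwise limit of the
  continuous functions \<open>u (T / Suc n)\<close>.\<close>

lemma measurable_\<psi>_X: "(\<lambda>\<omega>. \<psi> (X T \<omega>)) \<in> borel_measurable M"
proof (rule borel_measurable_LIMSEQ_real)
  show "(\<lambda>\<omega>. u (T / Suc n) (X T \<omega>)) \<in> borel_measurable M" for n
    using T by (intro measurable_fun_X_M continuous_u) (auto simp: field_simps)
  have "(\<lambda>n. T * inverse (real (Suc n))) \<longlonglongrightarrow> T * 0"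
    by (intro tendsto_mult tendsto_const LIMSEQ_inverse_real_of_nat)
  then have "filterlim (\<lambda>n. T / Suc n) (at_right 0) sequentially"
    using T by (simp add: filterlim_at divide_inverse)
  from filterlim_compose[OF initial this]
  show "(\<lambda>n. u (T / Suc n) (X T \<omega>)) \<longlonglongrightarrow> \<psi> (X T \<omega>)" for \<omega> .
qed

lemma measurable_exp_integral_k: "0 \<le> t \<Longrightarrow> (\<lambda>\<omega>. exp (- integral {0..t} (\<lambda>r. k (X r \<omega>)))) \<in> borel_measurable M"
  using measurable_F_M[OF _ measurable_integral_X[OF k(1) order.refl]] by measurable

lemma exp_integral_k_le_1: "\<omega> \<in> space M \<Longrightarrow> exp (- integral {0..t} (\<lambda>r. k (X r \<omega>))) \<le> 1"
  by (auto intro!: integral_nonneg integrable_continuous_real continuous_fun_X k)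

lemma abs_\<psi>_le: "\<bar>\<psi> x\<bar> \<le> Cu"
proof (rule tendsto_upperbound)
  show "((\<lambda>s. \<bar>u s x\<bar>) \<longlongrightarrow> \<bar>\<psi> x\<bar>) (at_right 0)" by (intro tendsto_rabs initial)
  have "\<forall>\<^sub>F s in at_right 0. s \<in> {0<..<T}" using T by (rule eventually_at_right_real)
  then show "\<forall>\<^sub>F s in at_right 0. \<bar>u s x\<bar> \<le> Cu"
    by eventually_elim (auto intro: u)
qed simp

context
  fixes G :: "'a \<Rightarrow> real" and KG :: real
  assumes G: "G \<in> borel_measurable (F 0)" and KG: "0 < KG" "\<And>\<omega>. \<omega> \<in> space M \<Longrightarrow> \<bar>G \<omega>\<bar> \<le> KG"
begin

lemma measurable_G_M: "G \<in> borel_measurable M"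
  using measurable_F_M[OF order.refl G] .

lemma abs_G_discount_le:
  assumes "\<omega> \<in> space M" "\<bar>y\<bar> \<le> C"
  shows "\<bar>G \<omega> * (discount n t \<omega> * y)\<bar> \<le> KG * C"
proof -
  have "\<bar>discount n t \<omega>\<bar> * \<bar>y\<bar> \<le> 1 * C"
    using discount_bounds[OF assms(1)] assms(2) by (intro mult_mono) auto
  then show ?thesis
    unfolding abs_mult using KG(1) KG(2)[OF assms(1)] by (intro mult_mono) auto
qed

text \<open>A product rule: the increment of the discount factor is paired with
  \<open>w (t + h)\<close> and differentiated path by path, the increment of \<open>w\<close> is
  weighted by \<open>G\<close> times the discount factor at \<open>t\<close> and handled by
  \<open>w_derivative\<close>. The contributions \<open>- kt n\<close> and \<open>k\<close> leave
  the truncation error.\<close>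

lemma discounted_right_derivative:
  assumes t: "0 \<le> t" "t < T"
  shows "((\<lambda>h. ((\<integral>\<omega>. G \<omega> * (discount n (t + h) \<omega> * w (t + h) \<omega>) \<partial>M) - (\<integral>\<omega>. G \<omega> * (discount n t \<omega> * w t \<omega>) \<partial>M)) / h) \<longlongrightarrow>
    (\<integral>\<omega>. G \<omega> * (discount n t \<omega> * ((k (X t \<omega>) - kt n (X t \<omega>)) * w t \<omega>)) \<partial>M)) (at_right 0)"
proof -
  let ?q = "\<lambda>h \<omega>. G \<omega> * ((discount n (t + h) \<omega> - discount n t \<omega>) / h * w (t + h) \<omega>)"
  have Cu: "0 \<le> Cu" using order_trans[OF abs_ge_zero abs_w_le[OF t]] .
  have Z: "(\<lambda>\<omega>. G \<omega> * discount n t \<omega>) \<in> borel_measurable (F t)"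
    using measurable_F_mono[OF order.refl t(1) G] measurable_discount[OF t(1)] by measurable
  have Zb: "bounded ((\<lambda>\<omega>. G \<omega> * discount n t \<omega>) ` space M)"
    unfolding bounded_iff using abs_G_discount_le[where y=1 and C=1 and n=n and t=t] by auto
  have 1: "((\<lambda>h. \<integral>\<omega>. ?q h \<omega> \<partial>M) \<longlongrightarrow> (\<integral>\<omega>. G \<omega> * (- (discount n t \<omega> * kt n (X t \<omega>)) * w t \<omega>) \<partial>M)) (at 0 within {0<..<T - t})"
  proof (rule bounded_convergence_within[where K="KG * (n * Cu)"])
    fix h assume h: "h \<in> {0<..<T - t} - {0}"
    have [measurable]: "w (t + h) \<in> borel_measurable M" "discount n (t + h) \<in> borel_measurable M" "discount n t \<in> borel_measurable M"
      using h t by (auto intro!: measurable_w measurable_discount_M)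
    show "?q h \<in> borel_measurable M" using measurable_G_M by measurable
    show "AE \<omega> in M. \<bar>?q h \<omega>\<bar> \<le> KG * (n * Cu)"
    proof (rule AE_I2)
      fix \<omega> assume \<omega>: "\<omega> \<in> space M"
      have "\<bar>(discount n (t + h) \<omega> - discount n t \<omega>) / h\<bar> \<le> n"
        using discount_lipschitz[OF t(1) _ \<omega>, of h n] h by (simp add: field_simps)
      then have "\<bar>(discount n (t + h) \<omega> - discount n t \<omega>) / h * w (t + h) \<omega>\<bar> \<le> n * Cu"
        unfolding abs_mult using abs_w_le[of "t + h" \<omega>] t h by (intro mult_mono) auto
      then show "\<bar>?q h \<omega>\<bar> \<le> KG * (n * Cu)"
        unfolding abs_mult[of "G \<omega>"] using KG(1) KG(2)[OF \<omega>] by (intro mult_mono) auto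
    qed
  next
    have [measurable]: "w t \<in> borel_measurable M" "discount n t \<in> borel_measurable M" "(\<lambda>\<omega>. kt n (X t \<omega>)) \<in> borel_measurable M"
      using t by (auto intro!: measurable_w measurable_discount_M measurable_fun_X_M kt)
    show "(\<lambda>\<omega>. G \<omega> * (- (discount n t \<omega> * kt n (X t \<omega>)) * w t \<omega>)) \<in> borel_measurable M"
      using measurable_G_M by measurable
  next
    fix \<omega> assume \<omega>: "\<omega> \<in> space M"
    show "((\<lambda>h. ?q h \<omega>) \<longlongrightarrow> G \<omega> * (- (discount n t \<omega> * kt n (X t \<omega>)) * w t \<omega>)) (at 0 within {0<..<T - t})"
      using t by (simp only: at_right_eq_Ioo diff_gt_0_iff_gt)
        (intro tendsto_mult tendsto_const discount_right_quotient tendsto_w_right t \<omega>)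
  qed
  have "((\<lambda>h. (\<integral>\<omega>. ?q h \<omega> \<partial>M) + (\<integral>\<omega>. G \<omega> * discount n t \<omega> * (w (t + h) \<omega> - w t \<omega>) \<partial>M) / h) \<longlongrightarrow>
     (\<integral>\<omega>. G \<omega> * (- (discount n t \<omega> * kt n (X t \<omega>)) * w t \<omega>) \<partial>M) + (\<integral>\<omega>. G \<omega> * discount n t \<omega> * (k (X t \<omega>) * w t \<omega>) \<partial>M)) (at_right 0)"
    using 1 t by (intro tendsto_add w_derivative[OF t Z Zb]) (simp add: at_right_eq_Ioo)
  moreover have "\<forall>\<^sub>F h in at_right 0. (\<integral>\<omega>. ?q h \<omega> \<partial>M) + (\<integral>\<omega>. G \<omega> * discount n t \<omega> * (w (t + h) \<omega> - w t \<omega>) \<partial>M) / h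
    = ((\<integral>\<omega>. G \<omega> * (discount n (t + h) \<omega> * w (t + h) \<omega>) \<partial>M) - (\<integral>\<omega>. G \<omega> * (discount n t \<omega> * w t \<omega>) \<partial>M)) / h"
  proof -
    have "\<forall>\<^sub>F h in at_right 0. h \<in> {0<..<T - t}"
      using t by (intro eventually_at_right_real) auto
    then show ?thesis
    proof eventually_elim
      case (elim h)
      have i: "integrable M (\<lambda>\<omega>. G \<omega> * (discount n s \<omega> * w r \<omega>))" if "0 \<le> s" "0 \<le> r" "r < T" for s r
      proof (rule integrable_const_bound[where B="KG * Cu"])
        have [measurable]: "w r \<in> borel_measurable M" "discount n s \<in> borel_measurable M"
          using that by (auto intro!: measurable_w measurable_discount_M)
        show "(\<lambda>\<omega>. G \<omega> * (discount n s \<omega> * w r \<omega>)) \<in> borel_measurable M" using measurable_G_M by measurable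
        show "AE \<omega> in M. norm (G \<omega> * (discount n s \<omega> * w r \<omega>)) \<le> KG * Cu"
          using abs_G_discount_le abs_w_le[OF that(2,3)] by (intro AE_I2) auto
      qed
      have th: "0 \<le> t + h" "t + h < T" using elim t by auto
      have "(\<integral>\<omega>. G \<omega> * (discount n (t + h) \<omega> * w (t + h) \<omega>) \<partial>M) - (\<integral>\<omega>. G \<omega> * (discount n t \<omega> * w t \<omega>) \<partial>M)
        = ((\<integral>\<omega>. G \<omega> * (discount n (t + h) \<omega> * w (t + h) \<omega>) \<partial>M) - (\<integral>\<omega>. G \<omega> * (discount n t \<omega> * w (t + h) \<omega>) \<partial>M))
        + ((\<integral>\<omega>. G \<omega> * (discount n t \<omega> * w (t + h) \<omega>) \<partial>M) - (\<integral>\<omega>. G \<omega> * (discount n t \<omega> * w t \<omega>) \<partial>M))"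
        by simp
      also have "(\<integral>\<omega>. G \<omega> * (discount n (t + h) \<omega> * w (t + h) \<omega>) \<partial>M) - (\<integral>\<omega>. G \<omega> * (discount n t \<omega> * w (t + h) \<omega>) \<partial>M)
        = (\<integral>\<omega>. h * ?q h \<omega> \<partial>M)"
        unfolding Bochner_Integration.integral_diff[OF i[OF th(1) th] i[OF t(1) th], symmetric]
        using elim by (intro Bochner_Integration.integral_cong refl) (simp add: field_simps)
      also have "\<dots> = h * (\<integral>\<omega>. ?q h \<omega> \<partial>M)" by simp
      also have "(\<integral>\<omega>. G \<omega> * (discount n t \<omega> * w (t + h) \<omega>) \<partial>M) - (\<integral>\<omega>. G \<omega> * (discount n t \<omega> * w t \<omega>) \<partial>M)
        = (\<integral>\<omega>. G \<omega> * discount n t \<omega> * (w (t + h) \<omega> - w t \<omega>) \<partial>M)"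
        unfolding Bochner_Integration.integral_diff[OF i[OF t(1) th] i[OF t(1) t], symmetric]
        by (intro Bochner_Integration.integral_cong refl) (simp add: algebra_simps)
      finally show ?case using elim by (simp add: add_divide_distrib)
    qed
  qed
  ultimately have "((\<lambda>h. ((\<integral>\<omega>. G \<omega> * (discount n (t + h) \<omega> * w (t + h) \<omega>) \<partial>M) - (\<integral>\<omega>. G \<omega> * (discount n t \<omega> * w t \<omega>) \<partial>M)) / h) \<longlongrightarrow>
    (\<integral>\<omega>. G \<omega> * (- (discount n t \<omega> * kt n (X t \<omega>)) * w t \<omega>) \<partial>M) + (\<integral>\<omega>. G \<omega> * discount n t \<omega> * (k (X t \<omega>) * w t \<omega>) \<partial>M)) (at_right 0)"
    by (rule Lim_transform_eventually)
  also have "(\<integral>\<omega>. G \<omega> * (- (discount n t \<omega> * kt n (X t \<omega>)) * w t \<omega>) \<partial>M) + (\<integral>\<omega>. G \<omega> * discount n t \<omega> * (k (X t \<omega>) * w t \<omega>) \<partial>M)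
    = (\<integral>\<omega>. G \<omega> * (discount n t \<omega> * ((k (X t \<omega>) - kt n (X t \<omega>)) * w t \<omega>)) \<partial>M)"
  proof -
    have [measurable]: "w t \<in> borel_measurable M" "discount n t \<in> borel_measurable M" "(\<lambda>\<omega>. kt n (X t \<omega>)) \<in> borel_measurable M"
      "(\<lambda>\<omega>. k (X t \<omega>)) \<in> borel_measurable M"
      using t by (auto intro!: measurable_w measurable_discount_M measurable_fun_X_M kt k)
    have a: "integrable M (\<lambda>\<omega>. G \<omega> * (discount n t \<omega> * (- kt n (X t \<omega>) * w t \<omega>)))"
    proof (rule integrable_const_bound[where B="KG * (n * Cu)"])
      show "AE \<omega> in M. norm (G \<omega> * (discount n t \<omega> * (- kt n (X t \<omega>) * w t \<omega>))) \<le> KG * (n * Cu)"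
        unfolding real_norm_def using abs_w_le[OF t]
        by (intro AE_I2 abs_G_discount_le) (auto simp: abs_mult intro!: mult_mono kt)
    qed (use measurable_G_M in measurable)
    have b: "integrable M (\<lambda>\<omega>. G \<omega> * (discount n t \<omega> * (k (X t \<omega>) * w t \<omega>)))"
    proof (rule integrable_const_bound[where B="KG * Cku"])
      show "AE \<omega> in M. norm (G \<omega> * (discount n t \<omega> * (k (X t \<omega>) * w t \<omega>))) \<le> KG * Cku"
        unfolding real_norm_def using abs_k_w_le[OF t] by (intro AE_I2 abs_G_discount_le) auto
    qed (use measurable_G_M in measurable)
    show ?thesis
      using Bochner_Integration.integral_add[OF a b] by (simp add: algebra_simps)
  qed
  finally show ?thesis .
qed

text \<open>Besides the identity, continuity in time, a bound free of \<open>n\<close>, and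
  measurability of the integrand are stated, because the passage
  \<open>n \<rightarrow> \<infinity>\<close> draws on them.\<close>

lemma expectation_truncated_discount:
  assumes t: "0 \<le> t" "t < T"
  shows "(\<integral>\<omega>. G \<omega> * (discount n t \<omega> * w t \<omega>) \<partial>M) - (\<integral>\<omega>. G \<omega> * (discount n 0 \<omega> * w 0 \<omega>) \<partial>M)
    = integral {0..t} (\<lambda>s. \<integral>\<omega>. G \<omega> * (discount n s \<omega> * ((k (X s \<omega>) - kt n (X s \<omega>)) * w s \<omega>)) \<partial>M)" (is "_ = integral _ ?\<psi>")
    and "continuous_on {0..t} (\<lambda>s. \<integral>\<omega>. G \<omega> * (discount n s \<omega> * ((k (X s \<omega>) - kt n (X s \<omega>)) * w s \<omega>)) \<partial>M)"
    and "s \<in> {0..t} \<Longrightarrow> \<omega> \<in> space M \<Longrightarrow> \<bar>G \<omega> * (discount n s \<omega> * ((k (X s \<omega>) - kt n (X s \<omega>)) * w s \<omega>))\<bar> \<le> KG * Cku"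
    and "s \<in> {0..t} \<Longrightarrow> (\<lambda>\<omega>. G \<omega> * (discount n s \<omega> * ((k (X s \<omega>) - kt n (X s \<omega>)) * w s \<omega>))) \<in> borel_measurable M"
proof -
  let ?f = "\<lambda>s \<omega>. G \<omega> * (discount n s \<omega> * ((k (X s \<omega>) - kt n (X s \<omega>)) * w s \<omega>))"
  have wc: "continuous_on {0..t} (\<lambda>s. w s \<omega>)" if "\<omega> \<in> space M" for \<omega>
    by (rule continuous_on_subset[OF continuous_w[OF that]]) (use t in auto)
  have cX: "continuous_on {0..t} (\<lambda>s. c (X s \<omega>))" if "\<omega> \<in> space M" "continuous_on UNIV c" for \<omega> and c :: "real^'n \<Rightarrow> real"
    by (rule continuous_fun_X[OF that(2,1)]) auto
  show b: "\<bar>?f s \<omega>\<bar> \<le> KG * Cku" if s: "s \<in> {0..t}" and \<omega>: "\<omega> \<in> space M" for s \<omega>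
  proof (rule abs_G_discount_le[OF \<omega>])
    \<comment> \<open>As \<open>0 \<le> kt n \<le> k\<close>, the truncation error is dominated by
      \<open>k\<close> itself, whose product with \<open>w\<close> has a bound free of
      \<open>n\<close>.\<close>
    have "\<bar>(k (X s \<omega>) - kt n (X s \<omega>)) * w s \<omega>\<bar> \<le> \<bar>k (X s \<omega>) * w s \<omega>\<bar>"
      unfolding abs_mult using kt(2,4)[of n "X s \<omega>"] by (intro mult_right_mono) auto
    then show "\<bar>(k (X s \<omega>) - kt n (X s \<omega>)) * w s \<omega>\<bar> \<le> Cku"
      using abs_k_w_le[of s \<omega>] s t by auto
  qed
  show m: "?f s \<in> borel_measurable M" if s: "s \<in> {0..t}" for s
  proof -
    have [measurable]: "w s \<in> borel_measurable M" "discount n s \<in> borel_measurable M" "(\<lambda>\<omega>. kt n (X s \<omega>)) \<in> borel_measurable M"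
      "(\<lambda>\<omega>. k (X s \<omega>)) \<in> borel_measurable M"
      using s t by (auto intro!: measurable_w measurable_discount_M measurable_fun_X_M kt k)
    show ?thesis using measurable_G_M by measurable
  qed
  have "((\<lambda>s. \<integral>\<omega>. ?f s \<omega> \<partial>M) \<longlongrightarrow> (\<integral>\<omega>. ?f s \<omega> \<partial>M)) (at s within {0..t})" if s: "s \<in> {0..t}" for s
  proof (rule bounded_convergence_within[where K="KG * Cku"])
    fix \<omega> assume \<omega>: "\<omega> \<in> space M"
    have "continuous_on {0..t} (\<lambda>s. ?f s \<omega>)"
      by (intro continuous_intros continuous_discount wc cX \<omega> k kt)
    then show "((\<lambda>s. ?f s \<omega>) \<longlongrightarrow> ?f s \<omega>) (at s within {0..t})"
      using s by (auto simp: continuous_on_def)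
  qed (use b m s in \<open>auto intro!: AE_I2\<close>)
  then show c: "continuous_on {0..t} (\<lambda>s. \<integral>\<omega>. ?f s \<omega> \<partial>M)"
    by (auto simp: continuous_on_def)
  have "continuous_on {0..t} (\<lambda>s. \<integral>\<omega>. G \<omega> * (discount n s \<omega> * w s \<omega>) \<partial>M)"
    unfolding continuous_on_def
  proof
    fix s assume s: "s \<in> {0..t}"
    show "((\<lambda>s. \<integral>\<omega>. G \<omega> * (discount n s \<omega> * w s \<omega>) \<partial>M) \<longlongrightarrow> (\<integral>\<omega>. G \<omega> * (discount n s \<omega> * w s \<omega>) \<partial>M)) (at s within {0..t})"
    proof (rule bounded_convergence_within[where K="KG * Cu"])
      fix \<omega> assume \<omega>: "\<omega> \<in> space M"
      have "continuous_on {0..t} (\<lambda>s. G \<omega> * (discount n s \<omega> * w s \<omega>))"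
        by (intro continuous_intros continuous_discount wc \<omega>)
      then show "((\<lambda>s. G \<omega> * (discount n s \<omega> * w s \<omega>)) \<longlongrightarrow> G \<omega> * (discount n s \<omega> * w s \<omega>)) (at s within {0..t})"
        using s by (auto simp: continuous_on_def)
    next
      show "AE \<omega> in M. \<bar>G \<omega> * (discount n r \<omega> * w r \<omega>)\<bar> \<le> KG * Cu" if "r \<in> {0..t} - {s}" for r
        using abs_w_le[of r] that t by (intro AE_I2 abs_G_discount_le) auto
    qed (use s t measurable_G_M in \<open>auto intro!: borel_measurable_times measurable_w measurable_discount_M\<close>)
  qed
  from right_derivative_integral[OF t(1) this c]
  show "(\<integral>\<omega>. G \<omega> * (discount n t \<omega> * w t \<omega>) \<partial>M) - (\<integral>\<omega>. G \<omega> * (discount n 0 \<omega> * w 0 \<omega>) \<partial>M)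
    = integral {0..t} (\<lambda>s. \<integral>\<omega>. ?f s \<omega> \<partial>M)"
    using discounted_right_derivative t by auto
qed

text \<open>The truncation error vanishes eventually on each path. Dominated convergence is applied
  to it twice, first in \<open>\<omega>\<close> for fixed time and then in time.\<close>

lemma expectation_discount_before_T:
  assumes t: "0 \<le> t" "t < T"
  shows "(\<integral>\<omega>. G \<omega> * (exp (- integral {0..t} (\<lambda>r. k (X r \<omega>))) * w t \<omega>) \<partial>M) = (\<integral>\<omega>. G \<omega> * w 0 \<omega> \<partial>M)"
proof -
  let ?f = "\<lambda>n s \<omega>. G \<omega> * (discount n s \<omega> * ((k (X s \<omega>) - kt n (X s \<omega>)) * w s \<omega>))"
  note tr = expectation_truncated_discount[OF t]
  have lim: "(\<lambda>n. integral {0..t} (\<lambda>s. \<integral>\<omega>. ?f n s \<omega> \<partial>M)) \<longlonglongrightarrow> integral {0..t} (\<lambda>s. 0)"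
  proof (rule dominated_convergence(2)[where h="\<lambda>_. KG * Cku"])
    show "(\<lambda>s. \<integral>\<omega>. ?f n s \<omega> \<partial>M) integrable_on {0..t}" for n
      by (rule integrable_continuous_real[OF tr(2)])
    show "norm (\<integral>\<omega>. ?f n s \<omega> \<partial>M) \<le> KG * Cku" if s: "s \<in> {0..t}" for n s
    proof -
      have i: "integrable M (?f n s)"
        by (rule integrable_const_bound[where B="KG * Cku"]) (use tr(3,4)[OF s] in \<open>auto intro!: AE_I2\<close>)
      have "norm (\<integral>\<omega>. ?f n s \<omega> \<partial>M) \<le> (\<integral>\<omega>. norm (?f n s \<omega>) \<partial>M)" by (rule integral_norm_bound)
      also have "\<dots> \<le> (\<integral>\<omega>. KG * Cku \<partial>M)"
        by (rule integral_mono) (use i tr(3)[OF s] in auto)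
      finally show ?thesis by (simp add: prob_space)
    qed
    show "(\<lambda>n. \<integral>\<omega>. ?f n s \<omega> \<partial>M) \<longlonglongrightarrow> 0" if s: "s \<in> {0..t}" for s
    proof -
      have "(\<lambda>n. \<integral>\<omega>. ?f n s \<omega> \<partial>M) \<longlonglongrightarrow> (\<integral>\<omega>. 0 \<partial>M)"
      proof (rule integral_dominated_convergence[where w="\<lambda>_. KG * Cku"])
        show "AE \<omega> in M. (\<lambda>n. ?f n s \<omega>) \<longlonglongrightarrow> 0"
        proof (rule AE_I2)
          fix \<omega> assume "\<omega> \<in> space M"
          then obtain N where N: "\<And>n s. N \<le> n \<Longrightarrow> s \<in> {0..t} \<Longrightarrow> kt n (X s \<omega>) = k (X s \<omega>)"
            using kt_eventually_eq by metis
          then have "\<forall>\<^sub>F n in sequentially. ?f n s \<omega> = 0"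
            using N[OF _ s] by (intro eventually_sequentiallyI[of N]) simp
          then show "(\<lambda>n. ?f n s \<omega>) \<longlonglongrightarrow> 0" by (rule tendsto_eventually)
        qed
      qed (use tr(3,4)[OF s] in \<open>auto intro!: AE_I2\<close>)
      then show ?thesis by simp
    qed
  qed (auto intro: integrable_const_ivl)
  have "discount n 0 \<omega> = 1" for n \<omega> by (simp add: discount_def)
  then have "(\<lambda>n. \<integral>\<omega>. G \<omega> * (discount n t \<omega> * w t \<omega>) \<partial>M) \<longlonglongrightarrow> (\<integral>\<omega>. G \<omega> * w 0 \<omega> \<partial>M) + 0"
    using tendsto_add[OF tendsto_const lim, of "\<integral>\<omega>. G \<omega> * w 0 \<omega> \<partial>M"] by (simp add: tr(1)[symmetric])
  moreover have "(\<lambda>n. \<integral>\<omega>. G \<omega> * (discount n t \<omega> * w t \<omega>) \<partial>M) \<longlonglongrightarrow> (\<integral>\<omega>. G \<omega> * (exp (- integral {0..t} (\<lambda>r. k (X r \<omega>))) * w t \<omega>) \<partial>M)"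
  proof (rule integral_dominated_convergence[where w="\<lambda>_. KG * Cu"])
    have [measurable]: "w t \<in> borel_measurable M" "discount n t \<in> borel_measurable M" "(\<lambda>\<omega>. integral {0..t} (\<lambda>r. k (X r \<omega>))) \<in> borel_measurable M" for n
      using t measurable_F_M[OF t(1) measurable_integral_X[OF k(1) order.refl t(1)]]
      by (auto intro!: measurable_w measurable_discount_M)
    show "(\<lambda>\<omega>. G \<omega> * (exp (- integral {0..t} (\<lambda>r. k (X r \<omega>))) * w t \<omega>)) \<in> borel_measurable M"
      "(\<lambda>\<omega>. G \<omega> * (discount n t \<omega> * w t \<omega>)) \<in> borel_measurable M" for n
      using measurable_G_M by measurable
    show "AE \<omega> in M. (\<lambda>n. G \<omega> * (discount n t \<omega> * w t \<omega>)) \<longlonglongrightarrow> G \<omega> * (exp (- integral {0..t} (\<lambda>r. k (X r \<omega>))) * w t \<omega>)"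
    proof (rule AE_I2)
      fix \<omega> assume "\<omega> \<in> space M"
      then obtain N where N: "\<And>n s. N \<le> n \<Longrightarrow> s \<in> {0..t} \<Longrightarrow> kt n (X s \<omega>) = k (X s \<omega>)"
        using kt_eventually_eq by metis
      have "discount n t \<omega> = exp (- integral {0..t} (\<lambda>r. k (X r \<omega>)))" if "N \<le> n" for n
        unfolding discount_def
        using Henstock_Kurzweil_Integration.integral_cong[of "{0..t}" "\<lambda>r. kt n (X r \<omega>)" "\<lambda>r. k (X r \<omega>)"] N[OF that]
        by simp
      then have "\<forall>\<^sub>F n in sequentially. G \<omega> * (discount n t \<omega> * w t \<omega>) = G \<omega> * (exp (- integral {0..t} (\<lambda>r. k (X r \<omega>))) * w t \<omega>)"
        by (auto simp: eventually_sequentially)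
      then show "(\<lambda>n. G \<omega> * (discount n t \<omega> * w t \<omega>)) \<longlonglongrightarrow> G \<omega> * (exp (- integral {0..t} (\<lambda>r. k (X r \<omega>))) * w t \<omega>)"
        by (rule tendsto_eventually)
    qed
    show "AE \<omega> in M. norm (G \<omega> * (discount n t \<omega> * w t \<omega>)) \<le> KG * Cu" for n
      unfolding real_norm_def using abs_w_le[OF t] by (intro AE_I2 abs_G_discount_le) auto
  qed auto
  ultimately show ?thesis using LIMSEQ_unique by fastforce
qed

text \<open>For \<open>t < T\<close> the discounted expectation is constant in \<open>t\<close>. Its
  limit at \<open>T\<close> is computed a second time from path continuity and
  \<open>tendsto_w_T\<close>, and the two limits agree.\<close>

lemma feynman_kac:
  "(\<integral>\<omega>. G \<omega> * (exp (- integral {0..T} (\<lambda>r. k (X r \<omega>))) * \<psi> (X T \<omega>)) \<partial>M) = (\<integral>\<omega>. G \<omega> * u T (X 0 \<omega>) \<partial>M)"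
proof -
  let ?D = "\<lambda>t \<omega>. exp (- integral {0..t} (\<lambda>r. k (X r \<omega>)))"
  have "((\<lambda>t. \<integral>\<omega>. G \<omega> * (?D t \<omega> * w t \<omega>) \<partial>M) \<longlongrightarrow> (\<integral>\<omega>. G \<omega> * (?D T \<omega> * \<psi> (X T \<omega>)) \<partial>M)) (at T within {0..<T})"
  proof (rule bounded_convergence_within[where K="KG * Cu"])
    fix t assume t: "t \<in> {0..<T} - {T}"
    show "(\<lambda>\<omega>. G \<omega> * (?D t \<omega> * w t \<omega>)) \<in> borel_measurable M"
      using t by (intro borel_measurable_times measurable_G_M measurable_exp_integral_k measurable_w) auto
    show "AE \<omega> in M. \<bar>G \<omega> * (?D t \<omega> * w t \<omega>)\<bar> \<le> KG * Cu"
    proof (rule AE_I2)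
      fix \<omega> assume \<omega>: "\<omega> \<in> space M"
      have "\<bar>?D t \<omega> * w t \<omega>\<bar> \<le> 1 * Cu"
        unfolding abs_mult using exp_integral_k_le_1[OF \<omega>, of t] abs_w_le[of t \<omega>] t by (intro mult_mono) auto
      then show "\<bar>G \<omega> * (?D t \<omega> * w t \<omega>)\<bar> \<le> KG * Cu"
        unfolding abs_mult[of "G \<omega>"] using KG(1) KG(2)[OF \<omega>] by (intro mult_mono) auto
    qed
  next
    show "(\<lambda>\<omega>. G \<omega> * (?D T \<omega> * \<psi> (X T \<omega>))) \<in> borel_measurable M"
      using T by (intro borel_measurable_times measurable_G_M measurable_exp_integral_k measurable_\<psi>_X) auto
  next
    fix \<omega> assume \<omega>: "\<omega> \<in> space M"
    have "continuous_on {0..T} (\<lambda>t. ?D t \<omega>)"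
      by (intro continuous_intros indefinite_integral_continuous_1 integrable_continuous_real continuous_fun_X k \<omega>) auto
    then have "((\<lambda>t. ?D t \<omega>) \<longlongrightarrow> ?D T \<omega>) (at T within {0..<T})"
      using T by (auto simp: continuous_on_def intro: tendsto_within_subset[of _ _ T "{0..T}"])
    then show "((\<lambda>t. G \<omega> * (?D t \<omega> * w t \<omega>)) \<longlongrightarrow> G \<omega> * (?D T \<omega> * \<psi> (X T \<omega>))) (at T within {0..<T})"
      by (intro tendsto_mult tendsto_const tendsto_w_T \<omega>)
  qed
  moreover have "((\<lambda>t. \<integral>\<omega>. G \<omega> * (?D t \<omega> * w t \<omega>) \<partial>M) \<longlongrightarrow> (\<integral>\<omega>. G \<omega> * w 0 \<omega> \<partial>M)) (at T within {0..<T})"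
    by (rule tendsto_eventually) (auto simp: eventually_at_filter expectation_discount_before_T)
  moreover have "at T within {0..<T} \<noteq> bot"
    using T by (simp add: at_within_eq_bot_iff)
  ultimately have "(\<integral>\<omega>. G \<omega> * (?D T \<omega> * \<psi> (X T \<omega>)) \<partial>M) = (\<integral>\<omega>. G \<omega> * w 0 \<omega> \<partial>M)"
    using tendsto_unique by blast
  then show ?thesis by (simp add: w_def)
qed

end

end

section \<open>Minimisation of the mean squared error\<close>

lemma bcontinuous_onE:
  assumes "bcontinuous_on S f"
  obtains B where "0 \<le> B" "\<forall>x\<in>S. norm (f x) \<le> B"
  using assms by (auto simp: bcontinuous_on_def bounded_pos intro: less_imp_le)

lemma bcontinuous_on_const: "bcontinuous_on S (\<lambda>_. c)"
  by (auto simp: bcontinuous_on_def bounded_iff)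

lemma bcontinuous_on_add:
  "bcontinuous_on S f \<Longrightarrow> bcontinuous_on S g \<Longrightarrow> bcontinuous_on S (\<lambda>x. f x + g x)"
  by (simp add: bcontinuous_on_def bounded_plus_comp continuous_on_add)

lemma bcontinuous_on_diff:
  "bcontinuous_on S f \<Longrightarrow> bcontinuous_on S g \<Longrightarrow> bcontinuous_on S (\<lambda>x. f x - g x)"
  by (simp add: bcontinuous_on_def bounded_minus_comp continuous_on_diff)

lemma bcontinuous_on_mult:
  fixes f g :: "'a::topological_space \<Rightarrow> real"
  assumes "bcontinuous_on S f" "bcontinuous_on S g"
  shows "bcontinuous_on S (\<lambda>x. f x * g x)"
proof -
  obtain B where B: "0 \<le> B" "\<forall>x\<in>S. norm (f x) \<le> B" using bcontinuous_onE[OF assms(1)] .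
  obtain C where C: "0 \<le> C" "\<forall>x\<in>S. norm (g x) \<le> C" using bcontinuous_onE[OF assms(2)] .
  have "norm (f x * g x) \<le> B * C" if "x \<in> S" for x
    unfolding norm_mult using B C that by (intro mult_mono) auto
  then show ?thesis using assms by (auto simp: bcontinuous_on_def bounded_iff intro: continuous_on_mult)
qed

lemma bcontinuous_on_sum:
  "(\<And>i. i \<in> I \<Longrightarrow> bcontinuous_on S (f i)) \<Longrightarrow> bcontinuous_on S (\<lambda>x. \<Sum>i\<in>I. f i x)"
  by (induction I rule: infinite_finite_induct) (auto intro: bcontinuous_on_const bcontinuous_on_add)

lemma bcontinuous_on_vec_nth:
  fixes f :: "'a::topological_space \<Rightarrow> ('b::real_normed_vector)^'n::finite"
  assumes "bcontinuous_on S f"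
  shows "bcontinuous_on S (\<lambda>x. f x $ i)"
proof -
  obtain B where "0 \<le> B" "\<forall>x\<in>S. norm (f x) \<le> B" using bcontinuous_onE[OF assms] .
  then have "\<forall>x\<in>S. norm (f x $ i) \<le> B" by (meson Finite_Cartesian_Product.norm_nth_le order_trans)
  then show ?thesis using assms by (auto simp: bcontinuous_on_def bounded_iff intro!: continuous_intros)
qed

lemma bcontinuous_on_vec:
  fixes f :: "'i::finite \<Rightarrow> 'a::topological_space \<Rightarrow> 'b::real_normed_vector"
  assumes "\<And>i. bcontinuous_on S (f i)"
  shows "bcontinuous_on S (\<lambda>x. \<chi> i. f i x)"
proof -
  have "\<exists>B. \<forall>x\<in>S. norm (f i x) \<le> B" for i
    using assms[of i] by (auto simp: bcontinuous_on_def bounded_iff)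
  then obtain B where B: "\<And>i x. x \<in> S \<Longrightarrow> norm (f i x) \<le> B i" by metis
  have "norm (\<chi> i. f i x) \<le> (\<Sum>i\<in>UNIV. B i)" if "x \<in> S" for x
  proof -
    have "norm (\<chi> i. f i x) \<le> (\<Sum>i\<in>UNIV. norm (f i x))"
      using L2_set_le_sum[of UNIV "\<lambda>i. norm (f i x)"] by (simp add: norm_vec_def)
    also have "\<dots> \<le> (\<Sum>i\<in>UNIV. B i)" using B that by (intro sum_mono) auto
    finally show ?thesis .
  qed
  moreover have "continuous_on S (\<lambda>x. \<chi> i. f i x)"
    using assms by (intro continuous_on_vec_lambda) (auto simp: bcontinuous_on_def)
  ultimately show ?thesis by (auto simp: bcontinuous_on_def bounded_iff)
qed

lemma partial_deriv_diffusion_matrix: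
  fixes \<sigma> :: "real^'n::finite \<Rightarrow> real^'m::finite^'n"
  assumes "\<sigma> differentiable (at x)"
  shows "partial_deriv l (\<lambda>y. diffusion_matrix \<sigma> y $ i $ j) x
    = (1 / 2) * (\<Sum>p\<in>UNIV. \<sigma> x $ i $ p * partial_deriv l \<sigma> x $ j $ p + partial_deriv l \<sigma> x $ i $ p * \<sigma> x $ j $ p)"
proof -
  let ?D = "frechet_derivative \<sigma> (at x)"
  have D: "(\<sigma> has_derivative ?D) (at x)" using assms by (simp add: frechet_derivative_works)
  have c: "((\<lambda>y. \<sigma> y $ i $ p) has_derivative (\<lambda>h. ?D h $ i $ p)) (at x)" for i p
    by (rule bounded_linear.has_derivative[OF bounded_linear_vec_nth bounded_linear.has_derivative[OF bounded_linear_vec_nth D]])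
  have "((\<lambda>y. (1 / 2) * (\<Sum>p\<in>UNIV. \<sigma> y $ i $ p * \<sigma> y $ j $ p)) has_derivative
    (\<lambda>h. (1 / 2) * (\<Sum>p\<in>UNIV. \<sigma> x $ i $ p * ?D h $ j $ p + ?D h $ i $ p * \<sigma> x $ j $ p))) (at x)"
    by (intro has_derivative_mult_right has_derivative_sum has_derivative_mult c)
  moreover have "(\<lambda>y. (1 / 2) * (\<Sum>p\<in>UNIV. \<sigma> y $ i $ p * \<sigma> y $ j $ p)) = (\<lambda>y. diffusion_matrix \<sigma> y $ i $ j)"
    by (simp add: diffusion_matrix_def matrix_matrix_mult_def transpose_def)
  ultimately have "((\<lambda>y. diffusion_matrix \<sigma> y $ i $ j) has_derivative
    (\<lambda>h. (1 / 2) * (\<Sum>p\<in>UNIV. \<sigma> x $ i $ p * ?D h $ j $ p + ?D h $ i $ p * \<sigma> x $ j $ p))) (at x)"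
    by simp
  from frechet_derivative_at[OF this, symmetric] show ?thesis
    unfolding partial_deriv_def by simp
qed

text \<open>By the product rule each entry of the divergence is a polynomial in the entries of
  \<open>\<sigma>\<close> and of its first partial derivatives, all of which are bounded and
  continuous.\<close>

lemma bcontinuous_drift_hat:
  fixes f :: "real^'n::finite \<Rightarrow> real^'n" and \<sigma> :: "real^'n \<Rightarrow> real^'m::finite^'n"
  assumes f: "f \<in> C_b 1" and \<sigma>: "\<sigma> \<in> C_b 2"
  shows "bcontinuous_on UNIV (drift_hat f \<sigma>)"
proof -
  have fc: "bcontinuous_on UNIV f" using f by simp
  have \<sigma>c: "bcontinuous_on UNIV \<sigma>" "\<And>x. \<sigma> differentiable (at x)" "\<And>l. bcontinuous_on UNIV (partial_deriv l \<sigma>)"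
    using \<sigma> by (auto simp: numeral_2_eq_2)
  have eq: "drift_hat f \<sigma> = (\<lambda>x. \<chi> j. 2 * (\<Sum>i\<in>UNIV. (1 / 2) * (\<Sum>p\<in>UNIV. \<sigma> x $ i $ p * partial_deriv i \<sigma> x $ j $ p
      + partial_deriv i \<sigma> x $ i $ p * \<sigma> x $ j $ p)) - f x $ j)"
    by (simp add: fun_eq_iff vec_eq_iff drift_hat_def div_vec_def partial_deriv_diffusion_matrix[OF \<sigma>c(2)])
  show ?thesis
    unfolding eq
    by (intro bcontinuous_on_vec bcontinuous_on_diff bcontinuous_on_mult bcontinuous_on_const bcontinuous_on_sum
        bcontinuous_on_add bcontinuous_on_vec_nth \<sigma>c fc)
qed

section \<open>Uniqueness on the support of the uniform distribution\<close>

lemma open_null_set_empty: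
  fixes S :: "'a::euclidean_space set"
  assumes "open S" "emeasure lborel S = 0"
  shows "S = {}"
proof -
  have "S \<in> null_sets lebesgue"
    using assms by (intro null_sets_completionI) (auto simp: null_sets_def)
  then have "negligible S" by (simp add: negligible_iff_null_sets)
  then show ?thesis using open_not_negligible[OF assms(1)] by blast
qed

text \<open>Inside the open box the set of disagreement is open, and an open null set is empty.
  Continuity on the cube then reaches the boundary.\<close>

lemma uniform_null_imp_eq:
  fixes U V :: "real^'n::finite \<Rightarrow> real"
  assumes ab: "a < b" and c: "continuous_on (cube a b) U" "continuous_on (cube a b) V"
    and null: "emeasure (uniform_measure lborel (cube a b)) {x \<in> box (\<chi> i. a) (\<chi> i. b). U x \<noteq> V x} = 0"
    and x: "x \<in> cube a b"
  shows "U x = V x"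
proof -
  let ?B = "box (\<chi> i. a) (\<chi> i. b) :: (real^'n) set"
  let ?S = "{x \<in> ?B. U x \<noteq> V x}"
  have cc: "continuous_on (cube a b) (\<lambda>x. U x - V x)" using c by (intro continuous_intros)
  have sub: "?B \<subseteq> cube a b" by (simp add: cube_def box_subset_cbox)
  have "open (?B \<inter> (\<lambda>x. U x - V x) -` (- {0}))"
    by (rule continuous_open_preimage[OF continuous_on_subset[OF cc sub]]) (auto simp: open_box)
  moreover have "?B \<inter> (\<lambda>x. U x - V x) -` (- {0}) = ?S" by auto
  ultimately have op: "open ?S" by simp
  have "emeasure lborel (cube a b \<inter> ?S) / emeasure lborel (cube a b :: (real^'n) set) = 0"
    using null op by (subst (asm) emeasure_uniform_measure) (auto simp: cube_def)
  \<comment> \<open>A quotient in \<open>ennreal\<close> also vanishes when the denominator is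
    infinite; with this excluded, the numerator is 0.\<close>
  moreover have "emeasure lborel (cube a b :: (real^'n) set) \<noteq> \<top>"
    by (simp add: cube_def emeasure_lborel_cbox_eq)
  moreover have "cube a b \<inter> ?S = ?S" using sub by auto
  ultimately have "emeasure lborel ?S = 0" by (simp add: ennreal_divide_eq_0_iff)
  then have "?S = {}" by (rule open_null_set_empty[OF op])
  then have eq: "U y - V y = 0" if "y \<in> ?B" for y using that by auto
  \<comment> \<open>The midpoint shows the box to be nonempty, without which its closure would not
    be the cube.\<close>
  have "(\<chi> i. (a + b) / 2) \<in> ?B" using ab by (simp add: mem_box_cart)
  then have "?B \<noteq> {}" by blast
  then have "closure ?B = cube a b" by (simp add: cube_def closure_box)
  then have "U x - V x = 0"
    using continuous_constant_on_closure[of ?B "\<lambda>x. U x - V x" 0 x] cc eq x by auto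
  then show ?thesis by simp
qed

context cauchy_sde
begin

text \<open>Pythagoras, with \<open>feynman_kac\<close> removing the cross term for the test
  variable \<open>v (\<xi> \<omega>) - u T (\<xi> \<omega>)\<close>. Since \<open>v\<close> is
  continuous on the cube only, its measurability goes through \<open>restrict_space\<close> and its
  boundedness through compactness.\<close>

lemma risk_decomposition:
  assumes \<xi>: "\<xi> \<in> borel_measurable (F 0)" "\<And>\<omega>. \<omega> \<in> space M \<Longrightarrow> \<xi> \<omega> \<in> cube a b" and X0: "AE \<omega> in M. X 0 \<omega> = \<xi> \<omega>"
    and v: "continuous_on (cube a b) v"
  defines "Y \<equiv> \<lambda>\<omega>. \<psi> (X T \<omega>) * exp (- (LBINT \<tau>:{0..T}. k (X \<tau> \<omega>)))"
  shows "(\<lambda>\<omega>. v (\<xi> \<omega>)) \<in> borel_measurable M"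
    and "integrable M (\<lambda>\<omega>. (v (\<xi> \<omega>) - u T (\<xi> \<omega>))\<^sup>2)"
    and "(\<integral>\<omega>. \<bar>Y \<omega> - v (\<xi> \<omega>)\<bar>\<^sup>2 \<partial>M) = (\<integral>\<omega>. \<bar>Y \<omega> - u T (\<xi> \<omega>)\<bar>\<^sup>2 \<partial>M) + (\<integral>\<omega>. (v (\<xi> \<omega>) - u T (\<xi> \<omega>))\<^sup>2 \<partial>M)"
proof -
  have TT: "T \<in> {0<..T}" using T by simp
  define G where "G \<omega> = v (\<xi> \<omega>) - u T (\<xi> \<omega>)" for \<omega>
  have \<xi>r: "\<xi> \<in> measurable (F 0) (restrict_space borel (cube a b))"
    using \<xi> space_F[of 0] by (intro measurable_restrict_space2) auto
  have vm: "(\<lambda>\<omega>. v (\<xi> \<omega>)) \<in> borel_measurable (F 0)"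
    using measurable_compose[OF \<xi>r borel_measurable_continuous_on_restrict[OF v]] .
  have um: "(\<lambda>\<omega>. u T (\<xi> \<omega>)) \<in> borel_measurable (F 0)"
    using measurable_compose[OF \<xi>(1) borel_measurable_continuous_onI[OF continuous_u[OF TT]]] .
  have Gm0: "G \<in> borel_measurable (F 0)"
    unfolding G_def[abs_def] using vm um by (rule borel_measurable_diff)
  note [measurable] = measurable_F_M[OF order.refl vm] measurable_F_M[OF order.refl um] measurable_F_M[OF order.refl Gm0]
  show "(\<lambda>\<omega>. v (\<xi> \<omega>)) \<in> borel_measurable M" by measurable
  have "bounded (v ` cube a b)"
    unfolding cube_def by (rule compact_imp_bounded[OF compact_continuous_image[OF v[unfolded cube_def] compact_cbox]])
  then obtain Cv where Cv: "0 < Cv" "\<And>x. x \<in> cube a b \<Longrightarrow> \<bar>v x\<bar> \<le> Cv"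
    by (auto simp: bounded_pos)
  define KG where "KG = Cv + Cu"
  have Cu: "0 \<le> Cu" using order_trans[OF abs_ge_zero u(2)[OF TT]] .
  have KG: "0 < KG" "\<And>\<omega>. \<omega> \<in> space M \<Longrightarrow> \<bar>G \<omega>\<bar> \<le> KG"
    using Cv(1) Cu order_trans[OF abs_triangle_ineq4 add_mono[OF Cv(2)[OF \<xi>(2)] u(2)[OF TT]]]
    by (auto simp: KG_def G_def)
  let ?D = "\<lambda>\<omega>. exp (- integral {0..T} (\<lambda>r. k (X r \<omega>)))"
  have Y: "Y \<omega> = ?D \<omega> * \<psi> (X T \<omega>)" if "\<omega> \<in> space M" for \<omega>
    unfolding Y_def using integral_eq_LBINT_X[OF k(1) that order.refl] by simp
  have "(\<lambda>\<omega>. ?D \<omega> * \<psi> (X T \<omega>)) \<in> borel_measurable M"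
    using T by (intro borel_measurable_times measurable_exp_integral_k measurable_\<psi>_X) auto
  then have [measurable]: "Y \<in> borel_measurable M" by (simp add: Y cong: measurable_cong)
  have Yb: "\<bar>Y \<omega>\<bar> \<le> Cu" if "\<omega> \<in> space M" for \<omega>
  proof -
    have "\<bar>Y \<omega>\<bar> \<le> 1 * Cu"
      unfolding Y[OF that] abs_mult using exp_integral_k_le_1[OF that, of T] abs_\<psi>_le by (intro mult_mono) auto
    then show ?thesis by simp
  qed
  have ib: "integrable M f" if "f \<in> borel_measurable M" "\<And>\<omega>. \<omega> \<in> space M \<Longrightarrow> \<bar>f \<omega>\<bar> \<le> C" for f :: "'a \<Rightarrow> real" and C
    using that by (intro integrable_const_bound[where B=C]) auto
  have R: "\<bar>Y \<omega> - u T (\<xi> \<omega>)\<bar> \<le> Cu + Cu" if "\<omega> \<in> space M" for \<omega>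
    by (rule order_trans[OF abs_triangle_ineq4 add_mono[OF Yb[OF that] u(2)[OF TT]]])
  have i1: "integrable M (\<lambda>\<omega>. \<bar>Y \<omega> - u T (\<xi> \<omega>)\<bar>\<^sup>2)"
    by (rule ib[of _ "(Cu + Cu)\<^sup>2"]) (measurable, simp only: abs_power2 power_mono[OF R abs_ge_zero])
  have i2: "integrable M (\<lambda>\<omega>. (G \<omega>)\<^sup>2)"
    by (rule ib[of _ "KG\<^sup>2"]) (measurable, use power_mono[OF KG(2) abs_ge_zero, of _ 2] in \<open>simp only: abs_power2 power2_abs\<close>)
  then show "integrable M (\<lambda>\<omega>. (v (\<xi> \<omega>) - u T (\<xi> \<omega>))\<^sup>2)" by (simp add: G_def)
  have i3: "integrable M (\<lambda>\<omega>. G \<omega> * Y \<omega>)"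
    by (rule ib[of _ "KG * Cu"]) (use KG Yb in \<open>auto simp: abs_mult intro!: mult_mono\<close>)
  have i4: "integrable M (\<lambda>\<omega>. G \<omega> * u T (\<xi> \<omega>))"
    by (rule ib[of _ "KG * Cu"]) (use KG u(2)[OF TT] in \<open>auto simp: abs_mult intro!: mult_mono\<close>)
  have "(\<integral>\<omega>. G \<omega> * Y \<omega> \<partial>M) = (\<integral>\<omega>. G \<omega> * (?D \<omega> * \<psi> (X T \<omega>)) \<partial>M)"
    by (intro Bochner_Integration.integral_cong refl) (simp add: Y)
  also have "\<dots> = (\<integral>\<omega>. G \<omega> * u T (X 0 \<omega>) \<partial>M)"
    by (rule feynman_kac[OF Gm0 KG])
  also have "\<dots> = (\<integral>\<omega>. G \<omega> * u T (\<xi> \<omega>) \<partial>M)"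
  proof (rule integral_cong_AE)
    show "AE \<omega> in M. G \<omega> * u T (X 0 \<omega>) = G \<omega> * u T (\<xi> \<omega>)" using X0 by eventually_elim simp
    have [measurable]: "(\<lambda>\<omega>. u T (X 0 \<omega>)) \<in> borel_measurable M"
      by (rule measurable_fun_X_M[OF continuous_u[OF TT] order.refl])
    show "(\<lambda>\<omega>. G \<omega> * u T (X 0 \<omega>)) \<in> borel_measurable M" by measurable
  qed measurable
  finally have cross: "(\<integral>\<omega>. G \<omega> * Y \<omega> \<partial>M) = (\<integral>\<omega>. G \<omega> * u T (\<xi> \<omega>) \<partial>M)" .
  have eq: "\<bar>Y \<omega> - v (\<xi> \<omega>)\<bar>\<^sup>2 = \<bar>Y \<omega> - u T (\<xi> \<omega>)\<bar>\<^sup>2 + (G \<omega>)\<^sup>2 - 2 * (G \<omega> * Y \<omega> - G \<omega> * u T (\<xi> \<omega>))" for \<omega>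
    by (simp add: G_def power2_eq_square algebra_simps)
  show "(\<integral>\<omega>. \<bar>Y \<omega> - v (\<xi> \<omega>)\<bar>\<^sup>2 \<partial>M) = (\<integral>\<omega>. \<bar>Y \<omega> - u T (\<xi> \<omega>)\<bar>\<^sup>2 \<partial>M) + (\<integral>\<omega>. (v (\<xi> \<omega>) - u T (\<xi> \<omega>))\<^sup>2 \<partial>M)"
    unfolding eq G_def[symmetric] using i1 i2 i3 i4 cross by simp
qed

end

theorem proposition2p4:
  fixes M :: "'a measure" and F :: "real \<Rightarrow> 'a measure"
    and f :: "real^'d \<Rightarrow> real^'d" and \<sigma> :: "real^'d \<Rightarrow> real^'p^'d"
    and T a b :: real and k \<psi> :: "real^'d \<Rightarrow> real" and u :: "real \<Rightarrow> real^'d \<Rightarrow> real"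
    and \<xi> :: "'a \<Rightarrow> real^'d" and W :: "real \<Rightarrow> 'a \<Rightarrow> real^'p" and X :: "real \<Rightarrow> 'a \<Rightarrow> real^'d"
  assumes "filtered_prob_space M F"
    and "f \<in> C_b 1" and "\<sigma> \<in> C_b 2"
    and "0 < T" and "a < b"
    and "continuous_on UNIV k" and "\<And>x. 0 \<le> k x"
    and "at_most_polynomially_growing \<psi>"
    and "u \<in> C_b_1_2 {0<..T}" and "solves_Cauchy_problem f \<sigma> k \<psi> T u"
    and "\<xi> \<in> borel_measurable (F 0)" and "\<And>\<omega>. \<omega> \<in> space M \<Longrightarrow> \<xi> \<omega> \<in> cube a b"
    and "distr M borel \<xi> = uniform_measure lborel (cube a b)"
    and "filtered_prob_space.brownian_motion M F W"
    and "filtered_prob_space.diffusion_generated_by_A_hat M F f \<sigma> W \<xi> X"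
    and "AE \<omega> in M. X 0 \<omega> = \<xi> \<omega>"
  defines "risk \<equiv> \<lambda>v. \<integral>\<omega>. \<bar>\<psi> (X T \<omega>) * exp (- (LBINT \<tau>:{0..T}. k (X \<tau> \<omega>))) - v (\<xi> \<omega>)\<bar>\<^sup>2 \<partial>M"
  shows "(\<exists>!U. U \<in> C_on (cube a b) \<and> risk U = (INF v\<in>C_on (cube a b). risk v)) \<and>
    (\<forall>U. U \<in> C_on (cube a b) \<and> risk U = (INF v\<in>C_on (cube a b). risk v) \<longrightarrow>
       (\<forall>x\<in>cube a b. U x = u T x))"
proof -
  interpret filtered_prob_space M F by fact
  let ?I = "{0<..T}"
  have u: "bcontinuous_on (?I \<times> UNIV) (\<lambda>(t, x). u t x)"
    "\<And>t x. t \<in> ?I \<Longrightarrow> (\<lambda>s. u s x) differentiable (at t within ?I)"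
    "bcontinuous_on (?I \<times> UNIV) (\<lambda>(t, x). time_deriv ?I u t x)"
    "\<And>t x. t \<in> ?I \<Longrightarrow> u t differentiable (at x)"
    "\<And>i. bcontinuous_on (?I \<times> UNIV) (\<lambda>(t, x). partial_deriv i (u t) x)"
    "\<And>t x i. t \<in> ?I \<Longrightarrow> partial_deriv i (u t) differentiable (at x)"
    "\<And>i j. bcontinuous_on (?I \<times> UNIV) (\<lambda>(t, x). partial_deriv i (partial_deriv j (u t)) x)"
    using assms(9) unfolding C_b_1_2_def by blast+
  have gr: "bcontinuous_on (?I \<times> UNIV) (\<lambda>(t, x). grad (u t) x)"
    using bcontinuous_on_vec[OF u(5)] by (simp add: grad_def split_beta')
  have he: "bcontinuous_on (?I \<times> UNIV) (\<lambda>(t, x). Hess (u t) x)"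
    using bcontinuous_on_vec[OF bcontinuous_on_vec[OF u(7)]] by (simp add: Hess_def split_beta')
  have slice: "continuous_on UNIV (h t)" if "bcontinuous_on (?I \<times> UNIV) (\<lambda>(t, x). h t x)" "t \<in> ?I"
    for h :: "real \<Rightarrow> real^'d \<Rightarrow> 'e::real_normed_vector" and t
    using continuous_on_compose2[OF _ continuous_on_Pair[OF continuous_on_const[where c=t] continuous_on_id[of UNIV]], of "?I \<times> UNIV" "\<lambda>(t, x). h t x"]
      that by (auto simp: bcontinuous_on_def image_subset_iff)
  have "\<exists>C. \<forall>t\<in>?I. \<forall>x. \<bar>u t x\<bar> \<le> C"
    by (rule bcontinuous_onE[OF u(1)]) auto
  then obtain Cu where Cu: "\<And>t x. t \<in> ?I \<Longrightarrow> \<bar>u t x\<bar> \<le> Cu" by blast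
  have "\<exists>C. \<forall>t\<in>?I. \<forall>x. \<bar>time_deriv ?I u t x\<bar> \<le> C"
    by (rule bcontinuous_onE[OF u(3)]) auto
  then obtain Ct where Ct: "\<And>t x. t \<in> ?I \<Longrightarrow> \<bar>time_deriv ?I u t x\<bar> \<le> Ct" by blast
  have "\<exists>C. \<forall>t\<in>?I. \<forall>x. norm (grad (u t) x) \<le> C"
    by (rule bcontinuous_onE[OF gr]) auto
  then obtain Kg where Kg: "\<And>t x. t \<in> ?I \<Longrightarrow> norm (grad (u t) x) \<le> Kg" by blast
  have "\<exists>C. \<forall>t\<in>?I. \<forall>x. norm (Hess (u t) x) \<le> C"
    by (rule bcontinuous_onE[OF he]) auto
  then obtain KH where KH: "\<And>t x. t \<in> ?I \<Longrightarrow> norm (Hess (u t) x) \<le> KH" by blast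
  have dr: "bcontinuous_on UNIV (drift_hat f \<sigma>)" by (rule bcontinuous_drift_hat[OF assms(2,3)])
  have "\<exists>C. \<forall>x. norm (drift_hat f \<sigma> x) \<le> C"
    by (rule bcontinuous_onE[OF dr]) auto
  then obtain K\<mu> where K\<mu>: "\<And>x. norm (drift_hat f \<sigma> x) \<le> K\<mu>" by blast
  have \<sigma>c: "bcontinuous_on UNIV \<sigma>" using assms(3) by (simp add: numeral_2_eq_2)
  have "\<exists>C. \<forall>x. norm (\<sigma> x) \<le> C"
    by (rule bcontinuous_onE[OF \<sigma>c]) auto
  then obtain K\<sigma> where K\<sigma>: "\<And>x. norm (\<sigma> x) \<le> K\<sigma>" by blast
  \<comment> \<open>The abstract time derivative becomes \<open>time_deriv\<close> within
    \<open>(0, T]\<close>, one-sided at \<open>T\<close>, and unfolding \<open>A_hat\<close> gives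
    the equation in terms of trace and gradient.\<close>
  interpret cauchy_sde M F W "drift_hat f \<sigma>" \<sigma> \<xi> X K\<mu> K\<sigma> T k \<psi> u "time_deriv ?I u" Cu Ct Kg KH
  proof unfold_locales
    show "brownian_motion W" by fact
    show "solves_SDE (drift_hat f \<sigma>) \<sigma> W \<xi> X" using assms(15) by (simp add: diffusion_generated_by_A_hat_def)
    show "continuous_on UNIV (drift_hat f \<sigma>)" using dr by (simp add: bcontinuous_on_def)
    show "continuous_on UNIV \<sigma>" using \<sigma>c by (simp add: bcontinuous_on_def)
    show "continuous_on (?I \<times> UNIV) (\<lambda>(s, x). u s x)" "continuous_on (?I \<times> UNIV) (\<lambda>(s, x). time_deriv ?I u s x)"
      using u(1,3) by (auto simp: bcontinuous_on_def)
    show "((\<lambda>r. u r x) has_real_derivative time_deriv ?I u s x) (at s within ?I)" if "s \<in> ?I" for s x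
      using u(2)[OF that, of x]
      by (simp add: has_real_derivative_iff_has_vector_derivative time_deriv_def vector_derivative_works[symmetric])
    show "time_deriv ?I u s x + k x * u s x = trace (diffusion_matrix \<sigma> x ** Hess (u s) x) + drift_hat f \<sigma> x \<bullet> grad (u s) x"
      if "s \<in> ?I" for s x
      using assms(10) that by (auto simp: solves_Cauchy_problem_def A_hat_def)
    show "((\<lambda>s. u s x) \<longlongrightarrow> \<psi> x) (at_right 0)" for x
      using assms(10) unfolding solves_Cauchy_problem_def by metis
  qed (use assms K\<mu> K\<sigma> Cu Ct Kg KH u(4,6) slice[OF gr] slice[OF he] in auto)
  \<comment> \<open>The restriction takes the value \<open>undefined\<close> outside the cube, as
    membership in \<open>C_on\<close> demands.\<close>
  define V where "V = restrict (u T) (cube a b)"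
  have VC: "V \<in> C_on (cube a b)"
    using continuous_on_subset[OF continuous_u, of T "cube a b"] assms(4)
    by (auto simp: C_on_def V_def cong: continuous_on_cong)
  have Vu: "x \<in> cube a b \<Longrightarrow> V x = u T x" for x by (simp add: V_def)
  let ?q = "\<lambda>v. \<integral>\<omega>. (v (\<xi> \<omega>) - u T (\<xi> \<omega>))\<^sup>2 \<partial>M"
  have cont: "continuous_on (cube a b) v" if "v \<in> C_on (cube a b)" for v using that by (simp add: C_on_def)
  define R where "R = (\<integral>\<omega>. \<bar>\<psi> (X T \<omega>) * exp (- (LBINT \<tau>:{0..T}. k (X \<tau> \<omega>))) - u T (\<xi> \<omega>)\<bar>\<^sup>2 \<partial>M)"
  have risk: "risk v = R + ?q v" if "v \<in> C_on (cube a b)" for v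
    unfolding risk_def R_def by (rule risk_decomposition(3)[OF assms(11,12,16) cont[OF that]])
  have "?q V = (\<integral>\<omega>. 0 \<partial>M)"
    by (intro Bochner_Integration.integral_cong refl) (simp add: Vu assms(12))
  then have rV: "risk V = R" using risk[OF VC] by simp
  \<comment> \<open>The infimum is attained at \<open>V\<close>, because every risk is
    \<open>R\<close> plus a nonnegative square distance to
    \<open>u T (\<xi> \<omega>)\<close>.\<close>
  have inf: "(INF v\<in>C_on (cube a b). risk v) = R"
  proof (rule cInf_eq_minimum)
    show "R \<in> risk ` C_on (cube a b)" using VC rV by force
    show "R \<le> y" if "y \<in> risk ` C_on (cube a b)" for y
      using that risk by (force intro: integral_nonneg_AE)
  qed
  have uniq: "U x = u T x" if U: "U \<in> C_on (cube a b)" "risk U = R" and x: "x \<in> cube a b" for U x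
  proof (rule uniform_null_imp_eq[OF assms(5) cont[OF U(1)] _ _ x])
    show cu: "continuous_on (cube a b) (u T)"
      using continuous_on_subset[OF continuous_u, of T "cube a b"] assms(4) by simp
    note d = risk_decomposition[OF assms(11,12,16) cont[OF U(1)]]
    \<comment> \<open>A minimiser agrees with \<open>u T\<close> almost surely at
      \<open>\<xi>\<close>; the uniform law of \<open>\<xi>\<close> turns this into a null set in
      the cube.\<close>
    have "?q U = 0" using risk[OF U(1)] U(2) by simp
    then have ae: "AE \<omega> in M. U (\<xi> \<omega>) = u T (\<xi> \<omega>)"
      using integral_nonneg_eq_0_iff_AE[OF d(2)] by simp
    let ?S = "{x \<in> box (\<chi> i. a) (\<chi> i. b). U x \<noteq> u T x}"
    have "open (box (\<chi> i. a) (\<chi> i. b) \<inter> (\<lambda>x. U x - u T x) -` (- {0}))"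
      by (rule continuous_open_preimage[OF continuous_on_subset[OF continuous_on_diff[OF cont[OF U(1)] cu]]])
        (auto simp: cube_def open_box box_subset_cbox)
    moreover have "box (\<chi> i. a) (\<chi> i. b) \<inter> (\<lambda>x. U x - u T x) -` (- {0}) = ?S" by auto
    ultimately have Sb: "?S \<in> sets borel" by (metis borel_open)
    have "emeasure (distr M borel \<xi>) ?S = emeasure M (\<xi> -` ?S \<inter> space M)"
      using measurable_F_M[OF order.refl assms(11)] Sb by (rule emeasure_distr)
    also have "\<dots> = 0"
    proof -
      have "AE \<omega> in M. \<xi> \<omega> \<notin> ?S" using ae by eventually_elim simp
      moreover have "\<xi> -` ?S \<inter> space M \<in> sets M"
        using measurable_F_M[OF order.refl assms(11)] Sb by (rule measurable_sets)
      moreover have "\<xi> -` ?S \<inter> space M = {\<omega> \<in> space M. \<not> \<xi> \<omega> \<notin> ?S}" by auto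
      ultimately show ?thesis by (simp add: AE_iff_measurable)
    qed
    finally show "emeasure (uniform_measure lborel (cube a b)) ?S = 0" using assms(13) by simp
  qed
  \<comment> \<open>Agreement on the cube becomes equality of functions, because both are
    \<open>undefined\<close> outside it.\<close>
  have ext: "U = V" if "U \<in> C_on (cube a b)" "risk U = R" for U
  proof (rule extensionalityI[of U "cube a b"])
    show "U \<in> extensional (cube a b)" "V \<in> extensional (cube a b)"
      using that(1) VC by (auto simp: C_on_def)
    show "U x = V x" if "x \<in> cube a b" for x
      using uniq[OF \<open>U \<in> C_on (cube a b)\<close> \<open>risk U = R\<close> that] Vu[OF that] by simp
  qed
  show ?thesis
    unfolding inf using VC rV ext uniq by blast
qed

end
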